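(* Let $\gamma>-1/2$ and let $\{S_n\}_{n\ge0}$ be the SRRW-RVM with zero mean, unit variance innovation sequence $\{\xi_n\}$, memory sequence $\mu_n=n^\gamma(\log n)^{-(\gamma+1)}$ for $n\ge2$ (with $\mu_1>0$ arbitrary) and recollection probability $p=p_c$. Then, as $n\to\infty$, in the sense of convergence of finite dimensional distributions, $$\left(\frac{S_{\lfloor n^t\rfloor}}{\sqrt{n^t\log n\,\log\log n}}:t>0\right)\to\left((2\gamma+1)\sqrt t\,Z:t>0\right),$$ and $$\left(\frac{S_{\lfloor\exp((\log n)^t)\rfloor}}{\sqrt{\exp((\log n)^t)\,(\log n)^t\,\log\log n}}:t>0\right)\to\left((2\gamma+1)B(t):t>0\right),$$ where $Z$ is a standard normal variable and $(B(t):t\ge0)$ is a standard Brownian motion.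
   Context: Model (SRRW-RVM). Fix $p\in[0,1]$ (recollection probability) and $\gamma>-1$. Let $\{\mu_n\}_{n\ge1}$ (memory sequence) be a sequence of positive reals, regularly varying of index $\gamma$: $\mu_{\lfloor\lambda n\rfloor}/\mu_n\to\lambda^\gamma$ for every $\lambda>0$. Put $\nu_n=\sum_{k=1}^n\mu_k$. Let $\{\xi_n\}_{n\ge1}$ (innovation sequence) be i.i.d. real random variables with mean $0$; $\{\alpha_n\}_{n\ge2}$ i.i.d. Bernoulli($p$); $\{\beta_n\}_{n\ge2}$ independent with $\mathbb{P}(\beta_n=k)=\mu_k/\nu_{n-1}$ for $1\le k\le n-1$; the three sequences are independent of each other. Set $X_1=\xi_1$ and, for $n\ge1$, $X_{n+1}=\alpha_{n+1}X_{\beta_{n+1}}+(1-\alpha_{n+1})\xi_{n+1}$. The walk is $S_0=0$, $S_n=\sum_{k=1}^nX_k$. $p_c=(\gamma+\frac12)/(\gamma+1)$. *)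

theory Defs
  imports "HOL-Probability.Probability"
begin

section \<open>Convergence of finite-dimensional distributions\<close>

definition weakly_converges ::
    "'a topology \<Rightarrow> (nat \<Rightarrow> 'a measure) \<Rightarrow> 'a measure \<Rightarrow> bool" where
  "weakly_converges T L L' \<longleftrightarrow>
     (\<forall>f. continuous_map T euclideanreal f \<and> bounded (f ` topspace T) \<longrightarrow>
        (\<lambda>n. \<integral>x. f x \<partial>L n) \<longlonglongrightarrow> (\<integral>x. f x \<partial>L'))"

text \<open>The joint law of \<open>(X (t 0), \<dots>, X (t (k - 1)))\<close>. Vectors of \<open>\<real>\<^sup>k\<close> are extensional functions
  on \<open>{..<k}\<close>, so that \<open>k\<close> can be quantified over.\<close>

definition fin_dim_law ::
    "'a measure \<Rightarrow> ('t \<Rightarrow> 'a \<Rightarrow> real) \<Rightarrow> nat \<Rightarrow> (nat \<Rightarrow> 't) \<Rightarrow> (nat \<Rightarrow> real) measure" where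
  "fin_dim_law M X k t =
     distr M (Pi\<^sub>M {..<k} (\<lambda>_. borel)) (\<lambda>\<omega>. \<lambda>i\<in>{..<k}. X (t i) \<omega>)"

definition fdd_converges ::
    "'t set \<Rightarrow> 'a measure \<Rightarrow> (nat \<Rightarrow> 't \<Rightarrow> 'a \<Rightarrow> real) \<Rightarrow> 'b measure \<Rightarrow> ('t \<Rightarrow> 'b \<Rightarrow> real) \<Rightarrow> bool" where
  "fdd_converges I M X N Y \<longleftrightarrow>
     (\<forall>k t. (\<forall>i<k. t i \<in> I) \<longrightarrow>
        weakly_converges (product_topology (\<lambda>_. euclideanreal) {..<k})
          (\<lambda>n. fin_dim_law M (X n) k t) (fin_dim_law N Y k t))"

section \<open>Standard Brownian motion\<close>

locale standard_brownian_motion = prob_space N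
  for N :: "'b measure" +
  fixes B :: "real \<Rightarrow> 'b \<Rightarrow> real"
  assumes random_variable_B: "s \<ge> 0 \<Longrightarrow> random_variable borel (B s)"
    and start_zero: "AE \<omega> in N. B 0 \<omega> = 0"
    and independent_increments:
      "0 \<le> t 0 \<Longrightarrow> (\<And>i. i < k \<Longrightarrow> t i \<le> t (Suc i)) \<Longrightarrow>
         indep_vars (\<lambda>_. borel) (\<lambda>i \<omega>. B (t (Suc i)) \<omega> - B (t i) \<omega>) {..<k::nat}"
    and normal_increments:
      "0 \<le> s \<Longrightarrow> s < u \<Longrightarrow>
         distributed N lborel (\<lambda>\<omega>. B u \<omega> - B s \<omega>) (normal_density 0 (sqrt (u - s)))"
    and continuous_paths: "AE \<omega> in N. continuous_on {0..} (\<lambda>t. B t \<omega>)"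

section \<open>The step-reinforced random walk with regularly varying memory\<close>

definition regularly_varying :: "(nat \<Rightarrow> real) \<Rightarrow> real \<Rightarrow> bool" where
  "regularly_varying \<mu> \<gamma> \<longleftrightarrow>
     (\<forall>c>0. (\<lambda>n. \<mu> (nat \<lfloor>c * real n\<rfloor>) / \<mu> n) \<longlonglongrightarrow> c powr \<gamma>)"

definition total_memory :: "(nat \<Rightarrow> real) \<Rightarrow> nat \<Rightarrow> real" where
  "total_memory \<mu> n = (\<Sum>k=1..n. \<mu> k)"

definition generated_events ::
    "'a measure \<Rightarrow> 'c measure \<Rightarrow> (nat \<Rightarrow> 'a \<Rightarrow> 'c) \<Rightarrow> nat set \<Rightarrow> 'a set set" where
  "generated_events M M' Y I =
     sigma_sets (space M) (\<Union>n\<in>I. {Y n -` A \<inter> space M | A. A \<in> sets M'})"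

text \<open>The sequences are indexed from \<open>1\<close> (\<open>\<mu>\<close>, \<open>\<xi>\<close>, \<open>X\<close>) or from \<open>2\<close> (\<open>\<alpha>\<close>, \<open>\<beta>\<close>); their values at
  smaller indices are irrelevant. The law of \<open>\<beta> n\<close> only forces \<open>1 \<le> \<beta> n \<le> n - 1\<close> almost surely,
  hence the recursion is required almost surely and the steps are assumed measurable.\<close>

locale srrw_rvm = prob_space M
  for M :: "'a measure" +
  fixes p \<gamma> :: real
    and \<mu> :: "nat \<Rightarrow> real"
    and \<xi> :: "nat \<Rightarrow> 'a \<Rightarrow> real"
    and \<alpha> :: "nat \<Rightarrow> 'a \<Rightarrow> bool"
    and \<beta> :: "nat \<Rightarrow> 'a \<Rightarrow> nat"
    and X :: "nat \<Rightarrow> 'a \<Rightarrow> real"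
  assumes p_range: "0 \<le> p" "p \<le> 1"
    and gamma_range: "\<gamma> > -1"
    and memory_pos: "n \<ge> 1 \<Longrightarrow> \<mu> n > 0"
    and memory_regularly_varying: "regularly_varying \<mu> \<gamma>"
    and innovation_indep: "indep_vars (\<lambda>_. borel) \<xi> {1..}"
    and innovation_ident: "n \<ge> 1 \<Longrightarrow> distr M borel (\<xi> n) = distr M borel (\<xi> 1)"
    and innovation_integrable: "integrable M (\<xi> 1)"
    and innovation_mean: "expectation (\<xi> 1) = 0"
    and recollection_indep: "indep_vars (\<lambda>_. count_space UNIV) \<alpha> {2..}"
    and recollection_law:
      "n \<ge> 2 \<Longrightarrow> distr M (count_space UNIV) (\<alpha> n) = measure_pmf (bernoulli_pmf p)"
    and memory_indep: "indep_vars (\<lambda>_. count_space UNIV) \<beta> {2..}"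
    and memory_law:
      "n \<ge> 2 \<Longrightarrow> 1 \<le> k \<Longrightarrow> k \<le> n - 1 \<Longrightarrow>
         prob {\<omega> \<in> space M. \<beta> n \<omega> = k} = \<mu> k / total_memory \<mu> (n - 1)"
    and sequences_indep:
      "indep_sets (\<lambda>j. [generated_events M borel \<xi> {1..},
                        generated_events M (count_space UNIV) \<alpha> {2..},
                        generated_events M (count_space UNIV) \<beta> {2..}] ! j) {..<3::nat}"
    and step_random_variable: "n \<ge> 1 \<Longrightarrow> random_variable borel (X n)"
    and first_step: "AE \<omega> in M. X 1 \<omega> = \<xi> 1 \<omega>"
    and next_step:
      "n \<ge> 1 \<Longrightarrow> AE \<omega> in M. X (n + 1) \<omega> =
         of_bool (\<alpha> (n + 1) \<omega>) * X (\<beta> (n + 1) \<omega>) \<omega> + (1 - of_bool (\<alpha> (n + 1) \<omega>)) * \<xi> (n + 1) \<omega>"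

definition walk :: "(nat \<Rightarrow> 'a \<Rightarrow> real) \<Rightarrow> nat \<Rightarrow> 'a \<Rightarrow> real" where
  "walk X n \<omega> = (\<Sum>k=1..n. X k \<omega>)"

definition critical_prob :: "real \<Rightarrow> real" where
  "critical_prob \<gamma> = (\<gamma> + 1 / 2) / (\<gamma> + 1)"

end

theory Submission
  imports Defs "HOL-Real_Asymp.Real_Asymp"
begin

text \<open>
  Write \<open>Y\<^sub>n = \<mu>\<^sub>1 X\<^sub>1 + \<dots> + \<mu>\<^sub>n X\<^sub>n\<close> and \<open>a\<^sub>n = \<Prod>\<^sub>k\<^sub><\<^sub>n (1 + p \<mu>\<^sub>k\<^sub>+\<^sub>1 / \<nu>\<^sub>k)\<close>. Then \<open>M\<^sub>n = Y\<^sub>n / a\<^sub>n\<close> is a martingale, and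
  at criticality its increments have variance of order \<open>1 / (n log n)\<close>, so \<open>M\<close> evolves on the clock
  \<open>log log n\<close>. Since \<open>X\<^sub>k\<^sub>+\<^sub>1 - p Y\<^sub>k / \<nu>\<^sub>k\<close> is a martingale difference, summation by parts gives
  \<open>S\<^sub>n = R\<^sub>n M\<^sub>n\<close> up to an error of variance \<open>O(n log n)\<close>, with \<open>R\<^sub>n\<close> deterministic of order \<open>sqrt (n log n)\<close>.
  The time \<open>n powr t\<close> does not move the clock to leading order, whence the single normal variable;
  the time \<open>exp ((log n) powr t)\<close> multiplies it by \<open>t\<close>, whence Brownian motion.

  The increments of \<open>M\<close> are treated by a Lindeberg replacement of characteristic functions, uniformly
  over events of the past. The law of large numbers it needs for the squared steps comes for free: they
  are again steps of a reinforced walk, for which the same variance bound holds. Unbounded innovations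
  are truncated, which is harmless because \<open>M\<close> depends linearly on the innovations.
\<close>

section \<open>Asymptotics of the normalising sequences\<close>

text \<open>At criticality \<open>p * (\<gamma> + 1) = \<gamma> + 1/2\<close>, and this exponent
  makes the weight \<open>\<mu> n / growth \<mu> p n\<close> of order
  \<open>1 / sqrt (n * ln n)\<close>: its squares just fail to be summable. The growth is known only
  up to a constant factor that may depend on the whole memory sequence, including the arbitrary
  \<open>\<mu> 1\<close>. This factor enters \<open>c\<close> and \<open>\<rho>\<close> inversely
  and cancels in \<open>\<rho> * sqrt c = 2 * \<gamma> + 1\<close>, the only combination seen by the
  limits. Conditional expectations are never formed. Every conditional identity is an expectation
  against a test function \<open>G\<close> of the past; complex \<open>G\<close> can carry an event
  together with the exponentials of earlier increments. The conditional variance of an increment is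
  random. Controlling it by the variance bound for the squared steps takes fourth moments of the
  innovations, which is a second reason, besides the cubic Taylor remainder, for treating bounded
  innovations first. Joint limits come from the one-dimensional Levy theorem, one coordinate at a
  time, on events determined by the preceding coordinates.\<close>

lemma stolz_cesaro:
  fixes s g :: "nat \<Rightarrow> real"
  assumes inc: "\<forall>\<^sub>F n in sequentially. g n < g (Suc n)"
    and g: "filterlim g at_top sequentially"
    and lim: "(\<lambda>n. (s (Suc n) - s n) / (g (Suc n) - g n)) \<longlonglongrightarrow> l"
  shows "(\<lambda>n. s n / g n) \<longlonglongrightarrow> l"
proof (rule LIMSEQ_I)
  fix e :: real assume e: "e > 0"
  have "\<forall>\<^sub>F n in sequentially. dist ((s (Suc n) - s n) / (g (Suc n) - g n)) l < e / 2"
    using tendstoD[OF lim, of "e/2"] e by simp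
  with inc have "\<forall>\<^sub>F n in sequentially. g n < g (Suc n) \<and>
      \<bar>(s (Suc n) - l * g (Suc n)) - (s n - l * g n)\<bar> \<le> e / 2 * (g (Suc n) - g n)"
  proof eventually_elim
    case (elim n)
    have "(s (Suc n) - l * g (Suc n)) - (s n - l * g n) =
        ((s (Suc n) - s n) / (g (Suc n) - g n) - l) * (g (Suc n) - g n)"
      using elim by (simp add: field_simps)
    also have "\<bar>\<dots>\<bar> \<le> e / 2 * (g (Suc n) - g n)"
      using elim by (simp add: abs_mult dist_real_def)
    finally show ?case using elim by simp
  qed
  then obtain K where K: "\<And>n. n \<ge> K \<Longrightarrow> \<bar>(s (Suc n) - l * g (Suc n)) - (s n - l * g n)\<bar> \<le> e / 2 * (g (Suc n) - g n)"
    unfolding eventually_sequentially by blast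
  define C where "C = \<bar>s K - l * g K\<bar> + e / 2 * \<bar>g K\<bar>"
  have bound: "\<bar>(s n - l * g n) - (s K - l * g K)\<bar> \<le> e / 2 * (g n - g K)" if "n \<ge> K" for n
    using that
  proof (induction n rule: dec_induct)
    case (step n)
    have "\<bar>(s (Suc n) - l * g (Suc n)) - (s K - l * g K)\<bar> \<le>
        \<bar>(s (Suc n) - l * g (Suc n)) - (s n - l * g n)\<bar> + \<bar>(s n - l * g n) - (s K - l * g K)\<bar>"
      by linarith
    also have "\<dots> \<le> e / 2 * (g (Suc n) - g n) + e / 2 * (g n - g K)"
      using K[of n] step by (intro add_mono) auto
    finally show ?case by argo
  qed simp
  have "\<forall>\<^sub>F n in sequentially. g n > max 1 (2 * C / e)"
    using g unfolding filterlim_at_top_dense by blast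
  then have "\<forall>\<^sub>F n in sequentially. norm (s n / g n - l) < e"
    using eventually_ge_at_top[of K]
  proof eventually_elim
    case (elim n)
    have "\<bar>s n - l * g n\<bar> \<le> C + e / 2 * g n"
    proof -
      have "- (e / 2 * g K) \<le> e / 2 * \<bar>g K\<bar>"
        using e by (metis abs_ge_minus_self abs_mult abs_of_pos half_gt_zero)
      moreover have "e / 2 * (g n - g K) = e / 2 * g n - e / 2 * g K" by (rule right_diff_distrib)
      ultimately show ?thesis using bound[OF elim(2)] unfolding C_def by linarith
    qed
    also have "\<dots> < e * g n" using elim(1) e by (simp add: field_simps)
    finally show ?case using elim(1) by (simp add: field_simps abs_less_iff)
  qed
  then show "\<exists>no. \<forall>n\<ge>no. norm (s n / g n - l) < e"
    unfolding eventually_sequentially .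
qed

text \<open>Stolz-Cesaro with \<open>g\<close> the partial sums of the weights: the quotient of the
  differences is \<open>d n\<close> itself.\<close>

lemma weighted_average_tendsto_0:
  fixes w d :: "nat \<Rightarrow> real"
  assumes "\<And>n. w n > 0" "filterlim (\<lambda>n. \<Sum>k<n. w k) at_top sequentially" "d \<longlonglongrightarrow> 0"
  shows "(\<lambda>n. (\<Sum>k<n. w k * d k) / (\<Sum>k<n. w k)) \<longlonglongrightarrow> 0"
proof (rule stolz_cesaro)
  have "w n \<noteq> 0" for n using assms(1)[of n] by simp
  then show "(\<lambda>n. ((\<Sum>k<Suc n. w k * d k) - (\<Sum>k<n. w k * d k)) / ((\<Sum>k<Suc n. w k) - (\<Sum>k<n. w k))) \<longlonglongrightarrow> 0"
    using assms(3) by simp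
qed (use assms in auto)


section \<open>The normalising sequences and their critical asymptotics\<close>

definition growth :: "(nat \<Rightarrow> real) \<Rightarrow> real \<Rightarrow> nat \<Rightarrow> real" where
  "growth \<mu> p n = (\<Prod>k=1..<n. 1 + p * (\<mu> (Suc k) / total_memory \<mu> k))"

definition mart_weight :: "(nat \<Rightarrow> real) \<Rightarrow> real \<Rightarrow> nat \<Rightarrow> real" where
  "mart_weight \<mu> p n = \<mu> n / growth \<mu> p n"

text \<open>For unit step variance this bounds the variance accumulated by the martingale between
  the times \<open>1\<close> and \<open>n\<close>; in particular it is \<open>0\<close> at
  \<open>n = 1\<close>.\<close>

definition clock :: "(nat \<Rightarrow> real) \<Rightarrow> real \<Rightarrow> nat \<Rightarrow> real" where
  "clock \<mu> p n = (\<Sum>k=1..<n. (mart_weight \<mu> p (Suc k))\<^sup>2)"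

text \<open>The \<open>R\<^sub>n\<close> of the overview. The conditional mean
  \<open>p * Y\<^sub>k / \<nu>\<^sub>k\<close> of step \<open>k + 1\<close> is
  \<open>p * (a\<^sub>k / \<nu>\<^sub>k)\<close> times the martingale at \<open>k\<close>, and these
  coefficients are added up.\<close>

definition drift_sum :: "(nat \<Rightarrow> real) \<Rightarrow> real \<Rightarrow> nat \<Rightarrow> real" where
  "drift_sum \<mu> p n = (\<Sum>k=1..<n. p * (growth \<mu> p k / total_memory \<mu> k))"

lemma total_memory_Suc: "total_memory \<mu> (Suc n) = total_memory \<mu> n + \<mu> (Suc n)"
  by (simp add: total_memory_def)

lemma total_memory_pos:
  assumes "\<And>n. n \<ge> 1 \<Longrightarrow> \<mu> n > 0" "n \<ge> 1"
  shows "total_memory \<mu> n > 0"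
  unfolding total_memory_def using assms by (intro sum_pos) auto

lemma growth_Suc:
  "n \<ge> 1 \<Longrightarrow> growth \<mu> p (Suc n) = growth \<mu> p n * (1 + p * (\<mu> (Suc n) / total_memory \<mu> n))"
  by (simp add: growth_def)

lemma growth_pos:
  assumes "\<And>n. n \<ge> 1 \<Longrightarrow> \<mu> n > 0" "p \<ge> 0"
  shows "growth \<mu> p n > 0"
  unfolding growth_def
proof (intro prod_pos)
  fix k assume "k \<in> {1..<n}"
  then have "\<mu> (Suc k) / total_memory \<mu> k > 0"
    using assms total_memory_pos[where \<mu>=\<mu> and n=k] by (intro divide_pos_pos) auto
  then show "0 < 1 + p * (\<mu> (Suc k) / total_memory \<mu> k)"
    using assms(2) by (intro add_pos_nonneg mult_nonneg_nonneg) auto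
qed

lemma clock_Suc: "n \<ge> 1 \<Longrightarrow> clock \<mu> p (Suc n) = clock \<mu> p n + (mart_weight \<mu> p (Suc n))\<^sup>2"
  by (simp add: clock_def)

lemma drift_sum_Suc:
  "n \<ge> 1 \<Longrightarrow> drift_sum \<mu> p (Suc n) = drift_sum \<mu> p n + p * (growth \<mu> p n / total_memory \<mu> n)"
  by (simp add: drift_sum_def)

text \<open>The lower bound is \<open>ln y \<le> y - 1\<close> at \<open>y = 1 / (1 + x)\<close>,
  which gives \<open>ln (1 + x) \<ge> x / (1 + x) \<ge> x - x^2\<close>.\<close>

lemma abs_ln_one_plus_minus_le:
  fixes x :: real
  assumes "x \<ge> 0"
  shows "\<bar>ln (1 + x) - x\<bar> \<le> x\<^sup>2"
proof -
  have "ln (inverse (1 + x)) \<le> inverse (1 + x) - 1"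
    using assms by (intro ln_le_minus_one) auto
  moreover have "1 - inverse (1 + x) \<ge> x - x\<^sup>2"
    using assms by (simp add: field_simps power2_eq_square)
  ultimately have "ln (1 + x) \<ge> x - x\<^sup>2" using assms by (simp add: ln_inverse)
  moreover have "ln (1 + x) \<le> x" using assms by (intro ln_add_one_self_le_self)
  ultimately show ?thesis by (simp add: abs_le_iff)
qed

text \<open>Since \<open>ln (1 + p * u) - p * ln (1 + u) = O(u\<^sup>2)\<close>, the ratio \<open>growth / total_memory powr p\<close>
  converges as soon as the ratios \<open>u\<close> are square summable.\<close>

lemma growth_asymp:
  assumes pos: "\<And>n. n \<ge> 1 \<Longrightarrow> \<mu> n > 0" and p: "0 \<le> p" "p \<le> 1"
    and lim: "(\<lambda>n. \<mu> (Suc n) / total_memory \<mu> n * real n) \<longlonglongrightarrow> q"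
  obtains C where "C > 0" "(\<lambda>n. growth \<mu> p n / total_memory \<mu> n powr p) \<longlonglongrightarrow> C"
proof -
  define u where "u n = \<mu> (Suc n) / total_memory \<mu> n" for n
  define h where "h n = ln (growth \<mu> p n) - p * ln (total_memory \<mu> n)" for n
  have nu: "total_memory \<mu> n > 0" if "n \<ge> 1" for n using total_memory_pos pos that by blast
  have gp: "growth \<mu> p n > 0" for n using growth_pos pos p(1) by blast
  have u: "u n > 0" if "n \<ge> 1" for n using that pos nu by (simp add: u_def)
  have step: "h (Suc n) - h n = ln (1 + p * u n) - p * ln (1 + u n)" if n: "n \<ge> 1" for n
  proof -
    have "total_memory \<mu> (Suc n) = total_memory \<mu> n * (1 + u n)"
      using nu[OF n] by (simp add: u_def total_memory_Suc field_simps)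
    moreover have "growth \<mu> p (Suc n) = growth \<mu> p n * (1 + p * u n)"
      using growth_Suc[OF n] by (simp add: u_def)
    moreover have "1 + p * u n > 0" using u[OF n] p by (intro add_pos_nonneg) auto
    ultimately have "ln (total_memory \<mu> (Suc n)) = ln (total_memory \<mu> n) + ln (1 + u n)"
      and "ln (growth \<mu> p (Suc n)) = ln (growth \<mu> p n) + ln (1 + p * u n)"
      using u[OF n] nu[OF n] gp[of n] by (simp_all add: ln_mult)
    then show ?thesis unfolding h_def by (simp add: distrib_left)
  qed
  have bound: "\<bar>h (Suc n) - h n\<bar> \<le> 2 * (u n)\<^sup>2" if n: "n \<ge> 1" for n
  proof -
    have "\<bar>ln (1 + p * u n) - p * u n\<bar> \<le> (p * u n)\<^sup>2"
      using u[OF n] p by (intro abs_ln_one_plus_minus_le) auto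
    also have "\<dots> \<le> (u n)\<^sup>2" using u[OF n] p by (intro power_mono) (auto simp: mult_left_le_one_le)
    finally have 1: "\<bar>ln (1 + p * u n) - p * u n\<bar> \<le> (u n)\<^sup>2" .
    have "\<bar>p * (ln (1 + u n) - u n)\<bar> \<le> 1 * (u n)\<^sup>2"
      unfolding abs_mult using u[OF n] p
      by (intro mult_mono abs_ln_one_plus_minus_le) auto
    then show ?thesis unfolding step[OF n] using 1 by (simp add: algebra_simps)
  qed
  \<comment> \<open>Convergence of \<open>u n * n\<close> makes it bounded, so
    \<open>(u n)^2\<close> is at most a multiple of \<open>1 / n^2\<close>.\<close>
  obtain K where "K > 0" "\<And>n. norm (\<mu> (Suc n) / total_memory \<mu> n * real n) \<le> K"
    using convergent_imp_Bseq[OF convergentI[OF lim]] by (elim BseqE) blast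
  then have "\<forall>\<^sub>F n in sequentially. norm (\<mu> (Suc n) / total_memory \<mu> n * real n) \<le> K"
    by simp
  then have "\<forall>\<^sub>F n in sequentially. norm (h (Suc n) - h n) \<le> 2 * K\<^sup>2 * (1 / real n ^ 2)"
    using eventually_ge_at_top[of 1]
  proof eventually_elim
    case (elim n)
    have "(u n * real n)\<^sup>2 \<le> K\<^sup>2"
      using elim \<open>K > 0\<close> by (intro power2_le_iff_abs_le[THEN iffD2]) (auto simp: u_def)
    then have "(u n)\<^sup>2 \<le> K\<^sup>2 / real n ^ 2"
      using elim(2) by (simp add: field_simps power_mult_distrib)
    then show ?case using bound[OF elim(2)] by simp
  qed
  moreover have "summable (\<lambda>n. 2 * K\<^sup>2 * (1 / real n ^ 2))"
    by (intro summable_mult) (use inverse_power_summable[of 2] in \<open>simp add: divide_inverse\<close>)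
  ultimately have "summable (\<lambda>n. h (Suc n) - h n)"
    by (rule summable_comparison_test_ev)
  then have "(\<lambda>n. \<Sum>k<n. h (Suc k) - h k) \<longlonglongrightarrow> (\<Sum>k. h (Suc k) - h k)"
    by (rule summable_LIMSEQ)
  then have "(\<lambda>n. (h n - h 0) + h 0) \<longlonglongrightarrow> (\<Sum>k. h (Suc k) - h k) + h 0"
    by (intro tendsto_add tendsto_const) (simp add: sum_lessThan_telescope)
  then have "(\<lambda>n. exp (h n)) \<longlonglongrightarrow> exp ((\<Sum>k. h (Suc k) - h k) + h 0)"
    by (intro tendsto_exp) simp
  moreover have "\<forall>\<^sub>F n in sequentially. exp (h n) = growth \<mu> p n / total_memory \<mu> n powr p"
    using eventually_ge_at_top[of 1]
  proof eventually_elim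
    case (elim n)
    then show ?case using nu[OF elim] gp[of n] by (simp add: h_def exp_diff powr_def)
  qed
  ultimately show ?thesis
    using that[of "exp ((\<Sum>k. h (Suc k) - h k) + h 0)"] by (simp add: tendsto_cong)
qed

text \<open>Collects the asymptotic information about \<open>\<mu>\<close> on which the
  probabilistic part relies. The \<open>2\<close> in the last limit reflects that the sum of
  \<open>sqrt (ln k / k)\<close> up to \<open>n\<close> is asymptotic to
  \<open>2 * sqrt (n * ln n)\<close>; summing the last sequence, times \<open>p\<close>, gives the
  third limit.\<close>

definition critical_regime :: "(nat \<Rightarrow> real) \<Rightarrow> real \<Rightarrow> real \<Rightarrow> real \<Rightarrow> bool" where
  "critical_regime \<mu> p c \<rho> \<longleftrightarrow> c > 0 \<and> \<rho> > 0
     \<and> (\<lambda>n. (mart_weight \<mu> p n)\<^sup>2 * (real n * ln (real n))) \<longlonglongrightarrow> c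
     \<and> (\<lambda>n. clock \<mu> p n / ln (ln (real n))) \<longlonglongrightarrow> c
     \<and> (\<lambda>n. drift_sum \<mu> p n / sqrt (real n * ln (real n))) \<longlonglongrightarrow> \<rho>
     \<and> (\<lambda>n. growth \<mu> p n / total_memory \<mu> n * sqrt (real n / ln (real n))) \<longlonglongrightarrow> \<rho> / (2 * p)"

text \<open>With \<open>q = \<gamma> + 1\<close> criticality reads \<open>p * q = q - 1/2\<close>.
  The total memory grows like \<open>(n / ln n) powr q / q\<close>, hence \<open>growth\<close> like
  a constant times \<open>(n / ln n) powr (q - 1/2)\<close>. Dividing
  \<open>\<mu> n = n powr (q - 1) * ln n powr (- q)\<close> by it leaves a constant times
  \<open>1 / sqrt (n * ln n)\<close>.\<close>

lemma critical_asymptotics: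
  fixes \<gamma> p :: real
  assumes \<gamma>: "\<gamma> > - 1 / 2" and pos: "\<And>n. n \<ge> 1 \<Longrightarrow> \<mu> n > 0"
    and \<mu>: "\<And>n. n \<ge> 2 \<Longrightarrow> \<mu> n = real n powr \<gamma> * ln (real n) powr (- (\<gamma> + 1))"
    and p: "p = critical_prob \<gamma>"
  obtains c \<rho> where "critical_regime \<mu> p c \<rho>" "\<rho> * sqrt c = 2 * \<gamma> + 1"
proof -
  define q where "q = \<gamma> + 1"
  have q: "q > 1 / 2" using \<gamma> by (simp add: q_def)
  have pq: "p = (q - 1/2) / q" by (simp add: p critical_prob_def q_def)
  have p01: "0 < p" "p < 1" using q by (auto simp: pq field_simps)
  \<comment> \<open>The integral of the memory to leading order: the derivative of
    \<open>(x / ln x) powr q / q\<close> is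
    \<open>x powr (q - 1) * ln x powr (- q) * (1 - 1 / ln x)\<close>.\<close>
  define f where "f n = (real n / ln (real n)) powr q / q" for n
  let ?nu = "total_memory \<mu>"
  have nu: "?nu n > 0" if "n \<ge> 1" for n using total_memory_pos pos that by blast
  have gp: "growth \<mu> p n > 0" for n using growth_pos pos p01 by (meson less_imp_le)
  have ev\<mu>: "\<forall>\<^sub>F n in sequentially. \<mu> n = real n powr (q - 1) * ln (real n) powr (- q)"
    using eventually_ge_at_top[of 2] by eventually_elim (simp add: \<mu> q_def)
  have nu_f: "(\<lambda>n. ?nu n / f n) \<longlonglongrightarrow> 1"
  proof (rule stolz_cesaro)
    show "\<forall>\<^sub>F n in sequentially. f n < f (Suc n)" unfolding f_def using q by real_asymp
    show "filterlim f at_top sequentially" unfolding f_def using q by real_asymp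
    have "(\<lambda>n. real (Suc n) powr (q-1) * ln (real (Suc n)) powr (-q)/ (f (Suc n) - f n)) \<longlonglongrightarrow> 1"
      unfolding f_def using q by real_asymp
    moreover have "\<forall>\<^sub>F n in sequentially. real (Suc n) powr (q-1) * ln (real (Suc n)) powr (-q) / (f (Suc n) - f n) =
       (?nu (Suc n) - ?nu n) / (f (Suc n) - f n)"
      using eventually_ge_at_top[of 2] by eventually_elim (simp add: \<mu> q_def total_memory_Suc)
    ultimately show "(\<lambda>n. (?nu (Suc n) - ?nu n) / (f (Suc n) - f n)) \<longlonglongrightarrow> 1"
      by (rule Lim_transform_eventually)
  qed
  have f_pos: "\<forall>\<^sub>F n in sequentially. f n > 0" unfolding f_def using q by real_asymp
  have "(\<lambda>n. real (Suc n) powr (q-1) * ln (real (Suc n)) powr (-q) / f n * real n) \<longlonglongrightarrow> q"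
    unfolding f_def using q by real_asymp
  then have "(\<lambda>n. real (Suc n) powr (q-1) * ln (real (Suc n)) powr (-q) / f n * real n / (?nu n / f n)) \<longlonglongrightarrow> q / 1"
    by (intro tendsto_divide nu_f) auto
  moreover have "\<forall>\<^sub>F n in sequentially. real (Suc n) powr (q-1) * ln (real (Suc n)) powr (-q) / f n * real n / (?nu n / f n)
      = \<mu> (Suc n) / ?nu n * real n"
    using eventually_ge_at_top[of 2] f_pos by eventually_elim (simp add: \<mu> q_def)
  ultimately have "(\<lambda>n. \<mu> (Suc n) / ?nu n * real n) \<longlonglongrightarrow> q / 1"
    by (rule Lim_transform_eventually)
  then obtain C where C: "C > 0" "(\<lambda>n. growth \<mu> p n / ?nu n powr p) \<longlonglongrightarrow> C"
    using growth_asymp[of \<mu> p "q / 1", OF pos] p01 by auto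
  have nu_ev: "\<forall>\<^sub>F n in sequentially. ?nu n > 0"
    using eventually_ge_at_top[of 1] by eventually_elim (rule nu)
  \<comment> \<open>Both constants are read off from \<open>growth\<close> being asymptotic to
    \<open>C * f n powr p\<close>, where \<open>f n\<close> carries the factor
    \<open>1 / q\<close>.\<close>
  define c where "c = (q powr p / C)\<^sup>2"
  define \<rho> where "\<rho> = 2 * p * C * q powr (1 - p)"
  have c0: "c > 0" and \<rho>0: "\<rho> > 0" using q C p01 by (auto simp: c_def \<rho>_def)
  have "\<rho> * sqrt c = 2 * p * (q powr (1 - p) * q powr p)"
    using C q by (simp add: c_def \<rho>_def real_sqrt_abs)
  also have "q powr (1 - p) * q powr p = q" using q by (simp add: powr_add[symmetric])
  also have "2 * p * q = 2 * \<gamma> + 1" using q unfolding pq by (simp add: q_def)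
  finally have \<rho>c: "\<rho> * sqrt c = 2 * \<gamma> + 1" .

  \<comment> \<open>\<open>growth\<close> is split into \<open>f n powr p\<close>,
    \<open>(?nu n / f n) powr p\<close> and \<open>growth / ?nu n powr p\<close>. The last two
    converge, so only the explicit first factor has to be simplified.\<close>
  have b: "(\<lambda>n. (mart_weight \<mu> p n)\<^sup>2 * (real n * ln (real n))) \<longlonglongrightarrow> c"
  proof -
    have "(\<lambda>n. (real n powr (q - 1) * ln (real n) powr (- q) / f n powr p)\<^sup>2 * (real n * ln (real n))) \<longlonglongrightarrow> (q powr p)\<^sup>2"
    proof (rule Lim_transform_eventually[OF tendsto_const])
      show "\<forall>\<^sub>F n in sequentially. (q powr p)\<^sup>2 = (real n powr (q - 1) * ln (real n) powr (- q) / f n powr p)\<^sup>2 * (real n * ln (real n))"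
        using eventually_ge_at_top[of 2]
      proof eventually_elim
        case (elim n)
        define x l where "x = real n" and "l = ln (real n)"
        have xl: "x > 0" "l > 0" "ln x = l" using elim by (auto simp: x_def l_def)
        have 1: "f n powr p = x powr (q - 1/2) * l powr (- (q - 1/2)) / q powr p"
        proof -
          have "f n powr p = ((x / l) powr q) powr p / q powr p"
            using xl q by (simp add: f_def x_def[symmetric] powr_divide[of "(x / l) powr q"])
          also have "((x / l) powr q) powr p = (x / l) powr (q - 1/2)"
            using q by (simp add: powr_powr pq)
          also have "\<dots> = x powr (q - 1/2) * l powr (- (q - 1/2))"
            using xl by (simp add: powr_divide powr_minus_divide del: minus_diff_eq)
          finally show ?thesis .
        qed
        have "(x powr (q - 1) * l powr (- q) / f n powr p) = q powr p * (x powr (q - 1 - (q - 1/2)) * l powr (- q + (q - 1/2)))"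
          unfolding 1 powr_diff[of x "q - 1"] powr_add[of l "- q" "q - 1/2"]
          using xl q by (simp add: powr_minus field_simps del: minus_diff_eq)
        also have "\<dots> = q powr p / (sqrt x * sqrt l)"
          using xl by (simp add: powr_minus powr_half_sqrt field_simps)
        finally show ?case using xl q by (simp add: x_def l_def power_mult_distrib power_divide)
      qed
    qed
    then have "(\<lambda>n. (real n powr (q - 1) * ln (real n) powr (- q) / f n powr p)\<^sup>2 * (real n * ln (real n)) /
       ((?nu n / f n) powr p * (growth \<mu> p n / ?nu n powr p))\<^sup>2) \<longlonglongrightarrow> (q powr p)\<^sup>2 / (1 powr p * C)\<^sup>2"
      using C by (intro tendsto_intros nu_f) auto
    moreover have "\<forall>\<^sub>F n in sequentially. (real n powr (q - 1) * ln (real n) powr (- q) / f n powr p)\<^sup>2 * (real n * ln (real n)) /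
       ((?nu n / f n) powr p * (growth \<mu> p n / ?nu n powr p))\<^sup>2 = (mart_weight \<mu> p n)\<^sup>2 * (real n * ln (real n))"
      using f_pos ev\<mu> nu_ev
    proof eventually_elim
      case (elim n)
      have "(real n powr (q - 1) * ln (real n) powr (- q) / f n powr p)\<^sup>2 * (real n * ln (real n)) /
       ((?nu n / f n) powr p * (growth \<mu> p n / ?nu n powr p))\<^sup>2 =
        (\<mu> n / f n powr p / ((?nu n / f n) powr p * (growth \<mu> p n / ?nu n powr p)))\<^sup>2 * (real n * ln (real n))"
        unfolding elim(2)[symmetric] by (simp only: power_divide[of "\<mu> n / f n powr p"] times_divide_eq_left)
      also have "\<mu> n / f n powr p / ((?nu n / f n) powr p * (growth \<mu> p n / ?nu n powr p)) = mart_weight \<mu> p n"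
        using elim gp[of n] by (simp add: mart_weight_def powr_divide field_simps)
      finally show ?case .
    qed
    ultimately show ?thesis
      unfolding c_def by (simp add: power_divide tendsto_cong)
  qed

  have r: "(\<lambda>n. growth \<mu> p n / ?nu n * sqrt (real n / ln (real n))) \<longlonglongrightarrow> \<rho> / (2 * p)"
  proof -
    have "(\<lambda>n. f n powr (p - 1) * sqrt (real n / ln (real n))) \<longlonglongrightarrow> q powr (1 - p)"
    proof (rule Lim_transform_eventually[OF tendsto_const])
      show "\<forall>\<^sub>F n in sequentially. q powr (1 - p) = f n powr (p - 1) * sqrt (real n / ln (real n))"
        using eventually_ge_at_top[of 2]
      proof eventually_elim
        case (elim n)
        define z where "z = real n / ln (real n)"
        have z: "z > 0" using elim by (auto simp: z_def)
        have e: "q * (p - 1) = - (1/2)" using q by (simp add: pq field_simps)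
        have "f n powr (p - 1) = z powr (q * (p - 1)) / q powr (p - 1)"
          using z q by (simp add: f_def z_def[symmetric] powr_divide powr_powr)
        also have "\<dots> = q powr (1 - p) / sqrt z" 
          unfolding e using z q by (simp add: powr_minus powr_half_sqrt powr_diff field_simps)
        finally show ?case using z by (simp add: z_def[symmetric])
      qed
    qed
    then have "(\<lambda>n. (?nu n / f n) powr (p - 1) * (growth \<mu> p n / ?nu n powr p) * (f n powr (p - 1) * sqrt (real n / ln (real n))))
       \<longlonglongrightarrow> 1 powr (p - 1) * C * q powr (1 - p)"
      using C by (intro tendsto_intros nu_f) auto
    moreover have "\<forall>\<^sub>F n in sequentially. (?nu n / f n) powr (p - 1) * (growth \<mu> p n / ?nu n powr p) * (f n powr (p - 1) * sqrt (real n / ln (real n)))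
      = growth \<mu> p n / ?nu n * sqrt (real n / ln (real n))"
      using f_pos nu_ev
    proof eventually_elim
      case (elim n)
      have "(?nu n / f n) powr (p - 1) * f n powr (p - 1) = ?nu n powr p / ?nu n"
        using elim by (simp add: powr_divide powr_diff)
      then have "(?nu n / f n) powr (p - 1) * f n powr (p - 1) / ?nu n powr p = 1 / ?nu n"
        using elim by simp
      then show ?case using elim by (simp add: field_simps)
    qed
    ultimately show ?thesis
      using p01 unfolding \<rho>_def by (simp add: tendsto_cong)
  qed

  have "(\<lambda>n. clock \<mu> p n / ln (ln (real n))) \<longlonglongrightarrow> c * 1"
  proof (rule stolz_cesaro)
    show "\<forall>\<^sub>F n in sequentially. ln (ln (real n)) < ln (ln (real (Suc n)))" by real_asymp
    show "filterlim (\<lambda>n. ln (ln (real n))) at_top sequentially" by real_asymp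
    have "(\<lambda>n. (1/ (real (Suc n) * ln (real (Suc n)))) / (ln (ln (real (Suc n))) - ln (ln (real n)))) \<longlonglongrightarrow> 1"
      by real_asymp
    then have "(\<lambda>n. ((mart_weight \<mu> p (Suc n))\<^sup>2 * (real (Suc n) * ln (real (Suc n)))) *
        ((1/ (real (Suc n) * ln (real (Suc n)))) / (ln (ln (real (Suc n))) - ln (ln (real n))))) \<longlonglongrightarrow> c * 1"
      by (intro tendsto_mult LIMSEQ_Suc[OF b])
    moreover have "\<forall>\<^sub>F n in sequentially. ((mart_weight \<mu> p (Suc n))\<^sup>2 * (real (Suc n) * ln (real (Suc n)))) *
        ((1/ (real (Suc n) * ln (real (Suc n)))) / (ln (ln (real (Suc n))) - ln (ln (real n)))) =
        (clock \<mu> p (Suc n) - clock \<mu> p n) / (ln (ln (real (Suc n))) - ln (ln (real n)))"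
      using eventually_ge_at_top[of 2] by eventually_elim (simp add: clock_Suc)
    ultimately show "(\<lambda>n. (clock \<mu> p (Suc n) - clock \<mu> p n) / (ln (ln (real (Suc n))) - ln (ln (real n)))) \<longlonglongrightarrow> c * 1"
      by (rule Lim_transform_eventually)
  qed
  then have clock: "(\<lambda>n. clock \<mu> p n / ln (ln (real n))) \<longlonglongrightarrow> c" by simp

  have "(\<lambda>n. drift_sum \<mu> p n / sqrt (real n * ln (real n))) \<longlonglongrightarrow> p * (\<rho> / (2 * p)) * 2"
  proof (rule stolz_cesaro)
    show "\<forall>\<^sub>F n in sequentially. sqrt (real n * ln (real n)) < sqrt (real (Suc n) * ln (real (Suc n)))" by real_asymp
    show "filterlim (\<lambda>n. sqrt (real n * ln (real n))) at_top sequentially" by real_asymp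
    have "(\<lambda>n. (sqrt (ln (real n) / n)) / (sqrt (real (Suc n) * ln (real (Suc n))) - sqrt (real n * ln (real n)))) \<longlonglongrightarrow> 2"
      by real_asymp
    then have "(\<lambda>n. p * (growth \<mu> p n / ?nu n * sqrt (real n / ln (real n))) *
        ((sqrt (ln (real n) / n)) / (sqrt (real (Suc n) * ln (real (Suc n))) - sqrt (real n * ln (real n))))) \<longlonglongrightarrow> p * (\<rho> / (2 * p)) * 2"
      by (intro tendsto_mult r tendsto_const)
    moreover have "\<forall>\<^sub>F n in sequentially. p * (growth \<mu> p n / ?nu n * sqrt (real n / ln (real n))) *
        ((sqrt (ln (real n) / n)) / (sqrt (real (Suc n) * ln (real (Suc n))) - sqrt (real n * ln (real n)))) =
        (drift_sum \<mu> p (Suc n) - drift_sum \<mu> p n) / (sqrt (real (Suc n) * ln (real (Suc n))) - sqrt (real n * ln (real n)))"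
      using eventually_ge_at_top[of 2]
    proof eventually_elim
      case (elim n)
      have "sqrt (real n / ln (real n)) * sqrt (ln (real n) / n) = 1"
        using elim by (simp add: real_sqrt_mult[symmetric])
      then show ?case using elim by (simp add: drift_sum_Suc mult.assoc)
    qed
    ultimately show "(\<lambda>n. (drift_sum \<mu> p (Suc n) - drift_sum \<mu> p n) / (sqrt (real (Suc n) * ln (real (Suc n))) - sqrt (real n * ln (real n)))) \<longlonglongrightarrow> p * (\<rho> / (2 * p)) * 2"
      by (rule Lim_transform_eventually)
  qed
  then have "(\<lambda>n. drift_sum \<mu> p n / sqrt (real n * ln (real n))) \<longlonglongrightarrow> \<rho>"
    using p01 by simp
  then have "critical_regime \<mu> p c \<rho>" using c0 \<rho>0 b clock r by (simp add: critical_regime_def)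
  then show ?thesis using \<rho>c by (rule that)
qed

section \<open>Asymptotically Gaussian vectors\<close>

text \<open>Levy's theorem, applied under the density \<open>(1 + 1\<^sub>A) / (1 + P A)\<close>, which stays bounded away from
  zero even if the probability of \<open>A\<close> does not.\<close>

lemma weighted_levy_continuity_aux:
  fixes U :: "nat \<Rightarrow> 'a \<Rightarrow> real" and h :: "real \<Rightarrow> real"
  assumes "prob_space M" and [measurable]: "\<And>n. U n \<in> borel_measurable M" "\<And>n. A n \<in> sets M"
    and lim: "\<And>\<theta>. (\<lambda>n. \<integral>\<omega>. iexp (\<theta> * U n \<omega>) \<partial>M) \<longlonglongrightarrow> exp (- (\<theta>\<^sup>2) / 2)"
    and limA: "\<And>\<theta>. (\<lambda>n. (\<integral>\<omega>. indicator (A n) \<omega> * iexp (\<theta> * U n \<omega>) \<partial>M)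
                 - measure M (A n) * exp (- (\<theta>\<^sup>2) / 2)) \<longlonglongrightarrow> 0"
    and h: "continuous_on UNIV h" "\<And>x. \<bar>h x\<bar> \<le> B"
  shows "(\<lambda>n. (\<integral>\<omega>. h (U n \<omega>) \<partial>M) + (\<integral>\<omega>. indicator (A n) \<omega> * h (U n \<omega>) \<partial>M)
            - (1 + measure M (A n)) * (\<integral>y. h y \<partial>std_normal_distribution)) \<longlonglongrightarrow> 0"
proof -
  interpret prob_space M by fact
  define z where "z n = 1 + prob (A n)" for n
  define w where "w n \<omega> = (1 + indicator (A n) \<omega>) / z n" for n \<omega>
  define Q where "Q n = density M (\<lambda>\<omega>. ennreal (w n \<omega>))" for n
  have z: "z n \<ge> 1" "z n \<le> 2" for n by (auto simp: z_def)
  have [measurable]: "w n \<in> borel_measurable M" for n unfolding w_def by measurable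
  have w0: "w n \<omega> \<ge> 0" for n \<omega> using z[of n] by (auto simp: w_def)
  have [measurable]: "h \<in> borel_measurable borel" using h(1) by (rule borel_measurable_continuous_onI)
  have int_w: "(\<integral>\<omega>. w n \<omega> \<partial>M) = 1" "integrable M (w n)" for n
  proof -
    have ind: "integrable M (indicat_real (A n))" by (rule integrable_const_bound[of _ 1]) auto
    then show "integrable M (w n)" unfolding w_def by (intro integrable_divide Bochner_Integration.integrable_add) auto
    show "(\<integral>\<omega>. w n \<omega> \<partial>M) = 1" unfolding w_def using z[of n] ind
      by (subst integral_divide_zero, subst Bochner_Integration.integral_add) (simp_all add: prob_space z_def[symmetric])
  qed
  have Q: "prob_space (Q n)" for n
  proof
    have "emeasure (Q n) (space (Q n)) = (\<integral>\<^sup>+ \<omega>. ennreal (w n \<omega>) \<partial>M)"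
      by (simp add: Q_def emeasure_density cong: nn_integral_cong)
    also have "\<dots> = 1" using int_w w0 by (subst nn_integral_eq_integral) auto
    finally show "emeasure (Q n) (space (Q n)) = 1" .
  qed
  have sQ [measurable_cong]: "sets (Q n) = sets M" for n by (simp add: Q_def)
  define L where "L n = distr (Q n) borel (U n)" for n
  have rL: "real_distribution (L n)" for n
    unfolding L_def by (intro prob_space.real_distribution_distr[OF Q]) measurable
  have int_L: "(\<integral>x. g x \<partial>L n) = ((\<integral>\<omega>. g (U n \<omega>) \<partial>M) + (\<integral>\<omega>. indicator (A n) \<omega> *\<^sub>R g (U n \<omega>) \<partial>M)) /\<^sub>R z n"
    if [measurable]: "g \<in> borel_measurable borel" and g: "\<And>x. norm (g x) \<le> C"
    for g :: "real \<Rightarrow> 'c::{banach, second_countable_topology}" and C n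
  proof -
    have int: "integrable M (\<lambda>\<omega>. g (U n \<omega>))" by (rule integrable_const_bound[of _ C]) (use g in auto)
    have intA: "integrable M (\<lambda>\<omega>. indicator (A n) \<omega> *\<^sub>R g (U n \<omega>))"
      by (intro integrable_mult_indicator int) auto
    have "(\<integral>x. g x \<partial>L n) = (\<integral>\<omega>. w n \<omega> *\<^sub>R g (U n \<omega>) \<partial>M)"
      unfolding L_def Q_def using w0 by (subst integral_distr) (auto simp: integral_density)
    also have "\<dots> = (\<integral>\<omega>. (g (U n \<omega>) + indicator (A n) \<omega> *\<^sub>R g (U n \<omega>)) /\<^sub>R z n \<partial>M)"
      by (intro Bochner_Integration.integral_cong) (auto simp: w_def divide_inverse scaleR_add_left algebra_simps)
    also have "\<dots> = ((\<integral>\<omega>. g (U n \<omega>) \<partial>M) + (\<integral>\<omega>. indicator (A n) \<omega> *\<^sub>R g (U n \<omega>) \<partial>M)) /\<^sub>R z n"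
      using int intA by simp
    finally show ?thesis .
  qed
  have "weak_conv_m L std_normal_distribution"
  proof (rule levy_continuity[OF rL real_dist_normal_dist])
    fix t :: real
    have "char (L n) t - exp (- (t\<^sup>2) / 2) = (((\<integral>\<omega>. iexp (t * U n \<omega>) \<partial>M) - exp (- (t\<^sup>2) / 2)) +
       ((\<integral>\<omega>. indicator (A n) \<omega> * iexp (t * U n \<omega>) \<partial>M) - measure M (A n) * exp (- (t\<^sup>2) / 2))) /\<^sub>R z n" for n
    proof -
      have "char (L n) t = ((\<integral>\<omega>. iexp (t * U n \<omega>) \<partial>M) + (\<integral>\<omega>. indicator (A n) \<omega> *\<^sub>R iexp (t * U n \<omega>) \<partial>M)) /\<^sub>R z n"
        unfolding char_def by (rule int_L[of _ 1]) auto
      also have "(\<integral>\<omega>. indicator (A n) \<omega> *\<^sub>R iexp (t * U n \<omega>) \<partial>M) = (\<integral>\<omega>. indicator (A n) \<omega> * iexp (t * U n \<omega>) \<partial>M)"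
        by (intro Bochner_Integration.integral_cong) (auto simp: indicator_def)
      finally show ?thesis
      proof (simp only:)
        have alg: "(a + b) /\<^sub>R z n - e = ((a - e) + (b - prob (A n) * e)) /\<^sub>R z n" for a b e :: complex
        proof -
          have "complex_of_real (prob (A n)) = complex_of_real (z n) - 1" by (simp add: z_def)
          moreover have "complex_of_real (z n) \<noteq> 0" using z[of n] by auto
          ultimately show ?thesis by (simp only: scaleR_conv_of_real of_real_inverse) (simp add: field_simps)
        qed
        show "(a + b) /\<^sub>R z n - exp (- (t\<^sup>2) / 2) =
          ((a - exp (- (t\<^sup>2) / 2)) + (b - prob (A n) * exp (- (t\<^sup>2) / 2))) /\<^sub>R z n" for a b :: complex
          using alg[of a b "exp (- (t\<^sup>2) / 2)"] by simp
      qed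
    qed
    moreover have "(\<lambda>n. (((\<integral>\<omega>. iexp (t * U n \<omega>) \<partial>M) - exp (- (t\<^sup>2) / 2)) +
       ((\<integral>\<omega>. indicator (A n) \<omega> * iexp (t * U n \<omega>) \<partial>M) - measure M (A n) * exp (- (t\<^sup>2) / 2))) /\<^sub>R z n) \<longlonglongrightarrow> 0"
    proof (rule Lim_null_comparison)
      show "(\<lambda>n. norm (((\<integral>\<omega>. iexp (t * U n \<omega>) \<partial>M) - exp (- (t\<^sup>2) / 2)) +
       ((\<integral>\<omega>. indicator (A n) \<omega> * iexp (t * U n \<omega>) \<partial>M) - measure M (A n) * exp (- (t\<^sup>2) / 2)))) \<longlonglongrightarrow> 0"
        using tendsto_add[OF LIM_zero[OF lim] limA] by (intro tendsto_norm_zero) simp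
      have shrink: "norm (a /\<^sub>R z n) \<le> norm a" for a :: complex and n
        using z[of n] by (simp add: mult_left_le_one_le inverse_le_1_iff)
      show "\<forall>\<^sub>F n in sequentially. norm ((((\<integral>\<omega>. iexp (t * U n \<omega>) \<partial>M) - exp (- (t\<^sup>2) / 2)) +
       ((\<integral>\<omega>. indicator (A n) \<omega> * iexp (t * U n \<omega>) \<partial>M) - measure M (A n) * exp (- (t\<^sup>2) / 2))) /\<^sub>R z n)
        \<le> norm (((\<integral>\<omega>. iexp (t * U n \<omega>) \<partial>M) - exp (- (t\<^sup>2) / 2)) +
       ((\<integral>\<omega>. indicator (A n) \<omega> * iexp (t * U n \<omega>) \<partial>M) - measure M (A n) * exp (- (t\<^sup>2) / 2)))"
        by (intro always_eventually allI shrink)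
    qed
    ultimately have "(\<lambda>n. char (L n) t - exp (- (t\<^sup>2) / 2)) \<longlonglongrightarrow> 0" by simp
    then show "(\<lambda>n. char (L n) t) \<longlonglongrightarrow> char std_normal_distribution t"
      by (simp add: char_std_normal_distribution Lim_null[symmetric] exp_of_real[symmetric])
  qed
  then have "(\<lambda>n. (\<integral>x. h x \<partial>L n)) \<longlonglongrightarrow> (\<integral>y. h y \<partial>std_normal_distribution)"
    using h by (intro weak_conv_imp_integral_bdd_continuous_conv[OF rL real_dist_normal_dist])
      (auto simp: continuous_on_eq_continuous_at)
  then have "(\<lambda>n. (\<integral>x. h x \<partial>L n) - (\<integral>y. h y \<partial>std_normal_distribution)) \<longlonglongrightarrow> 0"
    by (rule LIM_zero)
  then have "(\<lambda>n. z n * ((\<integral>x. h x \<partial>L n) - (\<integral>y. h y \<partial>std_normal_distribution))) \<longlonglongrightarrow> 0"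
  proof (rule Lim_null_comparison[rotated, OF tendsto_mult_right_zero[OF tendsto_rabs_zero, where c=2]])
    show "\<forall>\<^sub>F n in sequentially. norm (z n * ((\<integral>x. h x \<partial>L n) - (\<integral>y. h y \<partial>std_normal_distribution)))
      \<le> 2 * \<bar>(\<integral>x. h x \<partial>L n) - (\<integral>y. h y \<partial>std_normal_distribution)\<bar>"
    proof (intro always_eventually allI)
      fix n
      show "norm (z n * ((\<integral>x. h x \<partial>L n) - (\<integral>y. h y \<partial>std_normal_distribution)))
        \<le> 2 * \<bar>(\<integral>x. h x \<partial>L n) - (\<integral>y. h y \<partial>std_normal_distribution)\<bar>"
        using z[of n] by (auto simp: abs_mult intro!: mult_right_mono)
    qed
  qed
  moreover have "z n * ((\<integral>x. h x \<partial>L n) - (\<integral>y. h y \<partial>std_normal_distribution)) =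
     (\<integral>\<omega>. h (U n \<omega>) \<partial>M) + (\<integral>\<omega>. indicator (A n) \<omega> * h (U n \<omega>) \<partial>M)
            - (1 + measure M (A n)) * (\<integral>y. h y \<partial>std_normal_distribution)" for n
  proof -
    have "z n * (\<integral>x. h x \<partial>L n) = (\<integral>\<omega>. h (U n \<omega>) \<partial>M) + (\<integral>\<omega>. indicator (A n) \<omega> * h (U n \<omega>) \<partial>M)"
      using int_L[of h B n] h z[of n] by simp
    then show ?thesis by (simp only: right_diff_distrib z_def[symmetric])
  qed
  ultimately show ?thesis by simp
qed

text \<open>With empty events the auxiliary lemma is the plain convergence of the mean of
  \<open>h\<close>; subtracting this case leaves the contribution of \<open>A n\<close>.\<close>

lemma weighted_levy_continuity:
  fixes U :: "nat \<Rightarrow> 'a \<Rightarrow> real" and h :: "real \<Rightarrow> real"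
  assumes "prob_space M" "\<And>n. U n \<in> borel_measurable M" "\<And>n. A n \<in> sets M"
    and "\<And>\<theta>. (\<lambda>n. \<integral>\<omega>. iexp (\<theta> * U n \<omega>) \<partial>M) \<longlonglongrightarrow> exp (- (\<theta>\<^sup>2) / 2)"
    and "\<And>\<theta>. (\<lambda>n. (\<integral>\<omega>. indicator (A n) \<omega> * iexp (\<theta> * U n \<omega>) \<partial>M)
                 - measure M (A n) * exp (- (\<theta>\<^sup>2) / 2)) \<longlonglongrightarrow> 0"
    and "continuous_on UNIV h" "\<And>x. \<bar>h x\<bar> \<le> B"
  shows "(\<lambda>n. (\<integral>\<omega>. indicator (A n) \<omega> * h (U n \<omega>) \<partial>M)
            - measure M (A n) * (\<integral>y. h y \<partial>std_normal_distribution)) \<longlonglongrightarrow> 0"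
  using tendsto_diff[OF weighted_levy_continuity_aux[OF assms]
      weighted_levy_continuity_aux[OF assms(1,2) _ assms(4) _ assms(6,7), of "\<lambda>_. {}"]]
  by (simp add: algebra_simps)

section \<open>Continuity on boxes in the space of real sequences\<close>

lemma tendsto_fun_iff:
  fixes f :: "'c \<Rightarrow> 'i \<Rightarrow> 'b::topological_space"
  shows "(f \<longlongrightarrow> l) F \<longleftrightarrow> (\<forall>i. ((\<lambda>x. f x i) \<longlongrightarrow> l i) F)"
  using limitin_componentwise[of "\<lambda>_. euclidean" UNIV f l F]
  by (simp add: euclidean_product_topology extensional_def)

text \<open>Tychonoff's theorem: the coordinates from \<open>m\<close> on are confined to the
  compact set \<open>{0}\<close>.\<close>

lemma compact_fun_box:
  fixes R :: real
  shows "compact {x::nat \<Rightarrow> real. \<forall>i. if i < m then \<bar>x i\<bar> \<le> R else x i = 0}"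
proof -
  define S where "S i = (if i < m then {-R..R} else {0::real})" for i
  have "compactin (product_topology (\<lambda>_. euclidean) UNIV) (PiE UNIV S)"
    unfolding compactin_PiE by (auto simp: S_def)
  moreover have "PiE UNIV S = {x::nat \<Rightarrow> real. \<forall>i. if i < m then \<bar>x i\<bar> \<le> R else x i = 0}"
    by (auto simp: PiE_def Pi_def S_def extensional_def abs_le_iff split: if_splits)
  ultimately show ?thesis by (simp add: euclidean_product_topology)
qed

text \<open>Pairs violating the claim with distances below \<open>1 / Suc n\<close> would, along a
  subsequence, converge to one common point by compactness of the box, against continuity at that
  point. Only \<open>x\<close> is confined to the box; \<open>y\<close> may lie slightly
  outside.\<close>

lemma uniformly_continuous_fun_box:
  fixes f :: "(nat \<Rightarrow> real) \<Rightarrow> real"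
  assumes f: "continuous_on UNIV f" and e: "e > 0"
  obtains d where "d > 0"
    "\<And>x y. (\<And>i. i < m \<Longrightarrow> \<bar>x i\<bar> \<le> R \<and> \<bar>x i - y i\<bar> < d) \<Longrightarrow> (\<And>i. i \<ge> m \<Longrightarrow> x i = 0 \<and> y i = 0)
       \<Longrightarrow> \<bar>f x - f y\<bar> < e"
proof -
  have "\<exists>d>0. \<forall>x y. (\<forall>i<m. \<bar>x i\<bar> \<le> R \<and> \<bar>x i - y i\<bar> < d) \<and> (\<forall>i\<ge>m. x i = 0 \<and> y i = 0) \<longrightarrow> \<bar>f x - f y\<bar> < e"
  proof (rule ccontr)
    assume "\<not> ?thesis"
    then have "\<exists>x y. (\<forall>i<m. \<bar>x i\<bar> \<le> R \<and> \<bar>x i - y i\<bar> < 1 / Suc n) \<and> (\<forall>i\<ge>m. x i = 0 \<and> y i = 0) \<and> \<not> \<bar>f x - f y\<bar> < e"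
      for n :: nat
      by (auto dest!: spec[of _ "1 / Suc n"])
    then obtain x y where xy: "\<And>n i. i < m \<Longrightarrow> \<bar>x n i\<bar> \<le> R" "\<And>n i. i < m \<Longrightarrow> \<bar>x n i - y n i\<bar> < 1 / Suc n"
      "\<And>n i. i \<ge> m \<Longrightarrow> x n i = 0" "\<And>n i. i \<ge> m \<Longrightarrow> y n i = 0" "\<And>n. \<not> \<bar>f (x n) - f (y n)\<bar> < e"
      by metis
    have "\<forall>n. x n \<in> {x::nat \<Rightarrow> real. \<forall>i. if i < m then \<bar>x i\<bar> \<le> R else x i = 0}"
      using xy by auto
    then obtain l r where r: "strict_mono r" and l: "(x \<circ> r) \<longlonglongrightarrow> l"
      using compact_fun_box[of m R, unfolded compact_eq_seq_compact_metric seq_compact_def] by meson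
    have ylim: "(y \<circ> r) \<longlonglongrightarrow> l"
      unfolding tendsto_fun_iff
    proof
      fix i
      have "(\<lambda>n. x (r n) i - y (r n) i) \<longlonglongrightarrow> 0"
      proof (rule Lim_null_comparison)
        show "(\<lambda>n. 1 / real (Suc (r n))) \<longlonglongrightarrow> 0"
          using LIMSEQ_subseq_LIMSEQ[OF lim_1_over_n[THEN LIMSEQ_Suc] r] by (simp add: o_def)
        show "\<forall>\<^sub>F n in sequentially. norm (x (r n) i - y (r n) i) \<le> 1 / real (Suc (r n))"
          using xy(2)[of i] xy(3,4)[of i] by (cases "i < m") (auto intro!: always_eventually less_imp_le)
      qed
      with l[unfolded tendsto_fun_iff, rule_format, of i]
      have "(\<lambda>n. x (r n) i - (x (r n) i - y (r n) i)) \<longlonglongrightarrow> l i - 0"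
        by (intro tendsto_diff) (auto simp: o_def)
      then show "(\<lambda>n. (y \<circ> r) n i) \<longlonglongrightarrow> l i" by (simp add: o_def)
    qed
    have "isCont f l" using f by (simp add: continuous_on_eq_continuous_at)
    then have "(\<lambda>n. f ((x \<circ> r) n) - f ((y \<circ> r) n)) \<longlonglongrightarrow> f l - f l"
      by (intro tendsto_diff) (use l ylim in \<open>auto intro!: isCont_tendsto_compose[where g=f] simp only: comp_def\<close>)
    then have "\<forall>\<^sub>F n in sequentially. \<bar>f ((x \<circ> r) n) - f ((y \<circ> r) n)\<bar> < e"
      using e by (auto dest!: tendstoD simp: dist_real_def)
    then show False using xy(5) by (auto simp: eventually_sequentially)
  qed
  then show ?thesis using that by blast
qed

text \<open>The sum of squares pays for the points outside a large box, so that second moment bounds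
  replace tightness.\<close>

lemma bounded_continuous_fun_modulus:
  fixes f :: "(nat \<Rightarrow> real) \<Rightarrow> real"
  assumes f: "continuous_on UNIV f" "\<And>x. \<bar>f x\<bar> \<le> B" and e: "e > 0"
  obtains d where "d > 0"
    "\<forall>x y. (\<forall>i<m. \<bar>x i - y i\<bar> < d) \<longrightarrow> (\<forall>i\<ge>m. x i = 0 \<and> y i = 0)
       \<longrightarrow> \<bar>f x - f y\<bar> \<le> e + e * (\<Sum>i<m. (x i)\<^sup>2)"
proof -
  have B: "B \<ge> 0" using f(2)[of undefined] by (meson abs_ge_zero order_trans)
  \<comment> \<open>A coordinate beyond \<open>R\<close> makes \<open>e\<close> times the sum of
    squares at least \<open>2 * B\<close>, the largest possible oscillation of
    \<open>f\<close>.\<close>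
  define R where "R = sqrt ((2 * B + 1) / e)"
  have R: "R > 0" "e * R\<^sup>2 = 2 * B + 1" using B e by (auto simp: R_def)
  obtain d where d: "d > 0"
    "\<And>x y. (\<And>i. i < m \<Longrightarrow> \<bar>x i\<bar> \<le> R \<and> \<bar>x i - y i\<bar> < d) \<Longrightarrow> (\<And>i. i \<ge> m \<Longrightarrow> x i = 0 \<and> y i = 0)
       \<Longrightarrow> \<bar>f x - f y\<bar> < e"
    using uniformly_continuous_fun_box[OF f(1) e, of m R] by metis
  have "\<bar>f x - f y\<bar> \<le> e + e * (\<Sum>i<m. (x i)\<^sup>2)"
    if "\<And>i. i < m \<Longrightarrow> \<bar>x i - y i\<bar> < d" "\<And>i. i \<ge> m \<Longrightarrow> x i = 0 \<and> y i = 0" for x y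
  proof (cases "\<forall>i<m. \<bar>x i\<bar> \<le> R")
    case True
    have "0 \<le> e * (\<Sum>i<m. (x i)\<^sup>2)" using e by (intro mult_nonneg_nonneg sum_nonneg) auto
    moreover have "\<bar>f x - f y\<bar> < e" using True that by (intro d(2)) auto
    ultimately show ?thesis by linarith
  next
    case False
    then obtain i where i: "i < m" "\<bar>x i\<bar> > R" by force
    have "2 * B \<le> e * R\<^sup>2" using R by simp
    also have "R\<^sup>2 \<le> (x i)\<^sup>2" using i R by (metis abs_le_square_iff abs_of_pos less_imp_le)
    also have "(x i)\<^sup>2 \<le> (\<Sum>i<m. (x i)\<^sup>2)" using i by (intro member_le_sum) auto
    finally have "2 * B \<le> e * (\<Sum>i<m. (x i)\<^sup>2)" using e by simp
    then show ?thesis using f(2)[of x] f(2)[of y] e by linarith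
  qed
  then show ?thesis by (intro that[OF d(1)]) blast
qed


text \<open>Padding with zeros puts vectors of every length into the topological space
  \<open>nat \<Rightarrow> real\<close>, so that \<open>continuous_on UNIV\<close> makes sense and
  the length can be an induction variable. The vectors of \<open>fin_dim_law\<close> are padded with
  \<open>undefined\<close> instead.\<close>

definition cut_off :: "nat \<Rightarrow> (nat \<Rightarrow> real) \<Rightarrow> nat \<Rightarrow> real" where
  "cut_off m u = (\<lambda>i. if i < m then u i else 0)"

lemma cut_off_0 [simp]: "cut_off 0 u = (\<lambda>_. 0)" by (simp add: cut_off_def)

lemma cut_off_Suc: "cut_off (Suc m) u = (cut_off m u)(m := u m)" by (auto simp: cut_off_def fun_eq_iff)

lemma cut_off_cong: "(\<And>i. i < k \<Longrightarrow> u i = v i) \<Longrightarrow> cut_off k u = cut_off k v"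
  by (auto simp: cut_off_def)

lemma measurable_fun_continuous:
  fixes f :: "(nat \<Rightarrow> real) \<Rightarrow> real"
  assumes "continuous_on UNIV f" "\<And>i. (\<lambda>\<omega>. V \<omega> i) \<in> borel_measurable M"
  shows "(\<lambda>\<omega>. f (V \<omega>)) \<in> borel_measurable M"
  using measurable_compose[OF measurable_coordinatewise_then_product[of V M] borel_measurable_continuous_onI[OF assms(1)]]
    assms(2) by simp

lemma measurable_cut:
  assumes "\<And>i. i < m \<Longrightarrow> U i \<in> borel_measurable M"
  shows "(\<lambda>\<omega>. cut_off m (\<lambda>i. U i \<omega>) i) \<in> borel_measurable M"
  using assms by (cases "i < m") (auto simp: cut_off_def)

lemma continuous_on_fun_upd: "continuous_on UNIV (\<lambda>y::real. x(m := y) :: nat \<Rightarrow> real)"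
proof (rule continuous_on_coordinatewise_then_product)
  fix i show "continuous_on UNIV (\<lambda>y. (x(m := y)) i)" by (cases "i = m") auto
qed

text \<open>Integrating out one coordinate preserves the bound and, by dominated convergence,
  continuity. This lets the averaging be iterated.\<close>

lemma gauss_average:
  fixes f :: "(nat \<Rightarrow> real) \<Rightarrow> real"
  assumes f: "continuous_on UNIV f" "\<And>x. \<bar>f x\<bar> \<le> B"
  shows "continuous_on UNIV (\<lambda>x. \<integral>y. f (x(m := y)) \<partial>std_normal_distribution)" (is ?cont)
    and "\<bar>\<integral>y. f (x(m := y)) \<partial>std_normal_distribution\<bar> \<le> B" (is ?bound)
    and "integrable std_normal_distribution (\<lambda>y. f (x(m := y)))" (is ?int)
proof -
  interpret N: real_distribution std_normal_distribution by (rule real_dist_normal_dist)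
  have meas: "(\<lambda>y. f (x(m := y))) \<in> borel_measurable std_normal_distribution" for x
  proof -
    have "(\<lambda>y. f (x(m := y))) \<in> borel_measurable borel"
      by (rule borel_measurable_continuous_onI, rule continuous_on_compose2[OF f(1) continuous_on_fun_upd]) simp
    then show ?thesis by simp
  qed
  have int: "integrable std_normal_distribution (\<lambda>y. f (x(m := y)))" for x
    by (rule N.integrable_const_bound[of _ B]) (use f meas in auto)
  show ?int by (rule int)
  have "\<bar>\<integral>y. f (x(m := y)) \<partial>std_normal_distribution\<bar> \<le> (\<integral>y. \<bar>f (x(m := y))\<bar> \<partial>std_normal_distribution)"
    by (rule integral_abs_bound)
  also have "\<dots> \<le> (\<integral>y. B \<partial>std_normal_distribution)"
    using f int by (intro integral_mono) auto
  finally show ?bound using N.prob_space by simp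
  show ?cont
    unfolding continuous_on_sequentially comp_def
  proof (intro allI ballI impI, elim conjE)
    fix x :: "nat \<Rightarrow> nat \<Rightarrow> real" and a assume x: "x \<longlonglongrightarrow> a"
    show "(\<lambda>n. \<integral>y. f ((x n)(m := y)) \<partial>std_normal_distribution) \<longlonglongrightarrow> (\<integral>y. f (a(m := y)) \<partial>std_normal_distribution)"
    proof (rule integral_dominated_convergence[where w="\<lambda>_. B"])
      show "AE y in std_normal_distribution. (\<lambda>n. f ((x n)(m := y))) \<longlonglongrightarrow> f (a(m := y))"
      proof (rule AE_I2)
        fix y
        have "(\<lambda>n. (x n)(m := y)) \<longlonglongrightarrow> a(m := y)"
          using x unfolding tendsto_fun_iff by auto
        then show "(\<lambda>n. f ((x n)(m := y))) \<longlonglongrightarrow> f (a(m := y))"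
          using f(1) by (intro isCont_tendsto_compose[where g=f]) (auto simp: continuous_on_eq_continuous_at)
      qed
    qed (use f meas in auto)
  qed
qed

text \<open>The mean of \<open>f\<close> at \<open>m\<close> independent standard normal coordinates and zeros; only the fact that it
  depends on \<open>m\<close> and \<open>f\<close> alone is used to identify limits.\<close>

primrec gauss_mean :: "nat \<Rightarrow> ((nat \<Rightarrow> real) \<Rightarrow> real) \<Rightarrow> real" where
  "gauss_mean 0 f = f (\<lambda>_. 0)"
| "gauss_mean (Suc m) f = gauss_mean m (\<lambda>x. \<integral>y. f (x(m := y)) \<partial>std_normal_distribution)"

text \<open>Standard normality of each coordinate, asymptotically independent of the preceding ones. A
  constant sequence has this property exactly if its coordinates are independent standard normal.\<close>

definition asymp_gauss :: "'a measure \<Rightarrow> (nat \<Rightarrow> nat \<Rightarrow> 'a \<Rightarrow> real) \<Rightarrow> nat \<Rightarrow> bool" where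
  "asymp_gauss M U m \<longleftrightarrow> prob_space M \<and>
     (\<forall>j<m. (\<forall>n. U n j \<in> borel_measurable M) \<and>
        (\<exists>C. \<forall>\<^sub>F n in sequentially. integrable M (\<lambda>\<omega>. (U n j \<omega>)\<^sup>2) \<and> (\<integral>\<omega>. (U n j \<omega>)\<^sup>2 \<partial>M) \<le> C) \<and>
        (\<forall>\<theta> I. (\<forall>i. I i \<in> sets borel) \<longrightarrow>
          (\<lambda>n. (\<integral>\<omega>. indicator {\<omega>\<in>space M. \<forall>i<j. U n i \<omega> \<in> I i} \<omega> * iexp (\<theta> * U n j \<omega>) \<partial>M)
             - measure M {\<omega>\<in>space M. \<forall>i<j. U n i \<omega> \<in> I i} * exp (- (\<theta>\<^sup>2) / 2)) \<longlonglongrightarrow> 0))"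


text \<open>The first \<open>m\<close> coordinates are sorted into finitely many cells of a grid of
  mesh \<open>d\<close>. On a cell they may be replaced by its corner, up to the modulus of
  continuity of \<open>f\<close>, and \<open>weighted_levy_continuity\<close> on the event of that
  cell replaces the last coordinate by a normal one. Second moments pay for the points outside the
  grid.\<close>

lemma asymp_gauss_step:
  fixes f :: "(nat \<Rightarrow> real) \<Rightarrow> real"
  assumes U: "asymp_gauss M U (Suc m)" and f: "continuous_on UNIV f" "\<And>x. \<bar>f x\<bar> \<le> B"
  shows "(\<lambda>n. (\<integral>\<omega>. f (cut_off (Suc m) (\<lambda>i. U n i \<omega>)) \<partial>M)
     - (\<integral>\<omega>. (\<integral>y. f ((cut_off m (\<lambda>i. U n i \<omega>))(m := y)) \<partial>std_normal_distribution) \<partial>M)) \<longlonglongrightarrow> 0"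
proof -
  interpret prob_space M using U by (simp add: asymp_gauss_def)
  interpret N: real_distribution std_normal_distribution by (rule real_dist_normal_dist)
  define F where "F x = (\<integral>y. f (x(m := y)) \<partial>std_normal_distribution)" for x
  have F: "continuous_on UNIV F" "\<And>x. \<bar>F x\<bar> \<le> B"
    using gauss_average[OF f] by (auto simp: F_def[abs_def])
  have Um: "U n j \<in> borel_measurable M" if "j \<le> m" for n j
    using U that by (auto simp: asymp_gauss_def less_Suc_eq_le)
  define P where "P j c \<longleftrightarrow> (\<forall>\<^sub>F n in sequentially. integrable M (\<lambda>\<omega>. (U n j \<omega>)\<^sup>2) \<and> (\<integral>\<omega>. (U n j \<omega>)\<^sup>2 \<partial>M) \<le> c)" for j c
  have "\<exists>c. P j c" if "j \<le> m" for j
    using U that by (auto simp: asymp_gauss_def less_Suc_eq_le P_def)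
  then obtain C where "\<And>j. j \<le> m \<Longrightarrow> P j (C j)" by metis
  then have C: "\<forall>\<^sub>F n in sequentially. integrable M (\<lambda>\<omega>. (U n j \<omega>)\<^sup>2) \<and> (\<integral>\<omega>. (U n j \<omega>)\<^sup>2 \<partial>M) \<le> C j" if "j \<le> m" for j
    using that by (simp add: P_def)
  define C' where "C' = (\<Sum>j<Suc m. C j)"
  have evC: "\<forall>\<^sub>F n in sequentially. \<forall>j\<in>{..m}. integrable M (\<lambda>\<omega>. (U n j \<omega>)\<^sup>2) \<and> (\<integral>\<omega>. (U n j \<omega>)\<^sup>2 \<partial>M) \<le> C j"
    using C by (intro eventually_ball_finite) auto
  have B: "B \<ge> 0" using f(2)[of undefined] by (meson abs_ge_zero order_trans)
  have bound: "\<forall>\<^sub>F n in sequentially. \<bar>(\<integral>\<omega>. f (cut_off (Suc m) (\<lambda>i. U n i \<omega>)) \<partial>M) - (\<integral>\<omega>. F (cut_off m (\<lambda>i. U n i \<omega>)) \<partial>M)\<bar>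
      \<le> e * (4 + 2 * C')" if e: "e > 0" for e
  proof -
    obtain d where d: "d > 0"
      "\<forall>x y. (\<forall>i<Suc m. \<bar>x i - y i\<bar> < d) \<longrightarrow> (\<forall>i\<ge>Suc m. x i = 0 \<and> y i = 0)
         \<longrightarrow> \<bar>f x - f y\<bar> \<le> e + e * (\<Sum>i<Suc m. (x i)\<^sup>2)"
      by (rule bounded_continuous_fun_modulus[OF f e, where m="Suc m"])
    define R where "R = sqrt ((B + 1) / e)"
    have R: "R > 0" "e * R\<^sup>2 = B + 1" using B e by (auto simp: R_def)
    \<comment> \<open>Labels in \<open>{-K..K}\<close> cover \<open>[-R, R]\<close>. A label outside
      \<open>L\<close> thus forces some coordinate beyond \<open>R\<close>, and then
      \<open>e\<close> times the sum of squares exceeds the bound \<open>B\<close> of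
      \<open>f\<close> and \<open>F\<close>.\<close>
    define K where "K = \<lceil>R / d\<rceil> + 1"
    define L where "L = PiE {..<m} (\<lambda>_. {-K..K})"
    have finL: "finite L" unfolding L_def by (intro finite_PiE) auto
    define lab where "lab n \<omega> = (\<lambda>i\<in>{..<m}. \<lfloor>U n i \<omega> / d\<rfloor>)" for n \<omega>
    define rep where "rep l = cut_off m (\<lambda>i. of_int (l i) * d)" for l :: "nat \<Rightarrow> int"
    define I where "I l i = {x::real. \<lfloor>x / d\<rfloor> = l i}" for l :: "nat \<Rightarrow> int" and i
    have "I l i = {of_int (l i) * d..<(of_int (l i) + 1) * d}" for l i
      using d(1) by (auto simp: I_def floor_eq_iff field_simps)
    then have I: "I l i \<in> sets borel" for l i by simp
    define A where "A n l = {\<omega>\<in>space M. \<forall>i<m. U n i \<omega> \<in> I l i}" for n l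
    have Aev [measurable]: "A n l \<in> events" for n l
    proof -
      have "{\<omega>\<in>space M. \<forall>i\<in>{..<m}. U n i \<omega> \<in> I l i} \<in> events"
      proof (rule sets.sets_Collect_finite_All)
        fix i assume "i \<in> {..<m}"
        then have "U n i -` I l i \<inter> space M \<in> events" by (intro measurable_sets[OF Um I]) auto
        moreover have "{\<omega>\<in>space M. U n i \<omega> \<in> I l i} = U n i -` I l i \<inter> space M" by auto
        ultimately show "{\<omega>\<in>space M. U n i \<omega> \<in> I l i} \<in> events" by simp
      qed auto
      then show ?thesis unfolding A_def by (simp only: Ball_def lessThan_iff)
    qed
    have A_lab: "\<omega> \<in> A n l \<longleftrightarrow> lab n \<omega> = l" if "l \<in> L" "\<omega> \<in> space M" for n l \<omega>
    proof -
      have "l \<in> extensional {..<m}" using that(1) by (simp add: L_def PiE_def)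
      then have "lab n \<omega> = l \<longleftrightarrow> (\<forall>i\<in>{..<m}. lab n \<omega> i = l i)"
        using extensionalityI[of "lab n \<omega>" "{..<m}" l] by (auto simp only: lab_def restrict_extensional)
      also have "\<dots> \<longleftrightarrow> (\<forall>i<m. \<lfloor>U n i \<omega> / d\<rfloor> = l i)"
        by (simp only: lab_def Ball_def lessThan_iff) (simp add: lab_def)
      finally show ?thesis using that(2) unfolding A_def I_def by blast
    qed
    define h where "h l y = f ((rep l)(m := y))" for l y
    have h: "continuous_on UNIV (h l)" for l
      unfolding h_def by (rule continuous_on_compose2[OF f(1) continuous_on_fun_upd]) auto
    have hB: "\<bar>h l y\<bar> \<le> B" for l y by (simp add: h_def f(2))
    have [measurable]: "h l \<in> borel_measurable borel" for l by (rule borel_measurable_continuous_onI[OF h])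
    \<comment> \<open>\<open>S\<close> freezes the first coordinates at the corner of their cell;
      \<open>T\<close> moreover replaces the last one by its Gaussian average. Both vanish off the
      grid.\<close>
    define S where "S n \<omega> = (\<Sum>l\<in>L. indicator (A n l) \<omega> * h l (U n m \<omega>))" for n \<omega>
    define T where "T n \<omega> = (\<Sum>l\<in>L. indicator (A n l) \<omega> * F (rep l))" for n \<omega>
    have sum_ind: "(\<Sum>l\<in>L. indicator (A n l) \<omega> * g l) = (if lab n \<omega> \<in> L then g (lab n \<omega>) else 0)"
      if "\<omega> \<in> space M" for n \<omega> and g :: "(nat \<Rightarrow> int) \<Rightarrow> real"
    proof -
      have "(\<Sum>l\<in>L. indicator (A n l) \<omega> * g l) = (\<Sum>l\<in>L. if l = lab n \<omega> then g l else 0)"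
        using A_lab that by (intro sum.cong) (auto simp: indicator_def)
      then show ?thesis using finL by simp
    qed
    have notL: "B \<le> e * (\<Sum>i<m. (U n i \<omega>)\<^sup>2)" if "lab n \<omega> \<notin> L" for n \<omega>
    proof -
      have "\<not> (\<forall>i\<in>{..<m}. \<lfloor>U n i \<omega> / d\<rfloor> \<in> {-K..K})"
        using that unfolding L_def lab_def restrict_PiE_iff .
      then obtain i where i: "i < m" "\<lfloor>U n i \<omega> / d\<rfloor> \<notin> {-K..K}"
        unfolding Ball_def lessThan_iff by blast
      have "\<bar>U n i \<omega>\<bar> > R"
      proof (rule ccontr)
        assume "\<not> ?thesis"
        then have "\<bar>U n i \<omega> / d\<bar> \<le> R / d" using d(1) by (simp add: divide_right_mono)
        moreover have "R / d \<le> of_int \<lceil>R / d\<rceil>" by (rule le_of_int_ceiling)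
        ultimately have "of_int (-K) \<le> U n i \<omega> / d" "U n i \<omega> / d < of_int K + 1"
          unfolding K_def of_int_minus of_int_add of_int_1 by linarith+
        then have "\<lfloor>U n i \<omega> / d\<rfloor> \<in> {-K..K}" by (simp only: atLeastAtMost_iff le_floor_iff floor_le_iff simp_thms)
        with i show False by simp
      qed
      then have "R\<^sup>2 \<le> (U n i \<omega>)\<^sup>2" using R abs_le_square_iff[of R "U n i \<omega>"] by simp
      also have "\<dots> \<le> (\<Sum>i<m. (U n i \<omega>)\<^sup>2)" using i by (intro member_le_sum) auto
      finally have "e * R\<^sup>2 \<le> e * (\<Sum>i<m. (U n i \<omega>)\<^sup>2)" using e by simp
      then show ?thesis using R by simp
    qed
    have rep_close: "\<bar>cut_off m (\<lambda>i. U n i \<omega>) i - rep (lab n \<omega>) i\<bar> < d" for n \<omega> i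
    proof (cases "i < m")
      case True
      have "\<bar>U n i \<omega> / d - of_int \<lfloor>U n i \<omega> / d\<rfloor>\<bar> < 1" by linarith
      then have "\<bar>U n i \<omega> / d - of_int \<lfloor>U n i \<omega> / d\<rfloor>\<bar> * d < 1 * d" using d(1) by (intro mult_strict_right_mono)
      moreover have "\<bar>U n i \<omega> / d - of_int \<lfloor>U n i \<omega> / d\<rfloor>\<bar> * d = \<bar>U n i \<omega> - of_int \<lfloor>U n i \<omega> / d\<rfloor> * d\<bar>"
      proof -
        have "(U n i \<omega> / d - of_int \<lfloor>U n i \<omega> / d\<rfloor>) * d = U n i \<omega> - of_int \<lfloor>U n i \<omega> / d\<rfloor> * d"
          using d(1) by (simp add: left_diff_distrib)
        then show ?thesis using d(1) by (metis abs_mult abs_of_pos)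
      qed
      ultimately show ?thesis using True by (simp add: cut_off_def rep_def lab_def)
    qed (use d(1) in \<open>auto simp: cut_off_def rep_def\<close>)
    have sum_cut: "(\<Sum>i<Suc m. (((cut_off m u)(m := y)) i)\<^sup>2) = (\<Sum>i<m. (u i)\<^sup>2) + y\<^sup>2" for u y
      by (simp add: cut_off_def)
    have close: "\<bar>f ((cut_off m (\<lambda>i. U n i \<omega>))(m := y)) - h (lab n \<omega>) y\<bar> \<le> e + e * ((\<Sum>i<m. (U n i \<omega>)\<^sup>2) + y\<^sup>2)" for n \<omega> y
      unfolding h_def sum_cut[symmetric]
    proof (intro d(2)[rule_format])
      fix i
      show "\<bar>((cut_off m (\<lambda>i. U n i \<omega>))(m := y)) i - ((rep (lab n \<omega>))(m := y)) i\<bar> < d"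
        using rep_close[of n \<omega> i] d(1) by simp
      assume "Suc m \<le> i"
      then show "((cut_off m (\<lambda>i. U n i \<omega>))(m := y)) i = 0 \<and> ((rep (lab n \<omega>))(m := y)) i = 0"
        by (simp add: cut_off_def rep_def)
    qed
    have closeS: "\<bar>f (cut_off (Suc m) (\<lambda>i. U n i \<omega>)) - S n \<omega>\<bar> \<le> e + e * (\<Sum>i<Suc m. (U n i \<omega>)\<^sup>2)" if "\<omega> \<in> space M" for n \<omega>
    proof (cases "lab n \<omega> \<in> L")
      case True
      then show ?thesis using close[of n \<omega> "U n m \<omega>"] unfolding S_def sum_ind[OF that] cut_off_Suc sum.lessThan_Suc by simp
    next
      case False
      have "0 \<le> e * (U n m \<omega>)\<^sup>2" using e by simp
      then have "B \<le> e + e * (\<Sum>i<Suc m. (U n i \<omega>)\<^sup>2)" using notL[OF False] e unfolding sum.lessThan_Suc distrib_left by linarith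
      then show ?thesis using False f(2)[of "cut_off (Suc m) (\<lambda>i. U n i \<omega>)"] unfolding S_def sum_ind[OF that] by (simp del: sum.lessThan_Suc)
    qed
    have intN: "integrable std_normal_distribution (\<lambda>y. y\<^sup>2)" "(\<integral>y. y\<^sup>2 \<partial>std_normal_distribution) = 1"
      using std_normal_distribution_even_moments[of 1] by (auto simp: fact_numeral)
    have closeF: "\<bar>F (cut_off m (\<lambda>i. U n i \<omega>)) - F (rep (lab n \<omega>))\<bar> \<le> e + e * ((\<Sum>i<m. (U n i \<omega>)\<^sup>2) + 1)" for n \<omega>
    proof -
      let ?x = "cut_off m (\<lambda>i. U n i \<omega>)"
      note ints = gauss_average(3)[OF f, of ?x m] gauss_average(3)[OF f, of "rep (lab n \<omega>)" m]
      have "F ?x - F (rep (lab n \<omega>)) = (\<integral>y. f (?x(m := y)) - h (lab n \<omega>) y \<partial>std_normal_distribution)"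
        unfolding F_def h_def using ints by (intro Bochner_Integration.integral_diff[symmetric])
      also have "\<bar>\<dots>\<bar> \<le> (\<integral>y. \<bar>f (?x(m := y)) - h (lab n \<omega>) y\<bar> \<partial>std_normal_distribution)"
        by (rule integral_abs_bound)
      also have "\<dots> \<le> (\<integral>y. e + e * ((\<Sum>i<m. (U n i \<omega>)\<^sup>2) + y\<^sup>2) \<partial>std_normal_distribution)"
        using ints intN close unfolding h_def by (intro integral_mono) (auto simp: h_def)
      also have "\<dots> = e + e * ((\<Sum>i<m. (U n i \<omega>)\<^sup>2) + 1)"
        using intN N.prob_space by simp
      finally show ?thesis .
    qed
    have closeT: "\<bar>F (cut_off m (\<lambda>i. U n i \<omega>)) - T n \<omega>\<bar> \<le> e + e * ((\<Sum>i<Suc m. (U n i \<omega>)\<^sup>2) + 1)" if "\<omega> \<in> space M" for n \<omega>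
    proof (cases "lab n \<omega> \<in> L")
      case True
      have "0 \<le> e * (U n m \<omega>)\<^sup>2" using e by simp
      then show ?thesis using True closeF[of n \<omega>] unfolding T_def sum_ind[OF that] sum.lessThan_Suc distrib_left by simp
    next
      case False
      have "0 \<le> e * (U n m \<omega>)\<^sup>2" using e by simp
      then have "B \<le> e + e * ((\<Sum>i<Suc m. (U n i \<omega>)\<^sup>2) + 1)" using notL[OF False] e unfolding sum.lessThan_Suc distrib_left by linarith
      then show ?thesis using False F(2)[of "cut_off m (\<lambda>i. U n i \<omega>)"] unfolding T_def sum_ind[OF that] by (simp del: sum.lessThan_Suc)
    qed
    have "(\<lambda>n. (\<integral>\<omega>. indicator (A n l) \<omega> * h l (U n m \<omega>) \<partial>M) - prob (A n l) * F (rep l)) \<longlonglongrightarrow> 0" if "l \<in> L" for l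
      unfolding F_def h_def[symmetric]
    proof (rule weighted_levy_continuity[OF prob_space_axioms Um[OF order_refl] Aev _ _ h hB])
      fix \<theta> :: real
      have *: "(\<lambda>n. (\<integral>\<omega>. indicator {\<omega>\<in>space M. \<forall>i<m. U n i \<omega> \<in> J i} \<omega> * iexp (\<theta> * U n m \<omega>) \<partial>M)
             - prob {\<omega>\<in>space M. \<forall>i<m. U n i \<omega> \<in> J i} * exp (- (\<theta>\<^sup>2) / 2)) \<longlonglongrightarrow> 0"
        if "\<And>i. J i \<in> sets borel" for J
        using U that unfolding asymp_gauss_def by blast
      show "(\<lambda>n. (\<integral>\<omega>. indicator (A n l) \<omega> * iexp (\<theta> * U n m \<omega>) \<partial>M) - prob (A n l) * exp (- (\<theta>\<^sup>2) / 2)) \<longlonglongrightarrow> 0"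
        unfolding A_def by (rule *) (rule I)
      have "(\<lambda>n. (\<integral>\<omega>. iexp (\<theta> * U n m \<omega>) \<partial>M) - exp (- (\<theta>\<^sup>2) / 2)) \<longlonglongrightarrow> 0"
      proof -
        have "(\<integral>\<omega>. indicator (space M) \<omega> * iexp (\<theta> * U n m \<omega>) \<partial>M) = (\<integral>\<omega>. iexp (\<theta> * U n m \<omega>) \<partial>M)" for n
          by (intro Bochner_Integration.integral_cong) auto
        then show ?thesis using *[of "\<lambda>_. UNIV"] by (simp add: prob_space)
      qed
      then show "(\<lambda>n. (\<integral>\<omega>. iexp (\<theta> * U n m \<omega>) \<partial>M)) \<longlonglongrightarrow> exp (- (\<theta>\<^sup>2) / 2)"
        by (rule LIM_zero_cancel)
    qed
    then have "(\<lambda>n. \<Sum>l\<in>L. (\<integral>\<omega>. indicator (A n l) \<omega> * h l (U n m \<omega>) \<partial>M) - prob (A n l) * F (rep l)) \<longlonglongrightarrow> 0"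
      by (rule tendsto_null_sum)
    moreover have intS: "integrable M (S n)" "integrable M (T n)" for n
    proof -
      have "integrable M (\<lambda>\<omega>. indicator (A n l) \<omega> * h l (U n m \<omega>))" for l
        by (rule integrable_const_bound[of _ B]) (use hB B Um[of m n] in \<open>auto simp: indicator_def\<close>)
      then show "integrable M (S n)" unfolding S_def by simp
      show "integrable M (T n)" unfolding T_def
        by (intro Bochner_Integration.integrable_sum integrable_mult_left) (auto intro: integrable_const_bound[of _ 1])
    qed
    moreover have "(\<integral>\<omega>. S n \<omega> \<partial>M) - (\<integral>\<omega>. T n \<omega> \<partial>M) =
      (\<Sum>l\<in>L. (\<integral>\<omega>. indicator (A n l) \<omega> * h l (U n m \<omega>) \<partial>M) - prob (A n l) * F (rep l))" for n
    proof -
      have "integrable M (\<lambda>\<omega>. indicator (A n l) \<omega> * h l (U n m \<omega>))" for l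
        by (rule integrable_const_bound[of _ B]) (use hB B Um[of m n] in \<open>auto simp: indicator_def\<close>)
      moreover have "integrable M (\<lambda>\<omega>. indicator (A n l) \<omega> * F (rep l))" for l
        by (intro integrable_mult_left) (auto intro: integrable_const_bound[of _ 1])
      ultimately show ?thesis unfolding S_def T_def
        by (subst (1 2) Bochner_Integration.integral_sum) (auto simp: sum_subtractf)
    qed
    ultimately have "(\<lambda>n. (\<integral>\<omega>. S n \<omega> \<partial>M) - (\<integral>\<omega>. T n \<omega> \<partial>M)) \<longlonglongrightarrow> 0" by simp
    then have "\<forall>\<^sub>F n in sequentially. \<bar>(\<integral>\<omega>. S n \<omega> \<partial>M) - (\<integral>\<omega>. T n \<omega> \<partial>M)\<bar> < e"
      using e by (auto dest!: tendstoD simp: dist_real_def)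
    then show ?thesis using evC
    proof eventually_elim
      case (elim n)
      let ?Q = "\<lambda>\<omega>. \<Sum>i<Suc m. (U n i \<omega>)\<^sup>2"
      have intQ: "integrable M ?Q" using elim by (intro Bochner_Integration.integrable_sum) auto
      have Q: "(\<integral>\<omega>. ?Q \<omega> \<partial>M) \<le> C'"
        using elim unfolding C'_def by (subst Bochner_Integration.integral_sum) (auto intro!: sum_mono simp del: sum.lessThan_Suc)
      have meas: "(\<lambda>\<omega>. f (cut_off (Suc m) (\<lambda>i. U n i \<omega>))) \<in> borel_measurable M"
        "(\<lambda>\<omega>. F (cut_off m (\<lambda>i. U n i \<omega>))) \<in> borel_measurable M"
        by (intro measurable_fun_continuous[OF f(1)] measurable_fun_continuous[OF F(1)] measurable_cut Um; simp)+
      have ints: "integrable M (\<lambda>\<omega>. f (cut_off (Suc m) (\<lambda>i. U n i \<omega>)))" "integrable M (\<lambda>\<omega>. F (cut_off m (\<lambda>i. U n i \<omega>)))"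
        using f F meas by (auto intro!: integrable_const_bound[of _ B])
      have 1: "\<bar>(\<integral>\<omega>. f (cut_off (Suc m) (\<lambda>i. U n i \<omega>)) \<partial>M) - (\<integral>\<omega>. S n \<omega> \<partial>M)\<bar> \<le> e + e * C'"
      proof -
        have "\<bar>(\<integral>\<omega>. f (cut_off (Suc m) (\<lambda>i. U n i \<omega>)) \<partial>M) - (\<integral>\<omega>. S n \<omega> \<partial>M)\<bar> \<le> (\<integral>\<omega>. \<bar>f (cut_off (Suc m) (\<lambda>i. U n i \<omega>)) - S n \<omega>\<bar> \<partial>M)"
          using integral_abs_bound[of M "\<lambda>\<omega>. f (cut_off (Suc m) (\<lambda>i. U n i \<omega>)) - S n \<omega>"] ints intS by simp
        also have "\<dots> \<le> (\<integral>\<omega>. e + e * ?Q \<omega> \<partial>M)"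
          using closeS ints intS intQ by (intro integral_mono) auto
        also have "\<dots> = e + e * (\<integral>\<omega>. ?Q \<omega> \<partial>M)" using intQ by (simp add: prob_space del: sum.lessThan_Suc)
        also have "\<dots> \<le> e + e * C'" using Q e by simp
        finally show ?thesis .
      qed
      have 2: "\<bar>(\<integral>\<omega>. F (cut_off m (\<lambda>i. U n i \<omega>)) \<partial>M) - (\<integral>\<omega>. T n \<omega> \<partial>M)\<bar> \<le> e + e * (C' + 1)"
      proof -
        have "\<bar>(\<integral>\<omega>. F (cut_off m (\<lambda>i. U n i \<omega>)) \<partial>M) - (\<integral>\<omega>. T n \<omega> \<partial>M)\<bar> \<le> (\<integral>\<omega>. \<bar>F (cut_off m (\<lambda>i. U n i \<omega>)) - T n \<omega>\<bar> \<partial>M)"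
          using integral_abs_bound[of M "\<lambda>\<omega>. F (cut_off m (\<lambda>i. U n i \<omega>)) - T n \<omega>"] ints intS by simp
        also have "\<dots> \<le> (\<integral>\<omega>. e + e * (?Q \<omega> + 1) \<partial>M)"
          using closeT ints intS intQ by (intro integral_mono) auto
        also have "\<dots> = e + e * ((\<integral>\<omega>. ?Q \<omega> \<partial>M) + 1)" using intQ by (simp add: prob_space del: sum.lessThan_Suc)
        also have "\<dots> \<le> e + e * (C' + 1)" using Q e by simp
        finally show ?thesis .
      qed
      have "e + e * C' + (e + e * (C' + 1)) + e = e * (4 + 2 * C')" by (simp add: algebra_simps)
      then show ?case using 1 2 elim(1) by linarith
    qed
  qed
  show ?thesis
  proof (rule tendstoI)
    fix \<epsilon> :: real assume \<epsilon>: "\<epsilon> > 0"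
    \<comment> \<open>The absolute value and the \<open>+ 1\<close> keep the divisor positive
      whatever the sign of \<open>C'\<close>.\<close>
    define e where "e = \<epsilon> / (2 * (\<bar>4 + 2 * C'\<bar> + 1))"
    have pos: "\<bar>4 + 2 * C'\<bar> + 1 > 0" by linarith
    then have e: "e > 0" using \<epsilon> unfolding e_def by (intro divide_pos_pos mult_pos_pos) auto
    have "e * (4 + 2 * C') \<le> e * (\<bar>4 + 2 * C'\<bar> + 1)" using e by (intro mult_left_mono) auto
    also have "\<dots> = \<epsilon> / 2"
    proof -
      have "\<epsilon> / (2 * x) * x = \<epsilon> / 2" if "x > 0" for x using that by simp
      from this[OF pos] show ?thesis unfolding e_def .
    qed
    also have "\<dots> < \<epsilon>" using \<epsilon> by simp
    finally have lt: "e * (4 + 2 * C') < \<epsilon>" .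
    show "\<forall>\<^sub>F n in sequentially. dist ((\<integral>\<omega>. f (cut_off (Suc m) (\<lambda>i. U n i \<omega>)) \<partial>M)
       - (\<integral>\<omega>. (\<integral>y. f ((cut_off m (\<lambda>i. U n i \<omega>))(m := y)) \<partial>std_normal_distribution) \<partial>M)) 0 < \<epsilon>"
      using bound[OF e] unfolding F_def[symmetric] by eventually_elim (use lt in \<open>simp add: dist_real_def\<close>)
  qed
qed


text \<open>Coordinates are integrated out from the last one: the averaged function is again bounded
  and continuous, and it is evaluated at the first \<open>m\<close> coordinates, to which the
  induction hypothesis applies.\<close>

theorem asymp_gauss_tendsto:
  fixes f :: "(nat \<Rightarrow> real) \<Rightarrow> real"
  assumes "asymp_gauss M U m" "continuous_on UNIV f" "\<And>x. \<bar>f x\<bar> \<le> B"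
  shows "(\<lambda>n. \<integral>\<omega>. f (cut_off m (\<lambda>i. U n i \<omega>)) \<partial>M) \<longlonglongrightarrow> gauss_mean m f"
  using assms
proof (induction m arbitrary: f)
  case 0
  then interpret prob_space M by (simp add: asymp_gauss_def)
  show ?case by (simp add: prob_space)
next
  case (Suc m)
  have "asymp_gauss M U m" using Suc.prems(1) by (auto simp: asymp_gauss_def)
  then have "(\<lambda>n. \<integral>\<omega>. (\<integral>y. f ((cut_off m (\<lambda>i. U n i \<omega>))(m := y)) \<partial>std_normal_distribution) \<partial>M) \<longlonglongrightarrow> gauss_mean (Suc m) f"
    unfolding gauss_mean.simps by (rule Suc.IH) (rule gauss_average[OF Suc.prems(2,3)])+
  from tendsto_add[OF asymp_gauss_step[OF Suc.prems] this] show ?case by (simp del: fun_upd_apply)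
qed

text \<open>Where all coordinates differ by less than \<open>d\<close>, the modulus applies with
  \<open>Y\<close> as base point, because the second moments of \<open>Y\<close> are bounded.
  Elsewhere the difference is at most \<open>2 * B\<close> and, as in Chebyshev's inequality, is
  paid by \<open>2 * B / d^2\<close> times the squared distance.\<close>

lemma fun_slutsky:
  fixes f :: "(nat \<Rightarrow> real) \<Rightarrow> real" and X Y :: "nat \<Rightarrow> nat \<Rightarrow> 'a \<Rightarrow> real"
  assumes "prob_space M" and f: "continuous_on UNIV f" "\<And>x. \<bar>f x\<bar> \<le> B"
    and XY: "\<And>n i. i < k \<Longrightarrow> X n i \<in> borel_measurable M" "\<And>n i. i < k \<Longrightarrow> Y n i \<in> borel_measurable M"
    and Y: "\<And>i. i < k \<Longrightarrow> \<forall>\<^sub>F n in sequentially. integrable M (\<lambda>\<omega>. (Y n i \<omega>)\<^sup>2) \<and> (\<integral>\<omega>. (Y n i \<omega>)\<^sup>2 \<partial>M) \<le> C i"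
    and int: "\<And>i. i < k \<Longrightarrow> \<forall>\<^sub>F n in sequentially. integrable M (\<lambda>\<omega>. (X n i \<omega> - Y n i \<omega>)\<^sup>2)"
    and lim: "\<And>i. i < k \<Longrightarrow> (\<lambda>n. \<integral>\<omega>. (X n i \<omega> - Y n i \<omega>)\<^sup>2 \<partial>M) \<longlonglongrightarrow> 0"
  shows "(\<lambda>n. (\<integral>\<omega>. f (cut_off k (\<lambda>i. X n i \<omega>)) \<partial>M) - (\<integral>\<omega>. f (cut_off k (\<lambda>i. Y n i \<omega>)) \<partial>M)) \<longlonglongrightarrow> 0"
proof -
  interpret prob_space M by fact
  have B: "B \<ge> 0" using f(2)[of undefined] by (meson abs_ge_zero order_trans)
  define C' where "C' = (\<Sum>i<k. C i)"
  have bound: "\<forall>\<^sub>F n in sequentially. \<bar>(\<integral>\<omega>. f (cut_off k (\<lambda>i. X n i \<omega>)) \<partial>M) - (\<integral>\<omega>. f (cut_off k (\<lambda>i. Y n i \<omega>)) \<partial>M)\<bar>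
      \<le> e * (2 + C')" if e: "e > 0" for e
  proof -
    obtain d where d: "d > 0"
      "\<forall>x y. (\<forall>i<k. \<bar>x i - y i\<bar> < d) \<longrightarrow> (\<forall>i\<ge>k. x i = 0 \<and> y i = 0)
         \<longrightarrow> \<bar>f x - f y\<bar> \<le> e + e * (\<Sum>i<k. (x i)\<^sup>2)"
      by (rule bounded_continuous_fun_modulus[OF f e, where m=k])
    let ?E = "\<lambda>n \<omega>. \<Sum>i<k. (X n i \<omega> - Y n i \<omega>)\<^sup>2" and ?Q = "\<lambda>n \<omega>. \<Sum>i<k. (Y n i \<omega>)\<^sup>2"
    have close: "\<bar>f (cut_off k (\<lambda>i. X n i \<omega>)) - f (cut_off k (\<lambda>i. Y n i \<omega>))\<bar> \<le> e + e * ?Q n \<omega> + 2 * B / d\<^sup>2 * ?E n \<omega>" for n \<omega>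
    proof (cases "\<forall>i<k. \<bar>X n i \<omega> - Y n i \<omega>\<bar> < d")
      case True
      have "\<bar>f (cut_off k (\<lambda>i. Y n i \<omega>)) - f (cut_off k (\<lambda>i. X n i \<omega>))\<bar> \<le> e + e * (\<Sum>i<k. (cut_off k (\<lambda>i. Y n i \<omega>) i)\<^sup>2)"
        using True by (intro d(2)[rule_format]) (auto simp: cut_off_def abs_minus_commute)
      moreover have "0 \<le> 2 * B / d\<^sup>2 * ?E n \<omega>" using B by (intro mult_nonneg_nonneg sum_nonneg) auto
      ultimately show ?thesis by (simp add: cut_off_def abs_minus_commute)
    next
      case False
      then obtain i where i: "i < k" "\<bar>X n i \<omega> - Y n i \<omega>\<bar> \<ge> d" by (auto simp: not_less)
      have "d\<^sup>2 \<le> (X n i \<omega> - Y n i \<omega>)\<^sup>2" using i d(1) abs_le_square_iff[of d "X n i \<omega> - Y n i \<omega>"] by simp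
      also have "\<dots> \<le> ?E n \<omega>" using i by (intro member_le_sum) auto
      finally have "2 * B / d\<^sup>2 * d\<^sup>2 \<le> 2 * B / d\<^sup>2 * ?E n \<omega>" using B by (intro mult_left_mono) auto
      then have "2 * B \<le> 2 * B / d\<^sup>2 * ?E n \<omega>" using d(1) by simp
      moreover have "0 \<le> e * ?Q n \<omega>" using e by (intro mult_nonneg_nonneg sum_nonneg) auto
      ultimately show ?thesis
        using f(2)[of "cut_off k (\<lambda>i. X n i \<omega>)"] f(2)[of "cut_off k (\<lambda>i. Y n i \<omega>)"] e by linarith
    qed
    have "(\<lambda>n. 2 * B / d\<^sup>2 * (\<Sum>i<k. \<integral>\<omega>. (X n i \<omega> - Y n i \<omega>)\<^sup>2 \<partial>M)) \<longlonglongrightarrow> 0"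
      using lim by (intro tendsto_mult_right_zero tendsto_null_sum) auto
    then have "\<forall>\<^sub>F n in sequentially. 2 * B / d\<^sup>2 * (\<Sum>i<k. \<integral>\<omega>. (X n i \<omega> - Y n i \<omega>)\<^sup>2 \<partial>M) < e"
      using e by (rule order_tendstoD)
    moreover have "\<forall>\<^sub>F n in sequentially. \<forall>i\<in>{..<k}. (integrable M (\<lambda>\<omega>. (Y n i \<omega>)\<^sup>2) \<and> (\<integral>\<omega>. (Y n i \<omega>)\<^sup>2 \<partial>M) \<le> C i)
        \<and> integrable M (\<lambda>\<omega>. (X n i \<omega> - Y n i \<omega>)\<^sup>2)"
      by (intro eventually_ball_finite ballI eventually_conj Y int; simp)
    ultimately show ?thesis
    proof eventually_elim
      case (elim n)
      have intQ: "integrable M (?Q n)" "integrable M (?E n)"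
        by (rule Bochner_Integration.integrable_sum, use elim in simp)+
      have Q: "(\<integral>\<omega>. ?Q n \<omega> \<partial>M) \<le> C'"
        using elim unfolding C'_def by (subst Bochner_Integration.integral_sum) (auto intro!: sum_mono)
      have E: "2 * B / d\<^sup>2 * (\<integral>\<omega>. ?E n \<omega> \<partial>M) < e"
        using elim by (subst Bochner_Integration.integral_sum) auto
      have ints: "integrable M (\<lambda>\<omega>. f (cut_off k (\<lambda>i. X n i \<omega>)))" "integrable M (\<lambda>\<omega>. f (cut_off k (\<lambda>i. Y n i \<omega>)))"
        using f(2) by (intro integrable_const_bound[of _ B] measurable_fun_continuous[OF f(1)] measurable_cut AE_I2 XY; simp)+
      have "\<bar>(\<integral>\<omega>. f (cut_off k (\<lambda>i. X n i \<omega>)) \<partial>M) - (\<integral>\<omega>. f (cut_off k (\<lambda>i. Y n i \<omega>)) \<partial>M)\<bar>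
         \<le> (\<integral>\<omega>. \<bar>f (cut_off k (\<lambda>i. X n i \<omega>)) - f (cut_off k (\<lambda>i. Y n i \<omega>))\<bar> \<partial>M)"
        using integral_abs_bound[of M "\<lambda>\<omega>. f (cut_off k (\<lambda>i. X n i \<omega>)) - f (cut_off k (\<lambda>i. Y n i \<omega>))"] ints by simp
      also have "\<dots> \<le> (\<integral>\<omega>. e + e * ?Q n \<omega> + 2 * B / d\<^sup>2 * ?E n \<omega> \<partial>M)"
        using close ints intQ by (intro integral_mono Bochner_Integration.integrable_add integrable_mult_right
          integrable_const integrable_abs Bochner_Integration.integrable_diff)
      also have "\<dots> = e + e * (\<integral>\<omega>. ?Q n \<omega> \<partial>M) + 2 * B / d\<^sup>2 * (\<integral>\<omega>. ?E n \<omega> \<partial>M)"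
        using intQ by (simp add: prob_space)
      also have "\<dots> \<le> e + e * C' + e" using Q e E by (intro add_mono mult_left_mono) auto
      finally show ?case by (simp add: algebra_simps)
    qed
  qed
  show ?thesis
  proof (rule tendstoI)
    fix \<epsilon> :: real assume \<epsilon>: "\<epsilon> > 0"
    define e where "e = \<epsilon> / (2 * (\<bar>2 + C'\<bar> + 1))"
    have pos: "\<bar>2 + C'\<bar> + 1 > 0" by linarith
    then have e: "e > 0" using \<epsilon> unfolding e_def by (intro divide_pos_pos mult_pos_pos) auto
    have "e * (2 + C') \<le> e * (\<bar>2 + C'\<bar> + 1)" using e by (intro mult_left_mono) auto
    also have "\<dots> = \<epsilon> / 2"
    proof -
      have "\<epsilon> / (2 * x) * x = \<epsilon> / 2" if "x > 0" for x using that by simp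
      from this[OF pos] show ?thesis unfolding e_def .
    qed
    also have "\<dots> < \<epsilon>" using \<epsilon> by simp
    finally have lt: "e * (2 + C') < \<epsilon>" .
    show "\<forall>\<^sub>F n in sequentially. dist ((\<integral>\<omega>. f (cut_off k (\<lambda>i. X n i \<omega>)) \<partial>M)
       - (\<integral>\<omega>. f (cut_off k (\<lambda>i. Y n i \<omega>)) \<partial>M)) 0 < \<epsilon>"
      using bound[OF e] by eventually_elim (use lt in \<open>simp add: dist_real_def\<close>)
  qed
qed

section \<open>The one-step identity\<close>

lemma measurable_vimage_sigma:
  assumes "\<And>A. A \<in> sets N \<Longrightarrow> f -` A \<inter> \<Omega> \<in> E" "E \<subseteq> Pow \<Omega>" "f \<in> \<Omega> \<rightarrow> space N"
  shows "f \<in> measurable (sigma \<Omega> E) N"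
  using assms by (intro measurableI) (auto simp: sets_measure_of space_measure_of Pi_iff)

lemma Int_stable_vimage: "Int_stable {f -` A \<inter> S | A. A \<in> sets N}"
proof (rule Int_stableI)
  fix a b assume "a \<in> {f -` A \<inter> S | A. A \<in> sets N}" "b \<in> {f -` A \<inter> S | A. A \<in> sets N}"
  then obtain A B where "a = f -` A \<inter> S" "b = f -` B \<inter> S" "A \<inter> B \<in> sets N" by blast
  moreover from this have "a \<inter> b = f -` (A \<inter> B) \<inter> S" by auto
  ultimately show "a \<inter> b \<in> {f -` A \<inter> S | A. A \<in> sets N}" by blast
qed

section \<open>Innovations, recollections and memory choices as one independent family\<close>

context srrw_rvm
begin

text \<open>The index \<open>(0, n)\<close> stands for \<open>\<xi> n\<close>, \<open>(1, n)\<close> for \<open>\<alpha> n\<close> and \<open>(2, n)\<close> for \<open>\<beta> n\<close>.\<close>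

definition gen :: "nat \<times> nat \<Rightarrow> 'a set set" where
  "gen i = (if fst i = 0 then {\<xi> (snd i) -` A \<inter> space M | A. A \<in> sets borel}
     else if fst i = 1 then {\<alpha> (snd i) -` A \<inter> space M | A. A \<in> sets (count_space UNIV)}
     else {\<beta> (snd i) -` A \<inter> space M | A. A \<in> sets (count_space UNIV)})"

text \<open>The indices about which the model makes assumptions: at smaller ones the sequences may
  be dependent or not even measurable.\<close>

definition idx :: "(nat \<times> nat) set" where
  "idx = {0} \<times> {1..} \<union> {1, 2} \<times> {2..}"

definition Sig :: "(nat \<times> nat) set \<Rightarrow> 'a measure" where
  "Sig K = sigma (space M) (\<Union>i\<in>K. gen i)"

lemma gen_Pow: "gen i \<subseteq> Pow (space M)"
  by (auto simp: gen_def)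

lemma space_Sig [simp]: "space (Sig K) = space M"
  unfolding Sig_def by (intro space_measure_of) (use gen_Pow in blast)

lemma sets_Sig: "sets (Sig K) = sigma_sets (space M) (\<Union>i\<in>K. gen i)"
  unfolding Sig_def by (intro sets_measure_of) (use gen_Pow in blast)

lemma sets_Sig_mono: "K \<subseteq> K' \<Longrightarrow> sets (Sig K) \<subseteq> sets (Sig K')"
  unfolding sets_Sig by (intro sigma_sets_mono') auto

lemma measurable_Sig_mono:
  assumes "f \<in> measurable (Sig K) N" "K \<subseteq> K'"
  shows "f \<in> measurable (Sig K') N"
  using measurable_mono[OF order_refl refl sets_Sig_mono[OF assms(2)]] assms(1) by auto

lemma measurable_Sig:
  assumes "i \<in> K" "gen i = {f -` A \<inter> space M | A. A \<in> sets N}" "space N = UNIV"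
  shows "f \<in> measurable (Sig K) N"
  unfolding Sig_def
proof (rule measurable_vimage_sigma)
  show "f -` A \<inter> space M \<in> (\<Union>i\<in>K. gen i)" if "A \<in> sets N" for A
    using assms that by blast
qed (use gen_Pow assms(3) in blast)+

lemma measurable_Sig_xi: "(0, n) \<in> K \<Longrightarrow> \<xi> n \<in> borel_measurable (Sig K)"
  by (rule measurable_Sig, assumption) (simp_all add: gen_def)

lemma measurable_Sig_alpha: "(1, n) \<in> K \<Longrightarrow> \<alpha> n \<in> measurable (Sig K) (count_space UNIV)"
  by (rule measurable_Sig, assumption) (simp_all add: gen_def)

lemma measurable_Sig_beta: "(2, n) \<in> K \<Longrightarrow> \<beta> n \<in> measurable (Sig K) (count_space UNIV)"
  by (rule measurable_Sig, assumption) (simp_all add: gen_def)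

lemma Int_stable_gen: "Int_stable (gen i)"
  unfolding gen_def by (simp only: split: if_split) (intro conjI impI Int_stable_vimage)

text \<open>The model gives independence within each sequence and of the three generated
  sigma-algebras. A finite intersection is grouped by sequence; each group is one event of a
  sigma-algebra, so its probability factors first across the groups and then inside each.\<close>

lemma indep_gen: "indep_sets gen idx"
proof -
  define dom where "dom c = (if c = 0 then {1..} else {2::nat..})" for c :: nat
  define G where "G c = [generated_events M borel \<xi> {1..},
                        generated_events M (count_space UNIV) \<alpha> {2..},
                        generated_events M (count_space UNIV) \<beta> {2..}] ! c" for c
  have c3: "c = 0 \<or> c = 1 \<or> c = 2" if "c < 3" for c :: nat using that by auto
  have idx: "(c, n) \<in> idx \<longleftrightarrow> c < 3 \<and> n \<in> dom c" for c n by (auto simp: idx_def dom_def)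
  have comp: "indep_sets (\<lambda>n. gen (c, n)) (dom c)" if "c < 3" for c
    using innovation_indep recollection_indep memory_indep c3[OF that]
    by (auto simp: indep_vars_def2 gen_def dom_def)
  have G_sigma: "sigma_algebra (space M) (G c)" if "c < 3" for c
    using c3[OF that] by (auto simp: G_def generated_events_def intro!: sigma_algebra_sigma_sets)
  have gen_G: "gen (c, n) \<subseteq> G c" if "c < 3" "n \<in> dom c" for c n
  proof
    fix a assume a: "a \<in> gen (c, n)"
    from c3[OF that(1)] show "a \<in> G c"
    proof (elim disjE)
      assume c: "c = 0"
      show ?thesis using a that(2) unfolding c G_def generated_events_def gen_def dom_def
        by (simp only: nth_Cons_0 fst_conv snd_conv if_True simp_thms) (rule sigma_sets.Basic, blast)
    next
      assume c: "c = 1"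
      show ?thesis using a that(2) unfolding c G_def generated_events_def gen_def dom_def
        by (simp only: nth_Cons_0 nth_Cons_Suc One_nat_def fst_conv snd_conv if_False if_True simp_thms nat.distinct) (rule sigma_sets.Basic, blast)
    next
      assume c: "c = 2"
      have "[x, y, z] ! 2 = z" for x y z :: "'a set set" by simp
      then show ?thesis using a that(2) unfolding c G_def generated_events_def gen_def dom_def
        by simp (rule sigma_sets.Basic, blast)
    qed
  qed
  have indG: "indep_sets G {..<3}" using sequences_indep by (simp add: G_def[abs_def])
  have gen_ev: "gen (c, n) \<subseteq> events" if "(c, n) \<in> idx" for c n
    using comp that unfolding idx indep_sets_def by auto
  show ?thesis unfolding indep_sets_def
  proof (intro conjI ballI allI impI)
    fix i assume "i \<in> idx"
    then show "gen i \<subseteq> events" using gen_ev by (cases i) auto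
  next
    fix J A assume J: "J \<subseteq> idx" "J \<noteq> {}" "finite J" and A: "A \<in> Pi J gen"
    define Jc where "Jc c = {n. (c, n) \<in> J}" for c
    have Jc_dom: "Jc c \<subseteq> dom c" for c using J(1) idx by (auto simp: Jc_def)
    have finJc: "finite (Jc c)" for c
      unfolding Jc_def using finite_vimageI[OF J(3), of "Pair c"] by (simp add: vimage_def inj_on_def)
    have J_Sigma: "J = Sigma {..<3} Jc" using J(1) idx by (auto simp: Jc_def)
    \<comment> \<open>The intersection with \<open>space M\<close> yields the neutral event if no
      index of \<open>J\<close> belongs to sequence \<open>c\<close>.\<close>
    define B where "B c = space M \<inter> (\<Inter>n\<in>Jc c. A (c, n))" for c
    have AG: "A (c, n) \<in> gen (c, n)" if "n \<in> Jc c" for c n using A that by (auto simp: Jc_def)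
    have AM: "A (c, n) \<subseteq> space M" if "n \<in> Jc c" for c n using AG[OF that] gen_Pow by blast
    have BG: "B c \<in> G c" if "c < 3" for c
    proof (cases "Jc c = {}")
      case True
      interpret G: sigma_algebra "space M" "G c" by (rule G_sigma[OF that])
      show ?thesis using True G.top by (simp add: B_def)
    next
      case False
      interpret G: sigma_algebra "space M" "G c" by (rule G_sigma[OF that])
      have "(\<Inter>n\<in>Jc c. A (c, n)) \<in> G c"
        using False finJc AG gen_G[OF that] Jc_dom by (intro G.finite_INT) blast+
      moreover have "B c = (\<Inter>n\<in>Jc c. A (c, n))" using False AM by (auto simp: B_def)
      ultimately show ?thesis by simp
    qed
    have probB: "prob (B c) = (\<Prod>n\<in>Jc c. prob (A (c, n)))" if "c < 3" for c
    proof (cases "Jc c = {}")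
      case True
      then show ?thesis by (simp add: B_def prob_space)
    next
      case False
      have "prob (\<Inter>n\<in>Jc c. A (c, n)) = (\<Prod>n\<in>Jc c. prob (A (c, n)))"
        using comp[OF that] AG Jc_dom finJc False by (intro indep_setsD) auto
      moreover have "B c = (\<Inter>n\<in>Jc c. A (c, n))" using False AM by (auto simp: B_def)
      ultimately show ?thesis by simp
    qed
    have "(\<Inter>j\<in>J. A j) = (\<Inter>c\<in>{..<3}. B c)"
    proof -
      have "(\<Inter>j\<in>J. A j) \<subseteq> space M" using J(2) AM unfolding J_Sigma by blast
      then show ?thesis unfolding J_Sigma B_def by auto
    qed
    also have "prob \<dots> = (\<Prod>c<3. prob (B c))"
      using indG BG by (intro indep_setsD) (auto simp: lessThan_empty_iff)
    also have "\<dots> = (\<Prod>c<3. \<Prod>n\<in>Jc c. prob (A (c, n)))"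
      by (intro prod.cong probB) auto
    also have "\<dots> = (\<Prod>j\<in>J. prob (A j))"
      unfolding J_Sigma using finJc by (subst prod.Sigma) (auto simp: case_prod_unfold)
    finally show "prob (\<Inter>j\<in>J. A j) = (\<Prod>j\<in>J. prob (A j))" .
  qed
qed

lemma sets_Sig_events: "K \<subseteq> idx \<Longrightarrow> sets (Sig K) \<subseteq> events"
  unfolding sets_Sig using indep_gen by (intro sets.sigma_sets_subset) (auto simp: indep_sets_def)

lemma measurable_from_Sig:
  assumes "f \<in> measurable (Sig K) N" "K \<subseteq> idx"
  shows "f \<in> measurable M N"
  using measurable_mono[OF order_refl refl sets_Sig_events[OF assms(2)]] assms(1) by auto

lemma indep_set_subset: "indep_set A B \<Longrightarrow> A' \<subseteq> A \<Longrightarrow> B' \<subseteq> B \<Longrightarrow> indep_set A' B'"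
  unfolding indep_sets2_eq by blast

text \<open>Disjoint blocks of an independent family of intersection-stable generators generate
  independent sigma-algebras.\<close>

lemma expectation_indep:
  fixes G H :: "'a \<Rightarrow> 'b::{real_normed_field, banach, second_countable_topology}"
  assumes K: "K \<subseteq> idx" "K' \<subseteq> idx" "K \<inter> K' = {}"
    and G: "G \<in> borel_measurable (Sig K)" "integrable M G"
    and H: "H \<in> borel_measurable (Sig K')" "integrable M H"
  shows "integrable M (\<lambda>\<omega>. G \<omega> * H \<omega>)" "expectation (\<lambda>\<omega>. G \<omega> * H \<omega>) = expectation G * expectation H"
proof -
  have "indep_sets (\<lambda>j. sigma_sets (space M) (\<Union>i\<in>case_bool K K' j. gen i)) UNIV"
  proof (rule indep_sets_collect_sigma)
    show "indep_sets gen (\<Union>j\<in>UNIV. case_bool K K' j)"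
      by (rule indep_sets_mono_index[OF _ indep_gen]) (use K in \<open>auto simp: UNIV_bool\<close>)
    show "disjoint_family_on (case_bool K K') UNIV"
      using K(3) by (auto simp: disjoint_family_on_def split: bool.splits)
  qed (rule Int_stable_gen)
  also have "(\<lambda>j. sigma_sets (space M) (\<Union>i\<in>case_bool K K' j. gen i)) = case_bool (sets (Sig K)) (sets (Sig K'))"
    by (auto simp: sets_Sig fun_eq_iff split: bool.splits)
  finally have ind: "indep_set (sets (Sig K)) (sets (Sig K'))" by (simp add: indep_set_def)
  have gen_sub: "sigma_sets (space M) {f -` A \<inter> space M |A. A \<in> sets borel} \<subseteq> sets (Sig K)"
    if "f \<in> borel_measurable (Sig K)" for f :: "'a \<Rightarrow> 'b" and K
  proof -
    have "{f -` A \<inter> space M |A. A \<in> sets borel} \<subseteq> sets (Sig K)"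
      using measurable_sets[OF that] unfolding space_Sig by blast
    from sets.sigma_sets_subset[OF this] show ?thesis by simp
  qed
  have "indep_var borel G borel H"
    unfolding indep_var_eq
    by (intro conjI measurable_from_Sig[OF G(1) K(1)] measurable_from_Sig[OF H(1) K(2)]
        indep_set_subset[OF ind gen_sub[OF G(1)] gen_sub[OF H(1)]])
  from indep_var_integrable[OF this G(2) H(2)] indep_var_lebesgue_integral[OF this G(2) H(2)]
  show "integrable M (\<lambda>\<omega>. G \<omega> * H \<omega>)" "expectation (\<lambda>\<omega>. G \<omega> * H \<omega>) = expectation G * expectation H" .
qed

section \<open>The filtration and the adapted version of the steps\<close>

definition past :: "nat \<Rightarrow> (nat \<times> nat) set" where
  "past n = {0} \<times> {1..n} \<union> {1, 2} \<times> {2..n}"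

abbreviation filt :: "nat \<Rightarrow> 'a measure" where
  "filt n \<equiv> Sig (past n)"

lemma past_idx: "past n \<subseteq> idx" by (auto simp: past_def idx_def)

lemma past_mono: "m \<le> n \<Longrightarrow> past m \<subseteq> past n" by (auto simp: past_def)

lemma filt_mono: "f \<in> measurable (filt m) N \<Longrightarrow> m \<le> n \<Longrightarrow> f \<in> measurable (filt n) N"
  by (rule measurable_Sig_mono[OF _ past_mono])

lemma filt_measurable: "f \<in> measurable (filt n) N \<Longrightarrow> f \<in> measurable M N"
  by (rule measurable_from_Sig[OF _ past_idx])

text \<open>A version of the steps that satisfies the recursion everywhere, hence is adapted.\<close>

function step :: "nat \<Rightarrow> 'a \<Rightarrow> real" where
  "step n \<omega> = (if \<alpha> n \<omega> \<and> 1 \<le> \<beta> n \<omega> \<and> \<beta> n \<omega> < n \<and> n \<ge> 2 then step (\<beta> n \<omega>) \<omega> else \<xi> n \<omega>)"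
  by auto
termination by (relation "Wellfounded.measure fst") auto

declare step.simps [simp del]

definition recall :: "nat \<Rightarrow> nat \<Rightarrow> 'a \<Rightarrow> real" where
  "recall n k \<omega> = of_bool (\<alpha> (Suc n) \<omega>) * of_bool (\<beta> (Suc n) \<omega> = k)"

text \<open>At most one of the indicators \<open>recall n k\<close> is nonzero, so a case
  distinction becomes an expression linear in \<open>\<phi>\<close>; it holds at every \<omega>,
  also where \<open>\<beta>\<close> leaves its range. This linearity is why functions of the steps
  form reinforced walks with the same memory.\<close>

lemma step_Suc:
  assumes "n \<ge> 1"
  shows "\<phi> (step (Suc n) \<omega>) = (\<Sum>k=1..n. recall n k \<omega> * \<phi> (step k \<omega>)) + (1 - (\<Sum>k=1..n. recall n k \<omega>)) * \<phi> (\<xi> (Suc n) \<omega>)"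
proof (cases "\<alpha> (Suc n) \<omega> \<and> \<beta> (Suc n) \<omega> \<in> {1..n}")
  case True
  have sum: "(\<Sum>k=1..n. recall n k \<omega> * g k) = g (\<beta> (Suc n) \<omega>)" for g
  proof -
    have "(\<Sum>k=1..n. recall n k \<omega> * g k) = (\<Sum>k=1..n. if k = \<beta> (Suc n) \<omega> then g k else 0)"
      using True by (intro sum.cong) (auto simp: recall_def)
    then show ?thesis using True by simp
  qed
  have "step (Suc n) \<omega> = step (\<beta> (Suc n) \<omega>) \<omega>" using True assms by (subst step.simps) auto
  then show ?thesis using sum[of "\<lambda>k. \<phi> (step k \<omega>)"] sum[of "\<lambda>_. 1"] by simp
next
  case False
  have "recall n k \<omega> = 0" if "k \<in> {1..n}" for k using False that by (auto simp: recall_def)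
  moreover have "step (Suc n) \<omega> = \<xi> (Suc n) \<omega>" using False by (subst step.simps) auto
  ultimately show ?thesis by simp
qed

lemma step_1: "step 1 \<omega> = \<xi> 1 \<omega>" by (subst step.simps) auto

lemma step_filt: "n \<ge> 1 \<Longrightarrow> step n \<in> borel_measurable (filt n)"
proof (induction n rule: less_induct)
  case (less n)
  show ?case
  proof (cases "n = 1")
    case True
    then have "step n = \<xi> 1" using step_1 by auto
    then show ?thesis using True by (auto intro: measurable_Sig_xi simp: past_def)
  next
    case False
    then obtain m where m: "n = Suc m" "m \<ge> 1" using less.prems by (cases n) auto
    have [measurable]: "step k \<in> borel_measurable (filt n)" if "k \<in> {1..m}" for k
      by (rule filt_mono[OF less.IH]) (use that m in auto)
    have [measurable]: "\<xi> n \<in> borel_measurable (filt n)" "\<alpha> n \<in> measurable (filt n) (count_space UNIV)"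
      "\<beta> n \<in> measurable (filt n) (count_space UNIV)"
      using m by (auto intro!: measurable_Sig_xi measurable_Sig_alpha measurable_Sig_beta simp: past_def)
    have "(\<lambda>\<omega>. (\<Sum>k=1..m. recall m k \<omega> * step k \<omega>) + (1 - (\<Sum>k=1..m. recall m k \<omega>)) * \<xi> n \<omega>)
       \<in> borel_measurable (filt n)"
      unfolding recall_def m(1)[symmetric] by measurable
    also have "(\<lambda>\<omega>. (\<Sum>k=1..m. recall m k \<omega> * step k \<omega>) + (1 - (\<Sum>k=1..m. recall m k \<omega>)) * \<xi> n \<omega>) = step n"
      using step_Suc[OF m(2), of id] m(1) by auto
    finally show ?thesis .
  qed
qed

lemma step_filt': "1 \<le> k \<Longrightarrow> k \<le> n \<Longrightarrow> step k \<in> borel_measurable (filt n)"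
  using step_filt filt_mono by blast

lemma nu_pos: "n \<ge> 1 \<Longrightarrow> total_memory \<mu> n > 0"
  using total_memory_pos memory_pos by blast

lemma
  assumes "n \<ge> 1"
  shows expectation_recall: "k \<in> {1..n} \<Longrightarrow> expectation (recall n k) = p * \<mu> k / total_memory \<mu> n"
    and integrable_recall: "integrable M (recall n k)"
    and recall_Sig: "recall n k \<in> borel_measurable (Sig {(1, Suc n), (2, Suc n)})"
proof -
  have Suc_idx: "{(1, Suc n)} \<subseteq> idx" "{(2, Suc n)} \<subseteq> idx" using assms by (auto simp: idx_def)
  have a [measurable]: "\<alpha> (Suc n) \<in> measurable (Sig {(1, Suc n)}) (count_space UNIV)"
    and b [measurable]: "\<beta> (Suc n) \<in> measurable (Sig {(2, Suc n)}) (count_space UNIV)"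
    by (auto intro: measurable_Sig_alpha measurable_Sig_beta)
  note aM [measurable] = measurable_from_Sig[OF a Suc_idx(1)] and bM [measurable] = measurable_from_Sig[OF b Suc_idx(2)]
  have ma: "(\<lambda>\<omega>. of_bool (\<alpha> (Suc n) \<omega>) :: real) \<in> borel_measurable (Sig {(1, Suc n)})"
    and mb: "(\<lambda>\<omega>. of_bool (\<beta> (Suc n) \<omega> = k) :: real) \<in> borel_measurable (Sig {(2, Suc n)})"
    by measurable
  have int: "integrable M (\<lambda>\<omega>. of_bool (\<alpha> (Suc n) \<omega>) :: real)" "integrable M (\<lambda>\<omega>. of_bool (\<beta> (Suc n) \<omega> = k) :: real)"
    by (rule integrable_const_bound[of _ 1]; simp)+
  note ex = expectation_indep[OF Suc_idx _ ma int(1) mb int(2)]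
  show "integrable M (recall n k)" using ex(1) by (simp add: recall_def[abs_def])
  show "recall n k \<in> borel_measurable (Sig {(1, Suc n), (2, Suc n)})"
    unfolding recall_def using measurable_Sig_mono[OF ma] measurable_Sig_mono[OF mb] by (intro borel_measurable_times) auto
  have "expectation (\<lambda>\<omega>. of_bool (\<alpha> (Suc n) \<omega>)) = prob {\<omega> \<in> space M. \<alpha> (Suc n) \<omega>}"
  proof -
    have "expectation (\<lambda>\<omega>. of_bool (\<alpha> (Suc n) \<omega>)) = expectation (indicat_real {\<omega> \<in> space M. \<alpha> (Suc n) \<omega>})"
      by (intro Bochner_Integration.integral_cong) (auto simp: indicator_def)
    then show ?thesis by simp
  qed
  also have "\<dots> = measure (distr M (count_space UNIV) (\<alpha> (Suc n))) {True}"
    by (subst measure_distr) (auto intro!: arg_cong[where f=prob])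
  also have "\<dots> = p" using assms p_range by (simp add: recollection_law measure_pmf_single)
  finally have ea: "expectation (\<lambda>\<omega>. of_bool (\<alpha> (Suc n) \<omega>)) = p" .
  assume k: "k \<in> {1..n}"
  have "expectation (\<lambda>\<omega>. of_bool (\<beta> (Suc n) \<omega> = k)) = prob {\<omega> \<in> space M. \<beta> (Suc n) \<omega> = k}"
  proof -
    have "expectation (\<lambda>\<omega>. of_bool (\<beta> (Suc n) \<omega> = k)) = expectation (indicat_real {\<omega> \<in> space M. \<beta> (Suc n) \<omega> = k})"
      by (intro Bochner_Integration.integral_cong) (auto simp: indicator_def)
    then show ?thesis by simp
  qed
  also have "\<dots> = \<mu> k / total_memory \<mu> n"
    using memory_law[of "Suc n" k] k assms by simp
  finally show "expectation (recall n k) = p * \<mu> k / total_memory \<mu> n"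
    using ex(2) ea by (simp add: recall_def[abs_def])
qed

lemma
  fixes \<phi> :: "real \<Rightarrow> real"
  assumes [measurable]: "\<phi> \<in> borel_measurable borel" and n: "n \<ge> 1"
  shows expectation_innovation: "expectation (\<lambda>\<omega>. \<phi> (\<xi> n \<omega>)) = expectation (\<lambda>\<omega>. \<phi> (\<xi> 1 \<omega>))"
    and integrable_innovation: "integrable M (\<lambda>\<omega>. \<phi> (\<xi> n \<omega>)) \<longleftrightarrow> integrable M (\<lambda>\<omega>. \<phi> (\<xi> 1 \<omega>))"
proof -
  have [measurable]: "\<xi> n \<in> borel_measurable M" if "n \<ge> 1" for n
    using innovation_indep that by (auto simp: indep_vars_def)
  show "expectation (\<lambda>\<omega>. \<phi> (\<xi> n \<omega>)) = expectation (\<lambda>\<omega>. \<phi> (\<xi> 1 \<omega>))"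
    using integral_distr[of "\<xi> n" M borel \<phi>] integral_distr[of "\<xi> 1" M borel \<phi>] innovation_ident[OF n] n by simp
  show "integrable M (\<lambda>\<omega>. \<phi> (\<xi> n \<omega>)) \<longleftrightarrow> integrable M (\<lambda>\<omega>. \<phi> (\<xi> 1 \<omega>))"
    using integrable_distr_eq[of "\<xi> n" M borel \<phi>] integrable_distr_eq[of "\<xi> 1" M borel \<phi>] innovation_ident[OF n] n by simp
qed

text \<open>The conditional mean of \<open>\<phi> (step (Suc n))\<close> given
  \<open>filt n\<close>, tested against \<open>G\<close>. The indicators \<open>recall n k\<close>
  and the new innovation are independent of the past, so they enter through their means. The general
  value field of \<open>G\<close> admits complex exponentials.\<close>

theorem one_step:
  fixes \<phi> :: "real \<Rightarrow> real" and G :: "'a \<Rightarrow> 'b::{real_normed_field, banach, second_countable_topology}"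
  assumes n: "n \<ge> 1" and \<phi> [measurable]: "\<phi> \<in> borel_measurable borel"
    and G: "G \<in> borel_measurable (filt n)" "integrable M G"
    and int: "\<And>k. k \<in> {1..n} \<Longrightarrow> integrable M (\<lambda>\<omega>. G \<omega> * of_real (\<phi> (step k \<omega>)))"
    and int\<xi>: "integrable M (\<lambda>\<omega>. \<phi> (\<xi> 1 \<omega>))"
  shows "integrable M (\<lambda>\<omega>. G \<omega> * of_real (\<phi> (step (Suc n) \<omega>)))"
    and "expectation (\<lambda>\<omega>. G \<omega> * of_real (\<phi> (step (Suc n) \<omega>))) =
      (\<Sum>k=1..n. of_real (p * \<mu> k / total_memory \<mu> n) * expectation (\<lambda>\<omega>. G \<omega> * of_real (\<phi> (step k \<omega>))))
      + of_real (1 - p) * of_real (expectation (\<lambda>\<omega>. \<phi> (\<xi> 1 \<omega>))) * expectation G"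
proof -
  define fut where "fut = {(0, Suc n), (1, Suc n), (2::nat, Suc n)}"
  have fut: "fut \<subseteq> idx" "past n \<inter> fut = {}" using n by (auto simp: fut_def idx_def past_def)
  have ri: "integrable M (recall n k)" and rS: "recall n k \<in> borel_measurable (Sig {(1, Suc n), (2, Suc n)})" for k
    using integrable_recall[OF n] recall_Sig[OF n] by auto
  have rF: "recall n k \<in> borel_measurable (Sig fut)" for k
    using measurable_Sig_mono[OF rS] by (auto simp: fut_def)
  have part: "integrable M (\<lambda>\<omega>. G \<omega> * of_real (\<phi> (step k \<omega>)) * of_real (recall n k \<omega>))"
    "expectation (\<lambda>\<omega>. G \<omega> * of_real (\<phi> (step k \<omega>)) * of_real (recall n k \<omega>)) =
       of_real (p * \<mu> k / total_memory \<mu> n) * expectation (\<lambda>\<omega>. G \<omega> * of_real (\<phi> (step k \<omega>)))"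
    if k: "k \<in> {1..n}" for k
  proof -
    have m: "(\<lambda>\<omega>. G \<omega> * of_real (\<phi> (step k \<omega>))) \<in> borel_measurable (filt n)"
    proof -
      have [measurable]: "step k \<in> borel_measurable (filt n)" "G \<in> borel_measurable (filt n)"
        using step_filt'[of k n] k G by auto
      show ?thesis by measurable
    qed
    have r: "(\<lambda>\<omega>. of_real (recall n k \<omega>) :: 'b) \<in> borel_measurable (Sig fut)"
      using rF by measurable
    note ex = expectation_indep[OF past_idx fut m int[OF k] r integrable_of_real[OF ri]]
    show "integrable M (\<lambda>\<omega>. G \<omega> * of_real (\<phi> (step k \<omega>)) * of_real (recall n k \<omega>))" by (rule ex)
    show "expectation (\<lambda>\<omega>. G \<omega> * of_real (\<phi> (step k \<omega>)) * of_real (recall n k \<omega>)) =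
       of_real (p * \<mu> k / total_memory \<mu> n) * expectation (\<lambda>\<omega>. G \<omega> * of_real (\<phi> (step k \<omega>)))"
      using ex(2) expectation_recall[OF n k] ri[of k] by simp
  qed
  \<comment> \<open>Indicator that step \<open>Suc n\<close> is a fresh innovation. It includes the
    null event on which \<open>\<alpha>\<close> holds but \<open>\<beta>\<close> is out of range;
    its mean is still \<open>1 - p\<close>.\<close>
  define J where "J \<omega> = 1 - (\<Sum>k=1..n. recall n k \<omega>)" for \<omega>
  have J: "J \<in> borel_measurable (Sig {(1, Suc n), (2, Suc n)})" "integrable M J"
    unfolding J_def using rS ri by (auto intro!: borel_measurable_diff borel_measurable_sum)
  have EJ: "expectation J = 1 - p"
  proof -
    have "expectation J = 1 - (\<Sum>k=1..n. expectation (recall n k))"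
      unfolding J_def using ri by (simp add: prob_space)
    also have "(\<Sum>k=1..n. expectation (recall n k)) = (\<Sum>k=1..n. p * \<mu> k / total_memory \<mu> n)"
      by (intro sum.cong refl expectation_recall[OF n])
    also have "\<dots> = p * (total_memory \<mu> n / total_memory \<mu> n)"
      unfolding total_memory_def by (simp add: sum_divide_distrib[symmetric] sum_distrib_left[symmetric])
    finally show ?thesis using nu_pos[OF n] by simp
  qed
  have \<xi>S: "(\<lambda>\<omega>. \<phi> (\<xi> (Suc n) \<omega>)) \<in> borel_measurable (Sig {(0, Suc n)})"
    using measurable_Sig_xi[of "Suc n" "{(0, Suc n)}"] by measurable
  have i\<xi>: "integrable M (\<lambda>\<omega>. \<phi> (\<xi> (Suc n) \<omega>))" using integrable_innovation[OF \<phi>, of "Suc n"] int\<xi> by simp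
  have "{(1, Suc n), (2, Suc n)} \<subseteq> idx" "{(0, Suc n)} \<subseteq> idx" "{(1::nat, Suc n), (2, Suc n)} \<inter> {(0, Suc n)} = {}"
    using n by (auto simp: idx_def)
  note ex = expectation_indep[OF this J \<xi>S i\<xi>]
  have mJ: "(\<lambda>\<omega>. of_real (J \<omega> * \<phi> (\<xi> (Suc n) \<omega>)) :: 'b) \<in> borel_measurable (Sig fut)"
  proof -
    have [measurable]: "J \<in> borel_measurable (Sig fut)" "(\<lambda>\<omega>. \<phi> (\<xi> (Suc n) \<omega>)) \<in> borel_measurable (Sig fut)"
      by (rule measurable_Sig_mono[OF J(1)] measurable_Sig_mono[OF \<xi>S]; auto simp: fut_def)+
    show ?thesis by measurable
  qed
  note ex2 = expectation_indep[OF past_idx fut G mJ integrable_of_real[OF ex(1)]]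
  have eq: "G \<omega> * of_real (\<phi> (step (Suc n) \<omega>)) =
     (\<Sum>k=1..n. G \<omega> * of_real (\<phi> (step k \<omega>)) * of_real (recall n k \<omega>)) + G \<omega> * of_real (J \<omega> * \<phi> (\<xi> (Suc n) \<omega>))" for \<omega>
    unfolding step_Suc[OF n] J_def by (simp add: sum_distrib_left distrib_left mult_ac)
  show "integrable M (\<lambda>\<omega>. G \<omega> * of_real (\<phi> (step (Suc n) \<omega>)))"
    unfolding eq using part ex2 by (intro Bochner_Integration.integrable_add Bochner_Integration.integrable_sum)
  have "expectation (\<lambda>\<omega>. G \<omega> * of_real (\<phi> (step (Suc n) \<omega>))) =
     (\<Sum>k=1..n. expectation (\<lambda>\<omega>. G \<omega> * of_real (\<phi> (step k \<omega>)) * of_real (recall n k \<omega>)))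
      + expectation (\<lambda>\<omega>. G \<omega> * of_real (J \<omega> * \<phi> (\<xi> (Suc n) \<omega>)))"
    unfolding eq using part ex2
    by (subst Bochner_Integration.integral_add) (auto intro!: Bochner_Integration.integrable_sum Bochner_Integration.integral_sum)
  also have "(\<Sum>k=1..n. expectation (\<lambda>\<omega>. G \<omega> * of_real (\<phi> (step k \<omega>)) * of_real (recall n k \<omega>))) =
     (\<Sum>k=1..n. of_real (p * \<mu> k / total_memory \<mu> n) * expectation (\<lambda>\<omega>. G \<omega> * of_real (\<phi> (step k \<omega>))))"
    by (intro sum.cong refl part(2))
  also have "expectation (\<lambda>\<omega>. G \<omega> * of_real (J \<omega> * \<phi> (\<xi> (Suc n) \<omega>))) =
     of_real (1 - p) * of_real (expectation (\<lambda>\<omega>. \<phi> (\<xi> 1 \<omega>))) * expectation G"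
  proof -
    have "expectation (\<lambda>\<omega>. of_real (J \<omega> * \<phi> (\<xi> (Suc n) \<omega>)) :: 'b) = of_real (expectation (\<lambda>\<omega>. J \<omega> * \<phi> (\<xi> (Suc n) \<omega>)))"
      by (rule integral_of_real[OF ex(1)])
    also have "expectation (\<lambda>\<omega>. J \<omega> * \<phi> (\<xi> (Suc n) \<omega>)) = (1 - p) * expectation (\<lambda>\<omega>. \<phi> (\<xi> 1 \<omega>))"
      using ex(2) EJ expectation_innovation[OF \<phi>, of "Suc n"] by simp
    finally show ?thesis using ex2(2) by (simp only: of_real_mult mult.commute)
  qed
  finally show "expectation (\<lambda>\<omega>. G \<omega> * of_real (\<phi> (step (Suc n) \<omega>))) =
      (\<Sum>k=1..n. of_real (p * \<mu> k / total_memory \<mu> n) * expectation (\<lambda>\<omega>. G \<omega> * of_real (\<phi> (step k \<omega>))))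
      + of_real (1 - p) * of_real (expectation (\<lambda>\<omega>. \<phi> (\<xi> 1 \<omega>))) * expectation G" .
qed

text \<open>Induction through \<open>one_step\<close> with \<open>G = 1\<close>: the ratios
  \<open>\<mu> k / total_memory \<mu> n\<close> sum to one, so recollection contributes
  \<open>p\<close> and innovation \<open>1 - p\<close> times the same mean. Every step thus has the
  law of \<open>\<xi> 1\<close>.\<close>

lemma step_law:
  fixes \<phi> :: "real \<Rightarrow> real"
  assumes \<phi>: "\<phi> \<in> borel_measurable borel" "integrable M (\<lambda>\<omega>. \<phi> (\<xi> 1 \<omega>))" and "n \<ge> 1"
  shows "integrable M (\<lambda>\<omega>. \<phi> (step n \<omega>)) \<and> expectation (\<lambda>\<omega>. \<phi> (step n \<omega>)) = expectation (\<lambda>\<omega>. \<phi> (\<xi> 1 \<omega>))"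
  using \<open>n \<ge> 1\<close>
proof (induction n rule: less_induct)
  case (less n)
  show ?case
  proof (cases "n = 1")
    case True
    then show ?thesis using \<phi>(2) by (simp add: step_1[unfolded One_nat_def])
  next
    case False
    then obtain m where m: "n = Suc m" "m \<ge> 1" using less.prems by (cases n) auto
    have IH: "integrable M (\<lambda>\<omega>. \<phi> (step k \<omega>))" "expectation (\<lambda>\<omega>. \<phi> (step k \<omega>)) = expectation (\<lambda>\<omega>. \<phi> (\<xi> 1 \<omega>))"
      if "k \<in> {1..m}" for k using less.IH[of k] m that by auto
    have "integrable M (\<lambda>\<omega>. 1 * of_real (\<phi> (step k \<omega>)) :: real)" if "k \<in> {1..m}" for k
      using IH(1)[OF that] by simp
    note o = one_step[where G="\<lambda>_. 1 :: real", OF m(2) \<phi>(1) borel_measurable_const integrable_const this \<phi>(2)]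
    have os: "integrable M (\<lambda>\<omega>. \<phi> (step n \<omega>))" "expectation (\<lambda>\<omega>. \<phi> (step n \<omega>)) =
       (\<Sum>k=1..m. p * \<mu> k / total_memory \<mu> m * expectation (\<lambda>\<omega>. \<phi> (step k \<omega>))) + (1 - p) * expectation (\<lambda>\<omega>. \<phi> (\<xi> 1 \<omega>))"
      using o unfolding m(1) of_real_eq_id id_apply mult_1_left integral_const by (simp_all add: prob_space)
    note os(2)
    also have "(\<Sum>k=1..m. p * \<mu> k / total_memory \<mu> m * expectation (\<lambda>\<omega>. \<phi> (step k \<omega>))) =
       (\<Sum>k=1..m. \<mu> k * (p / total_memory \<mu> m * expectation (\<lambda>\<omega>. \<phi> (\<xi> 1 \<omega>))))"
      by (intro sum.cong refl) (simp only: IH(2), simp)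
    also have "\<dots> = total_memory \<mu> m * (p / total_memory \<mu> m * expectation (\<lambda>\<omega>. \<phi> (\<xi> 1 \<omega>)))"
      unfolding total_memory_def by (rule sum_distrib_right[symmetric])
    also have "\<dots> = p * expectation (\<lambda>\<omega>. \<phi> (\<xi> 1 \<omega>))" using nu_pos[OF m(2)] by simp
    finally show ?thesis using os(1) by (simp add: algebra_simps)
  qed
qed

text \<open>The prescribed probabilities on \<open>{1..n - 1}\<close> add up to one. Hence almost
  surely every \<open>\<beta> n\<close> stays in range, and there the two recursions agree by strong
  induction.\<close>

lemma steps_eq: "AE \<omega> in M. \<forall>n\<ge>1. X n \<omega> = step n \<omega>"
proof -
  have "AE \<omega> in M. \<beta> n \<omega> \<in> {1..n - 1}" if n: "n \<ge> 2" for n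
  proof -
    have [measurable]: "\<beta> n \<in> measurable M (count_space UNIV)"
      using memory_indep n by (auto simp: indep_vars_def)
    have "prob {\<omega> \<in> space M. \<beta> n \<omega> \<in> {1..n - 1}} = prob (\<Union>k\<in>{1..n - 1}. {\<omega> \<in> space M. \<beta> n \<omega> = k})"
      by (intro arg_cong[where f=prob]) auto
    also have "\<dots> = (\<Sum>k=1..n - 1. prob {\<omega> \<in> space M. \<beta> n \<omega> = k})"
      by (intro finite_measure_finite_Union) (auto simp: disjoint_family_on_def)
    also have "\<dots> = (\<Sum>k=1..n - 1. \<mu> k / total_memory \<mu> (n - 1))"
      using n by (intro sum.cong refl memory_law) auto
    also have "\<dots> = total_memory \<mu> (n - 1) / total_memory \<mu> (n - 1)"
      by (simp only: sum_divide_distrib[symmetric] total_memory_def)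
    also have "n - 1 \<ge> 1" using n by simp
    then have "total_memory \<mu> (n - 1) / total_memory \<mu> (n - 1) = 1" using nu_pos[of "n - 1"] by simp
    finally show ?thesis by (subst (asm) prob_Collect_eq_1) auto
  qed
  then have "AE \<omega> in M. \<forall>n\<in>{2..}. \<beta> n \<omega> \<in> {1..n - 1}" by (intro AE_ball_countable') auto
  moreover have "AE \<omega> in M. \<forall>n\<in>{1..}. X (n + 1) \<omega> =
         of_bool (\<alpha> (n + 1) \<omega>) * X (\<beta> (n + 1) \<omega>) \<omega> + (1 - of_bool (\<alpha> (n + 1) \<omega>)) * \<xi> (n + 1) \<omega>"
    using next_step by (intro AE_ball_countable') auto
  ultimately show ?thesis using first_step
  proof eventually_elim
    case (elim \<omega>)
    have "X n \<omega> = step n \<omega>" if "n \<ge> 1" for n using that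
    proof (induction n rule: less_induct)
      case (less n)
      show ?case
      proof (cases "n = 1")
        case True
        then show ?thesis using elim(3) step_1 by simp
      next
        case False
        then have n: "n \<ge> 2" using less.prems by simp
        have \<beta>: "\<beta> n \<omega> \<in> {1..n - 1}" using elim(1) n by auto
        have "X n \<omega> = of_bool (\<alpha> n \<omega>) * X (\<beta> n \<omega>) \<omega> + (1 - of_bool (\<alpha> n \<omega>)) * \<xi> n \<omega>"
          using elim(2)[rule_format, of "n - 1"] n by simp
        also have "X (\<beta> n \<omega>) \<omega> = step (\<beta> n \<omega>) \<omega>" using less.IH[of "\<beta> n \<omega>"] \<beta> n by auto
        finally show ?thesis using \<beta> n by (subst step.simps) auto
      qed
    qed
    then show ?case by blast
  qed
qed

end

section \<open>The martingale of a functional of the steps\<close>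

lemma integrable_mult_of_squares:
  fixes f g :: "'a \<Rightarrow> real"
  assumes [measurable]: "f \<in> borel_measurable M" "g \<in> borel_measurable M"
    and sq: "integrable M (\<lambda>\<omega>. (f \<omega>)\<^sup>2)" "integrable M (\<lambda>\<omega>. (g \<omega>)\<^sup>2)"
  shows "integrable M (\<lambda>\<omega>. f \<omega> * g \<omega>)"
proof (rule Bochner_Integration.integrable_bound[OF Bochner_Integration.integrable_add[OF sq]])
  have "\<bar>a * b\<bar> \<le> a\<^sup>2 + b\<^sup>2" for a b :: real
  proof -
    have "2 * (\<bar>a\<bar> * \<bar>b\<bar>) \<le> a\<^sup>2 + b\<^sup>2" using sum_squares_bound[of "\<bar>a\<bar>" "\<bar>b\<bar>"] by simp
    moreover have "0 \<le> \<bar>a\<bar> * \<bar>b\<bar>" by simp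
    ultimately show ?thesis unfolding abs_mult by linarith
  qed
  then show "AE \<omega> in M. norm (f \<omega> * g \<omega>) \<le> norm ((f \<omega>)\<^sup>2 + (g \<omega>)\<^sup>2)"
    by (intro AE_I2) (simp add: order_trans[OF _ abs_ge_self])
qed simp

lemma (in prob_space) integrable_of_square:
  fixes f :: "'a \<Rightarrow> real"
  assumes "f \<in> borel_measurable M" "integrable M (\<lambda>\<omega>. (f \<omega>)\<^sup>2)"
  shows "integrable M f"
  using integrable_mult_of_squares[of f M "\<lambda>_. 1"] assms by simp

text \<open>Nonnegativity of the variance of \<open>\<bar>f\<bar>\<close>.\<close>

lemma (in prob_space) expectation_abs_le_sqrt:
  fixes f :: "'a \<Rightarrow> real"
  assumes "f \<in> borel_measurable M" "integrable M (\<lambda>\<omega>. (f \<omega>)\<^sup>2)"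
  shows "expectation (\<lambda>\<omega>. \<bar>f \<omega>\<bar>) \<le> sqrt (expectation (\<lambda>\<omega>. (f \<omega>)\<^sup>2))"
proof -
  define m where "m = expectation (\<lambda>\<omega>. \<bar>f \<omega>\<bar>)"
  have int: "integrable M f" by (rule integrable_of_square[OF assms])
  have "0 \<le> expectation (\<lambda>\<omega>. (\<bar>f \<omega>\<bar> - m)\<^sup>2)" by (intro Bochner_Integration.integral_nonneg) simp
  also have "\<dots> = expectation (\<lambda>\<omega>. (f \<omega>)\<^sup>2 - 2 * m * \<bar>f \<omega>\<bar> + m\<^sup>2)"
    by (intro Bochner_Integration.integral_cong) (simp_all add: power2_diff mult_ac)
  also have "\<dots> = expectation (\<lambda>\<omega>. (f \<omega>)\<^sup>2) - m\<^sup>2"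
    using int assms(2) by (simp add: prob_space m_def[symmetric] power2_eq_square)
  finally show ?thesis unfolding m_def[symmetric] by (intro real_le_rsqrt) simp
qed

lemma (in prob_space) expectation_square_add_le:
  fixes f g :: "'a \<Rightarrow> real"
  assumes [measurable]: "f \<in> borel_measurable M" "g \<in> borel_measurable M"
    and sq: "integrable M (\<lambda>\<omega>. (f \<omega>)\<^sup>2)" "integrable M (\<lambda>\<omega>. (g \<omega>)\<^sup>2)"
  shows "integrable M (\<lambda>\<omega>. (f \<omega> + g \<omega>)\<^sup>2)"
    and "expectation (\<lambda>\<omega>. (f \<omega> + g \<omega>)\<^sup>2) \<le> 2 * expectation (\<lambda>\<omega>. (f \<omega>)\<^sup>2) + 2 * expectation (\<lambda>\<omega>. (g \<omega>)\<^sup>2)"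
proof -
  have "integrable M (\<lambda>\<omega>. (f \<omega>)\<^sup>2 + (g \<omega>)\<^sup>2 + 2 * (f \<omega> * g \<omega>))"
    using integrable_mult_of_squares[OF assms] sq by simp
  then show int: "integrable M (\<lambda>\<omega>. (f \<omega> + g \<omega>)\<^sup>2)" by (simp add: power2_sum mult_ac)
  have "(a + b)\<^sup>2 \<le> 2 * a\<^sup>2 + 2 * b\<^sup>2" for a b :: real
    using sum_squares_bound[of a b] by (simp add: power2_sum)
  then have "expectation (\<lambda>\<omega>. (f \<omega> + g \<omega>)\<^sup>2) \<le> expectation (\<lambda>\<omega>. 2 * (f \<omega>)\<^sup>2 + 2 * (g \<omega>)\<^sup>2)"
    using int sq by (intro integral_mono) auto
  also have "\<dots> = 2 * expectation (\<lambda>\<omega>. (f \<omega>)\<^sup>2) + 2 * expectation (\<lambda>\<omega>. (g \<omega>)\<^sup>2)"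
    using sq by simp
  finally show "expectation (\<lambda>\<omega>. (f \<omega> + g \<omega>)\<^sup>2) \<le> 2 * expectation (\<lambda>\<omega>. (f \<omega>)\<^sup>2) + 2 * expectation (\<lambda>\<omega>. (g \<omega>)\<^sup>2)" .
qed

context srrw_rvm
begin

definition l2 :: "nat \<Rightarrow> ('a \<Rightarrow> real) \<Rightarrow> bool" where
  "l2 n h \<longleftrightarrow> h \<in> borel_measurable (filt n) \<and> integrable M (\<lambda>\<omega>. (h \<omega>)\<^sup>2)"

lemma l2_measurable: "l2 n h \<Longrightarrow> h \<in> borel_measurable M"
  unfolding l2_def using filt_measurable by blast

lemma l2_square: "l2 n h \<Longrightarrow> integrable M (\<lambda>\<omega>. (h \<omega>)\<^sup>2)"
  by (simp add: l2_def)

lemma l2_integrable: "l2 n h \<Longrightarrow> integrable M h"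
  by (rule integrable_of_square[OF l2_measurable l2_square])

lemma l2_mult: "l2 n f \<Longrightarrow> l2 m g \<Longrightarrow> integrable M (\<lambda>\<omega>. f \<omega> * g \<omega>)"
  by (rule integrable_mult_of_squares[OF l2_measurable l2_measurable l2_square l2_square])

lemma l2_mono: "l2 m h \<Longrightarrow> m \<le> n \<Longrightarrow> l2 n h"
  unfolding l2_def using filt_mono by blast

lemma l2_scale: "l2 n h \<Longrightarrow> l2 n (\<lambda>\<omega>. c * h \<omega>)"
  by (auto simp: l2_def power_mult_distrib)

lemma l2_divide: "l2 n h \<Longrightarrow> l2 n (\<lambda>\<omega>. h \<omega> / c)"
  using l2_scale[of n h "1 / c"] by simp

lemma l2_add:
  assumes "l2 n f" "l2 n g" shows "l2 n (\<lambda>\<omega>. f \<omega> + g \<omega>)"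
  unfolding l2_def
proof
  show "(\<lambda>\<omega>. f \<omega> + g \<omega>) \<in> borel_measurable (filt n)"
    using assms by (intro borel_measurable_add) (auto simp: l2_def)
  show "integrable M (\<lambda>\<omega>. (f \<omega> + g \<omega>)\<^sup>2)"
    by (rule expectation_square_add_le[OF l2_measurable l2_measurable l2_square l2_square]) (rule assms)+
qed

lemma l2_diff: "l2 n f \<Longrightarrow> l2 n g \<Longrightarrow> l2 n (\<lambda>\<omega>. f \<omega> - g \<omega>)"
  using l2_add[of n f "\<lambda>\<omega>. (- 1) * g \<omega>"] l2_scale[of n g "- 1"] by simp

lemma l2_sum: "finite I \<Longrightarrow> (\<And>i. i \<in> I \<Longrightarrow> l2 n (f i)) \<Longrightarrow> l2 n (\<lambda>\<omega>. \<Sum>i\<in>I. f i \<omega>)"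
proof (induction I rule: finite_induct)
  case empty
  then show ?case by (simp add: l2_def)
next
  case (insert i I)
  then show ?case using l2_add[of n "f i" "\<lambda>\<omega>. \<Sum>i\<in>I. f i \<omega>"] by simp
qed

end

text \<open>A function of the steps is again a step-reinforced walk with the same memory. The function is
  kept as a parameter because the truncated steps and their centred squares are needed as well.\<close>

locale srrw_functional = srrw_rvm M p \<gamma> \<mu> \<xi> \<alpha> \<beta> X
  for M :: "'a measure" and p \<gamma> :: real and \<mu> :: "nat \<Rightarrow> real" and \<xi> :: "nat \<Rightarrow> 'a \<Rightarrow> real"
    and \<alpha> :: "nat \<Rightarrow> 'a \<Rightarrow> bool" and \<beta> :: "nat \<Rightarrow> 'a \<Rightarrow> nat" and X :: "nat \<Rightarrow> 'a \<Rightarrow> real" +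
  fixes \<psi> :: "real \<Rightarrow> real"
  assumes psi_measurable: "\<psi> \<in> borel_measurable borel"
    and psi_square: "integrable M (\<lambda>\<omega>. (\<psi> (\<xi> 1 \<omega>))\<^sup>2)"
    and psi_mean: "expectation (\<lambda>\<omega>. \<psi> (\<xi> 1 \<omega>)) = 0"
begin

definition x :: "nat \<Rightarrow> 'a \<Rightarrow> real" where "x k \<omega> = \<psi> (step k \<omega>)"

definition s2 :: real where "s2 = expectation (\<lambda>\<omega>. (\<psi> (\<xi> 1 \<omega>))\<^sup>2)"

definition Y :: "nat \<Rightarrow> 'a \<Rightarrow> real" where "Y n \<omega> = (\<Sum>k=1..n. \<mu> k * x k \<omega>)"

text \<open>The conditional mean of \<open>x (Suc n)\<close> given the past;
  \<open>next_expectation\<close> says so against test functions.\<close>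

definition drift :: "nat \<Rightarrow> 'a \<Rightarrow> real" where "drift n \<omega> = p / total_memory \<mu> n * Y n \<omega>"

text \<open>The increment of \<open>mart\<close> from \<open>n\<close> to \<open>Suc n\<close>, see
  \<open>mart_Suc\<close>, written so that its orthogonality to the past is visible.\<close>

definition D :: "nat \<Rightarrow> 'a \<Rightarrow> real" where
  "D n \<omega> = mart_weight \<mu> p (Suc n) * (x (Suc n) \<omega> - drift n \<omega>)"

definition mart :: "nat \<Rightarrow> 'a \<Rightarrow> real" where "mart n \<omega> = Y n \<omega> / growth \<mu> p n"

lemma grow_pos: "growth \<mu> p n > 0" using growth_pos memory_pos p_range by blast

lemma s2_nonneg: "s2 \<ge> 0" unfolding s2_def by (intro Bochner_Integration.integral_nonneg) simp

lemma l2_x: "1 \<le> k \<Longrightarrow> k \<le> n \<Longrightarrow> l2 n (x k)"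
  and x_square: "1 \<le> k \<Longrightarrow> expectation (\<lambda>\<omega>. (x k \<omega>)\<^sup>2) = s2"
proof -
  have m: "(\<lambda>y. (\<psi> y)\<^sup>2) \<in> borel_measurable borel" using psi_measurable by measurable
  { assume k: "1 \<le> k"
    note sl = step_law[OF m psi_square k]
    show "expectation (\<lambda>\<omega>. (x k \<omega>)\<^sup>2) = s2" using sl by (simp add: x_def s2_def)
    assume "k \<le> n"
    then show "l2 n (x k)"
      using sl measurable_compose[OF step_filt'[OF k] psi_measurable] by (simp add: l2_def x_def[abs_def]) }
qed

lemma l2_Y: "l2 n (Y n)"
  unfolding Y_def[abs_def] by (intro l2_sum l2_scale l2_x) auto

lemma l2_drift: "l2 n (drift n)"
  unfolding drift_def[abs_def] by (intro l2_scale l2_Y)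

lemma l2_mart: "l2 n (mart n)"
  unfolding mart_def[abs_def] by (intro l2_divide l2_Y)

lemma l2_D: "l2 (Suc n) (D n)"
  unfolding D_def[abs_def] by (intro l2_scale l2_diff l2_x l2_mono[OF l2_drift]) auto

lemma psi_integrable: "integrable M (\<lambda>\<omega>. \<psi> (\<xi> 1 \<omega>))"
proof (rule integrable_of_square[OF _ psi_square])
  have "\<xi> 1 \<in> borel_measurable M" using innovation_indep by (simp add: indep_vars_def)
  then show "(\<lambda>\<omega>. \<psi> (\<xi> 1 \<omega>)) \<in> borel_measurable M" using psi_measurable by measurable
qed

text \<open>\<open>one_step\<close> for a function of mean zero: the innovation term drops out and
  the recollection terms sum to \<open>drift\<close>. Integrability is assumed term by term so that
  square integrable and bounded complex \<open>G\<close> are both covered.\<close>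

lemma
  fixes G :: "'a \<Rightarrow> 'b::{real_normed_field, banach, second_countable_topology}"
  assumes n: "n \<ge> 1" and G: "G \<in> borel_measurable (filt n)" "integrable M G"
    and int: "\<And>k. k \<in> {1..n} \<Longrightarrow> integrable M (\<lambda>\<omega>. G \<omega> * of_real (x k \<omega>))"
  shows next_integrable: "integrable M (\<lambda>\<omega>. G \<omega> * of_real (x (Suc n) \<omega>))" (is ?A)
    and drift_integrable: "integrable M (\<lambda>\<omega>. G \<omega> * of_real (drift n \<omega>))" (is ?B)
    and next_expectation: "expectation (\<lambda>\<omega>. G \<omega> * of_real (x (Suc n) \<omega>)) = expectation (\<lambda>\<omega>. G \<omega> * of_real (drift n \<omega>))" (is ?C)
proof -
  note os = one_step[OF n psi_measurable G int[unfolded x_def] psi_integrable]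
  show ?A using os(1) by (simp add: x_def)
  have eq: "G \<omega> * of_real (drift n \<omega>) = (\<Sum>k=1..n. of_real (p * \<mu> k / total_memory \<mu> n) * (G \<omega> * of_real (x k \<omega>)))" for \<omega>
    unfolding drift_def Y_def by (simp add: sum_distrib_left mult_ac)
  show ?B unfolding eq using int by (intro Bochner_Integration.integrable_sum integrable_mult_right)
  have "expectation (\<lambda>\<omega>. G \<omega> * of_real (drift n \<omega>)) =
      (\<Sum>k=1..n. expectation (\<lambda>\<omega>. of_real (p * \<mu> k / total_memory \<mu> n) * (G \<omega> * of_real (x k \<omega>))))"
    unfolding eq using int by (intro Bochner_Integration.integral_sum integrable_mult_right)
  also have "\<dots> = (\<Sum>k=1..n. of_real (p * \<mu> k / total_memory \<mu> n) * expectation (\<lambda>\<omega>. G \<omega> * of_real (x k \<omega>)))"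
    by (intro sum.cong refl integral_mult_right_zero)
  finally show ?C using os(2) unfolding psi_mean by (simp add: x_def)
qed

lemma
  assumes n: "n \<ge> 1" and G: "l2 n G"
  shows orthogonal: "expectation (\<lambda>\<omega>. G \<omega> * (x (Suc n) \<omega> - drift n \<omega>)) = 0"
    and orthogonal_D: "expectation (\<lambda>\<omega>. G \<omega> * D n \<omega>) = 0"
proof -
  have int: "integrable M (\<lambda>\<omega>. G \<omega> * of_real (x k \<omega>))" if "k \<in> {1..n}" for k
    using l2_mult[OF G l2_x[of k n]] that by simp
  have Gm: "G \<in> borel_measurable (filt n)" using G by (simp add: l2_def)
  note facts = next_integrable[OF n Gm l2_integrable[OF G] int] drift_integrable[OF n Gm l2_integrable[OF G] int]
    next_expectation[OF n Gm l2_integrable[OF G] int]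
  then show *: "expectation (\<lambda>\<omega>. G \<omega> * (x (Suc n) \<omega> - drift n \<omega>)) = 0"
    by (simp add: right_diff_distrib)
  have "expectation (\<lambda>\<omega>. G \<omega> * D n \<omega>) = expectation (\<lambda>\<omega>. mart_weight \<mu> p (Suc n) * (G \<omega> * (x (Suc n) \<omega> - drift n \<omega>)))"
    by (simp add: D_def mult_ac)
  also have "\<dots> = 0" using * by simp
  finally show "expectation (\<lambda>\<omega>. G \<omega> * D n \<omega>) = 0" .
qed

text \<open>Since \<open>drift\<close> is orthogonal to \<open>x - drift\<close>, the mean square of
  \<open>x - drift\<close> is \<open>s2\<close> minus that of \<open>drift\<close>.\<close>

lemma D_square: 
  assumes n: "n \<ge> 1"
  shows "expectation (\<lambda>\<omega>. (D n \<omega>)\<^sup>2) \<le> s2 * (mart_weight \<mu> p (Suc n))\<^sup>2"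
proof -
  have i1: "integrable M (\<lambda>\<omega>. (x (Suc n) \<omega>)\<^sup>2)" by (rule l2_square[OF l2_x[of "Suc n" "Suc n"]]) auto
  have i2: "integrable M (\<lambda>\<omega>. (drift n \<omega>)\<^sup>2)" by (rule l2_square[OF l2_drift])
  have i3: "integrable M (\<lambda>\<omega>. drift n \<omega> * (x (Suc n) \<omega> - drift n \<omega>))"
    by (rule l2_mult[OF l2_drift l2_diff[OF l2_x l2_mono[OF l2_drift]]]) auto
  have "expectation (\<lambda>\<omega>. (x (Suc n) \<omega> - drift n \<omega>)\<^sup>2) =
      expectation (\<lambda>\<omega>. (x (Suc n) \<omega>)\<^sup>2 - (drift n \<omega>)\<^sup>2 - 2 * (drift n \<omega> * (x (Suc n) \<omega> - drift n \<omega>)))"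
    by (intro Bochner_Integration.integral_cong) (simp_all add: power2_eq_square algebra_simps)
  also have "\<dots> = s2 - expectation (\<lambda>\<omega>. (drift n \<omega>)\<^sup>2)"
    using i1 i2 i3 orthogonal[OF n l2_drift] x_square[of "Suc n"] by simp
  also have "\<dots> \<le> s2" by simp
  finally have "expectation (\<lambda>\<omega>. (x (Suc n) \<omega> - drift n \<omega>)\<^sup>2) \<le> s2" .
  then have "(mart_weight \<mu> p (Suc n))\<^sup>2 * expectation (\<lambda>\<omega>. (x (Suc n) \<omega> - drift n \<omega>)\<^sup>2) \<le> (mart_weight \<mu> p (Suc n))\<^sup>2 * s2"
    by (rule mult_left_mono) simp
  then show ?thesis unfolding D_def power_mult_distrib by (simp add: mult.commute)
qed

text \<open>Pythagoras for orthogonal increments. The weights stay free because two choices are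
  needed: indicators give increments of \<open>mart\<close>, and summation by parts gives
  \<open>remainder\<close>.\<close>

lemma
  shows l2_transform: "n \<ge> 1 \<Longrightarrow> l2 n (\<lambda>\<omega>. \<Sum>k=1..<n. w k * D k \<omega>)"
    and transform_square: "n \<ge> 1 \<Longrightarrow> expectation (\<lambda>\<omega>. (\<Sum>k=1..<n. w k * D k \<omega>)\<^sup>2) \<le> s2 * (\<Sum>k=1..<n. (w k * mart_weight \<mu> p (Suc k))\<^sup>2)"
proof -
  have l: "l2 n (\<lambda>\<omega>. \<Sum>k=1..<n. w k * D k \<omega>)" for n
    by (intro l2_sum l2_scale l2_mono[OF l2_D]) auto
  then show "n \<ge> 1 \<Longrightarrow> l2 n (\<lambda>\<omega>. \<Sum>k=1..<n. w k * D k \<omega>)" .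
  assume "n \<ge> 1"
  then show "expectation (\<lambda>\<omega>. (\<Sum>k=1..<n. w k * D k \<omega>)\<^sup>2) \<le> s2 * (\<Sum>k=1..<n. (w k * mart_weight \<mu> p (Suc k))\<^sup>2)"
  proof (induction n rule: dec_induct)
    case (step n)
    define T where "T \<omega> = (\<Sum>k=1..<n. w k * D k \<omega>)" for \<omega>
    have T: "l2 n T" unfolding T_def[abs_def] by (rule l)
    have "expectation (\<lambda>\<omega>. (\<Sum>k=1..<Suc n. w k * D k \<omega>)\<^sup>2) =
       expectation (\<lambda>\<omega>. (T \<omega>)\<^sup>2 + (w n)\<^sup>2 * (D n \<omega>)\<^sup>2 + 2 * w n * (T \<omega> * D n \<omega>))"
    proof (intro Bochner_Integration.integral_cong refl)
      fix \<omega>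
      have "(\<Sum>k=1..<Suc n. w k * D k \<omega>) = T \<omega> + w n * D n \<omega>" using step(1) by (simp add: T_def)
      then show "(\<Sum>k=1..<Suc n. w k * D k \<omega>)\<^sup>2 = (T \<omega>)\<^sup>2 + (w n)\<^sup>2 * (D n \<omega>)\<^sup>2 + 2 * w n * (T \<omega> * D n \<omega>)"
        by (simp only:) (simp add: power2_sum power_mult_distrib mult_ac)
    qed
    also have "\<dots> = expectation (\<lambda>\<omega>. (T \<omega>)\<^sup>2) + (w n)\<^sup>2 * expectation (\<lambda>\<omega>. (D n \<omega>)\<^sup>2)"
      using l2_square[OF T] l2_square[OF l2_D, of n] l2_mult[OF T l2_D] orthogonal_D[OF step(1) T] by simp
    also have "\<dots> \<le> s2 * (\<Sum>k=1..<n. (w k * mart_weight \<mu> p (Suc k))\<^sup>2) + (w n)\<^sup>2 * (s2 * (mart_weight \<mu> p (Suc n))\<^sup>2)"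
      using step.IH D_square[OF step(1)] unfolding T_def by (intro add_mono mult_left_mono) auto
    also have "\<dots> = s2 * (\<Sum>k=1..<Suc n. (w k * mart_weight \<mu> p (Suc k))\<^sup>2)"
      using step(1) by (simp add: algebra_simps power_mult_distrib)
    finally show ?case .
  qed simp
qed

text \<open>The factor in \<open>growth\<close> is made for this: \<open>Y n + \<mu> (Suc n) * drift
  n = Y n * (1 + p * (\<mu> (Suc n) / total_memory \<mu> n))\<close>.\<close>

lemma mart_Suc:
  assumes n: "n \<ge> 1"
  shows "mart (Suc n) \<omega> = mart n \<omega> + D n \<omega>"
proof -
  have g: "growth \<mu> p (Suc n) = growth \<mu> p n * (1 + p * (\<mu> (Suc n) / total_memory \<mu> n))" by (rule growth_Suc[OF n])
  define q where "q = 1 + p * (\<mu> (Suc n) / total_memory \<mu> n)"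
  have pos: "growth \<mu> p n > 0" "growth \<mu> p n * q > 0" using grow_pos[of n] grow_pos[of "Suc n"] g by (simp_all add: q_def)
  then have q: "q > 0" by (simp add: zero_less_mult_iff)
  have "mart (Suc n) \<omega> - D n \<omega> = (Y n \<omega> + \<mu> (Suc n) * drift n \<omega>) / (growth \<mu> p n * q)"
    unfolding mart_def D_def mart_weight_def g q_def[symmetric] by (simp add: Y_def algebra_simps add_divide_distrib[symmetric] diff_divide_distrib[symmetric])
  also have "Y n \<omega> + \<mu> (Suc n) * drift n \<omega> = Y n \<omega> * q"
    by (simp add: drift_def q_def algebra_simps)
  finally show ?thesis using q by (simp add: mart_def)
qed

lemma mart_diff:
  assumes "1 \<le> m" "m \<le> n"
  shows "mart n \<omega> - mart m \<omega> = (\<Sum>k=1..<n. of_bool (m \<le> k) * D k \<omega>)"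
  using assms(2)
proof (induction n rule: dec_induct)
  case base
  have "(\<Sum>k=1..<m. of_bool (m \<le> k) * D k \<omega>) = 0" by (intro sum.neutral) auto
  then show ?case by simp
next
  case (step n)
  then show ?case using mart_Suc[of n \<omega>] assms(1) by simp
qed

lemma mart_diff_square:
  assumes "1 \<le> m" "m \<le> n"
  shows "expectation (\<lambda>\<omega>. (mart n \<omega> - mart m \<omega>)\<^sup>2) \<le> s2 * (clock \<mu> p n - clock \<mu> p m)"
proof -
  have "expectation (\<lambda>\<omega>. (mart n \<omega> - mart m \<omega>)\<^sup>2) \<le> s2 * (\<Sum>k=1..<n. (of_bool (m \<le> k) * mart_weight \<mu> p (Suc k))\<^sup>2)"
    unfolding mart_diff[OF assms] using assms by (intro transform_square) simp
  also have "(\<Sum>k=1..<n. (of_bool (m \<le> k) * mart_weight \<mu> p (Suc k))\<^sup>2) = clock \<mu> p n - clock \<mu> p m"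
    using assms(2)
  proof (induction n rule: dec_induct)
    case base
    have "(\<Sum>k=1..<m. (of_bool (m \<le> k) * mart_weight \<mu> p (Suc k))\<^sup>2) = 0" by (intro sum.neutral) auto
    then show ?case by simp
  next
    case (step n)
    then show ?case using clock_Suc[of n \<mu> p] assms(1) by simp
  qed
  finally show ?thesis .
qed

lemma mart_1: "mart 1 \<omega> = \<mu> 1 * x 1 \<omega>" by (simp add: mart_def Y_def growth_def)

lemma mart_square:
  assumes "n \<ge> 1"
  shows "expectation (\<lambda>\<omega>. (mart n \<omega>)\<^sup>2) \<le> 2 * s2 * ((\<mu> 1)\<^sup>2 + clock \<mu> p n)"
proof -
  have l: "l2 n (mart 1)" using l2_mono[OF l2_mart assms] .
  note le = expectation_square_add_le(2)[OF l2_measurable l2_measurable l2_square l2_square,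
      OF l2_diff[OF l2_mart l] l l2_diff[OF l2_mart l] l]
  have "expectation (\<lambda>\<omega>. (mart n \<omega>)\<^sup>2) = expectation (\<lambda>\<omega>. ((mart n \<omega> - mart 1 \<omega>) + mart 1 \<omega>)\<^sup>2)" by simp
  also note le
  also have "expectation (\<lambda>\<omega>. (mart 1 \<omega>)\<^sup>2) = (\<mu> 1)\<^sup>2 * s2"
    unfolding mart_1 power_mult_distrib using x_square[of 1] by simp
  finally show ?thesis using mart_diff_square[OF order_refl assms] by (simp add: clock_def algebra_simps)
qed

text \<open>The main part is taken from time \<open>1\<close> on, where the clock is zero, so that
  it is an increment of the martingale with variance bounded by the clock.\<close>

definition remainder :: "nat \<Rightarrow> 'a \<Rightarrow> real" where
  "remainder n \<omega> = (\<Sum>k=1..n. x k \<omega>) - drift_sum \<mu> p n * (mart n \<omega> - mart 1 \<omega>)"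

lemma l2_remainder: "n \<ge> 1 \<Longrightarrow> l2 n (remainder n)"
  unfolding remainder_def[abs_def]
  by (intro l2_diff l2_sum l2_x l2_scale l2_mart l2_mono[OF l2_mart]) auto

text \<open>Summation by parts turns the accumulated drift into a martingale transform.\<close>

lemma remainder_eq:
  assumes "n \<ge> 1"
  shows "remainder n \<omega> = (1 + drift_sum \<mu> p n * \<mu> 1) * x 1 \<omega> +
     (\<Sum>k=1..<n. (1 / mart_weight \<mu> p (Suc k) - drift_sum \<mu> p (Suc k)) * D k \<omega>)"
  using assms
proof (induction n rule: dec_induct)
  case base
  then show ?case by (simp add: remainder_def drift_sum_def)
next
  case (step n)
  define r where "r = p * (growth \<mu> p n / total_memory \<mu> n)"
  define b where "b = mart_weight \<mu> p (Suc n)"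
  have b: "b > 0" using memory_pos[of "Suc n"] grow_pos[of "Suc n"] by (simp add: b_def mart_weight_def)
  have ds: "drift_sum \<mu> p (Suc n) = drift_sum \<mu> p n + r" unfolding r_def by (rule drift_sum_Suc[OF step(1)])
  have d: "drift n \<omega> = r * mart n \<omega>" using grow_pos[of n] by (simp add: drift_def r_def mart_def)
  have x: "x (Suc n) \<omega> = D n \<omega> / b + drift n \<omega>" using b by (simp add: D_def b_def[symmetric])
  have "remainder (Suc n) \<omega> - remainder n \<omega> =
      x (Suc n) \<omega> - ((drift_sum \<mu> p n + r) * (mart n \<omega> + D n \<omega> - mart 1 \<omega>) - drift_sum \<mu> p n * (mart n \<omega> - mart 1 \<omega>))"
    unfolding remainder_def ds mart_Suc[OF step(1)] by simp
  also have "\<dots> = (1 / b - (drift_sum \<mu> p n + r)) * D n \<omega> + r * mart 1 \<omega>"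
    unfolding x d by (simp add: algebra_simps)
  finally have "remainder (Suc n) \<omega> = remainder n \<omega> + (1 / b - (drift_sum \<mu> p n + r)) * D n \<omega> + r * mart 1 \<omega>" by simp
  then show ?case unfolding step.IH using step(1)
    by (simp add: ds mart_1[unfolded One_nat_def] b_def[symmetric] algebra_simps)
qed

text \<open>Multiplied by \<open>mart_weight\<close>, the weights of \<open>remainder_eq\<close>
  become \<open>1 - drift_sum * mart_weight\<close>. This is bounded in the critical regime, where
  \<open>drift_sum\<close> is of order \<open>sqrt (n * ln n)\<close> and \<open>mart_weight\<close>
  of the inverse order. The separate first term is the coefficient of \<open>x 1\<close>.\<close>

lemma remainder_square:
  assumes n: "n \<ge> 1"
  shows "expectation (\<lambda>\<omega>. (remainder n \<omega>)\<^sup>2) \<le> 2 * s2 * ((1 + drift_sum \<mu> p n * \<mu> 1)\<^sup>2 +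
     (\<Sum>k=1..<n. (1 - drift_sum \<mu> p (Suc k) * mart_weight \<mu> p (Suc k))\<^sup>2))"
proof -
  define w where "w k = 1 / mart_weight \<mu> p (Suc k) - drift_sum \<mu> p (Suc k)" for k
  define c where "c = 1 + drift_sum \<mu> p n * \<mu> 1"
  have l1: "l2 n (\<lambda>\<omega>. c * x 1 \<omega>)" using n by (intro l2_scale l2_x) auto
  have l2: "l2 n (\<lambda>\<omega>. \<Sum>k=1..<n. w k * D k \<omega>)" by (rule l2_transform[OF n])
  have "expectation (\<lambda>\<omega>. (remainder n \<omega>)\<^sup>2) \<le> 2 * expectation (\<lambda>\<omega>. (c * x 1 \<omega>)\<^sup>2) + 2 * expectation (\<lambda>\<omega>. (\<Sum>k=1..<n. w k * D k \<omega>)\<^sup>2)"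
    unfolding remainder_eq[OF n] c_def[symmetric] w_def[symmetric]
    by (rule expectation_square_add_le(2)[OF l2_measurable l2_measurable l2_square l2_square, OF l1 l2 l1 l2])
  also have "expectation (\<lambda>\<omega>. (c * x 1 \<omega>)\<^sup>2) = c\<^sup>2 * s2"
    unfolding power_mult_distrib using x_square[of 1] by simp
  also have "2 * (c\<^sup>2 * s2) + 2 * expectation (\<lambda>\<omega>. (\<Sum>k=1..<n. w k * D k \<omega>)\<^sup>2) \<le>
     2 * (c\<^sup>2 * s2) + 2 * (s2 * (\<Sum>k=1..<n. (w k * mart_weight \<mu> p (Suc k))\<^sup>2))"
    using transform_square[OF n, of w] by simp
  also have "(\<Sum>k=1..<n. (w k * mart_weight \<mu> p (Suc k))\<^sup>2) = (\<Sum>k=1..<n. (1 - drift_sum \<mu> p (Suc k) * mart_weight \<mu> p (Suc k))\<^sup>2)"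
  proof (rule sum.cong[OF refl])
    fix k
    have "mart_weight \<mu> p (Suc k) \<noteq> 0" using memory_pos[of "Suc k"] grow_pos[of "Suc k"] by (simp add: mart_weight_def)
    then show "(w k * mart_weight \<mu> p (Suc k))\<^sup>2 = (1 - drift_sum \<mu> p (Suc k) * mart_weight \<mu> p (Suc k))\<^sup>2"
      by (simp add: w_def left_diff_distrib)
  qed
  finally show ?thesis by (simp add: c_def algebra_simps)
qed

end

section \<open>The central limit theorem for the martingale\<close>

lemma abs_exp_minus_le:
  fixes y :: real
  assumes "y \<ge> 0"
  shows "\<bar>exp (- y) - (1 - y)\<bar> \<le> y\<^sup>2"
proof -
  have "exp (- y) \<ge> 1 - y" using exp_ge_add_one_self[of "- y"] by simp
  moreover have "exp (- y) \<le> 1 / (1 + y)"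
    using exp_ge_add_one_self[of y] assms by (simp add: exp_minus divide_inverse le_imp_inverse_le)
  moreover have "1 / (1 + y) \<le> 1 - y + y\<^sup>2"
  proof -
    have "0 \<le> y ^ 3" using assms by simp
    then have "1 \<le> (1 - y + y\<^sup>2) * (1 + y)" by (simp add: power2_eq_square power3_eq_cube algebra_simps)
    then show ?thesis using assms by (simp add: pos_divide_le_eq)
  qed
  ultimately show ?thesis by (simp add: abs_le_iff)
qed

lemma cmod_iexp_diff_le: "cmod (iexp a - iexp b) \<le> \<bar>a - b\<bar>"
proof -
  have "iexp a - iexp b = iexp b * (iexp (a - b) - 1)"
    by (simp add: right_diff_distrib exp_diff)
  also have "cmod \<dots> = cmod (iexp (a - b) - 1)" by (simp add: norm_mult)
  also have "\<dots> \<le> \<bar>a - b\<bar>" using iexp_approx1[of "a - b" 0] by simp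
  finally show ?thesis .
qed

lemma iexp_approx_2: "cmod (iexp y - (1 + \<i> * y - of_real (y\<^sup>2 / 2))) \<le> \<bar>y\<bar> ^ 3 / 6"
proof -
  have 1: "(\<Sum>k\<le>2. (\<i> * complex_of_real y) ^ k / fact k) = 1 + \<i> * y - of_real (y\<^sup>2 / 2)"
    by (simp add: numeral_2_eq_2 power_mult_distrib algebra_simps)
  have 2: "\<bar>y\<bar> ^ Suc 2 / fact (Suc 2) = \<bar>y\<bar> ^ 3 / 6" by (simp add: eval_nat_numeral)
  show ?thesis using iexp_approx1[of y 2] unfolding 1 2 .
qed

lemma (in prob_space) norm_expectation_mult_le:
  fixes G :: "'a \<Rightarrow> complex" and H :: "'a \<Rightarrow> real"
  assumes "G \<in> borel_measurable M" "\<And>\<omega>. cmod (G \<omega>) \<le> 1" "integrable M H"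
  shows "integrable M (\<lambda>\<omega>. G \<omega> * of_real (H \<omega>))"
    and "cmod (expectation (\<lambda>\<omega>. G \<omega> * of_real (H \<omega>))) \<le> expectation (\<lambda>\<omega>. \<bar>H \<omega>\<bar>)"
proof -
  have le: "norm (G \<omega> * of_real (H \<omega>)) \<le> norm (H \<omega>)" for \<omega>
    using assms(2)[of \<omega>] by (simp add: norm_mult mult_left_le_one_le)
  show int: "integrable M (\<lambda>\<omega>. G \<omega> * of_real (H \<omega>))"
    by (rule Bochner_Integration.integrable_bound[OF assms(3)])
      (use le assms in \<open>auto intro!: borel_measurable_times\<close>)
  have "cmod (expectation (\<lambda>\<omega>. G \<omega> * of_real (H \<omega>))) \<le> expectation (\<lambda>\<omega>. cmod (G \<omega> * of_real (H \<omega>)))"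
    by (rule integral_norm_bound)
  also have "\<dots> \<le> expectation (\<lambda>\<omega>. \<bar>H \<omega>\<bar>)"
    using int assms(3) le by (intro integral_mono) auto
  finally show "cmod (expectation (\<lambda>\<omega>. G \<omega> * of_real (H \<omega>))) \<le> expectation (\<lambda>\<omega>. \<bar>H \<omega>\<bar>)" .
qed

context srrw_functional
begin

lemma weight_pos: "mart_weight \<mu> p (Suc n) > 0"
  using memory_pos[of "Suc n"] grow_pos[of "Suc n"] by (simp add: mart_weight_def)

text \<open>\<open>drift n\<close> is \<open>p * growth / total_memory\<close> times
  \<open>mart n\<close>. The square of this factor is of order \<open>ln n / n\<close>, while the
  second moment of \<open>mart n\<close> grows only like \<open>ln (ln n)\<close>. This is a weak
  law of large numbers for memory-weighted averages of a centred function of the steps.\<close>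

lemma drift_square_tendsto:
  assumes "critical_regime \<mu> p c \<rho>"
  shows "(\<lambda>n. expectation (\<lambda>\<omega>. (drift n \<omega>)\<^sup>2)) \<longlonglongrightarrow> 0"
proof (rule Lim_null_comparison)
  define u where "u n = growth \<mu> p n / total_memory \<mu> n" for n
  have u: "(\<lambda>n. u n * sqrt (real n / ln (real n))) \<longlonglongrightarrow> \<rho> / (2 * p)"
    and cl: "(\<lambda>n. clock \<mu> p n / ln (ln (real n))) \<longlonglongrightarrow> c"
    using assms by (auto simp: critical_regime_def u_def)
  show "\<forall>\<^sub>F n in sequentially. norm (expectation (\<lambda>\<omega>. (drift n \<omega>)\<^sup>2)) \<le> (u n)\<^sup>2 * (2 * s2 * ((\<mu> 1)\<^sup>2 + clock \<mu> p n))"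
    using eventually_ge_at_top[of 1]
  proof eventually_elim
    case (elim n)
    have "drift n \<omega> = p * u n * mart n \<omega>" for \<omega>
      using grow_pos[of n] by (simp add: drift_def u_def mart_def)
    then have "expectation (\<lambda>\<omega>. (drift n \<omega>)\<^sup>2) = p\<^sup>2 * (u n)\<^sup>2 * expectation (\<lambda>\<omega>. (mart n \<omega>)\<^sup>2)"
      by (simp add: power_mult_distrib)
    also have "\<dots> \<le> 1 * (u n)\<^sup>2 * (2 * s2 * ((\<mu> 1)\<^sup>2 + clock \<mu> p n))"
      using p_range by (intro mult_mono mart_square[OF elim] mult_nonneg_nonneg Bochner_Integration.integral_nonneg) (auto simp: power_le_one)
    finally show ?case by simp
  qed
  have "(\<lambda>n. (u n * sqrt (real n / ln (real n)))\<^sup>2 * (2 * s2 * ((\<mu> 1)\<^sup>2 * (ln (real n) / real n) + (clock \<mu> p n / ln (ln (real n))) * (ln (ln (real n)) * ln (real n) / real n))))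
      \<longlonglongrightarrow> (\<rho> / (2 * p))\<^sup>2 * (2 * s2 * ((\<mu> 1)\<^sup>2 * 0 + c * 0))"
  proof (intro tendsto_mult tendsto_power tendsto_add tendsto_const u cl)
    show "(\<lambda>n. ln (real n) / real n) \<longlonglongrightarrow> 0" by real_asymp
    show "(\<lambda>n. ln (ln (real n)) * ln (real n) / real n) \<longlonglongrightarrow> 0" by real_asymp
  qed
  moreover have "\<forall>\<^sub>F n in sequentially. (u n * sqrt (real n / ln (real n)))\<^sup>2 * (2 * s2 * ((\<mu> 1)\<^sup>2 * (ln (real n) / real n) + (clock \<mu> p n / ln (ln (real n))) * (ln (ln (real n)) * ln (real n) / real n)))
     = (u n)\<^sup>2 * (2 * s2 * ((\<mu> 1)\<^sup>2 + clock \<mu> p n))"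
    using eventually_ge_at_top[of 4]
  proof eventually_elim
    case (elim n)
    have l: "ln (real n) > 1"
    proof -
      have "exp 1 \<le> (3::real)" by (rule exp_le)
      also have "3 < real n" using elim by simp
      finally have "ln (exp 1) < ln (real n)" using elim by (subst ln_less_cancel_iff) auto
      then show ?thesis by simp
    qed
    then have ll: "ln (ln (real n)) > 0" by simp
    have "(sqrt (real n / ln (real n)))\<^sup>2 = real n / ln (real n)" using l by simp
    then have "(u n * sqrt (real n / ln (real n)))\<^sup>2 = (u n)\<^sup>2 * (real n / ln (real n))" by (simp only: power_mult_distrib)
    moreover have "real n / ln (real n) * ((\<mu> 1)\<^sup>2 * (ln (real n) / real n) + (clock \<mu> p n / ln (ln (real n))) * (ln (ln (real n)) * ln (real n) / real n)) = (\<mu> 1)\<^sup>2 + clock \<mu> p n"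
      using l ll elim by (simp add: field_simps)
    moreover have "(a * q) * (2 * s2 * E) = a * (2 * s2 * (q * E))" for a q E :: real by simp
    ultimately show ?case by (simp only:)
  qed
  ultimately show "(\<lambda>n. (u n)\<^sup>2 * (2 * s2 * ((\<mu> 1)\<^sup>2 + clock \<mu> p n))) \<longlonglongrightarrow> 0"
    using Lim_transform_eventually by fastforce
qed

end

locale srrw_bounded = srrw_functional M p \<gamma> \<mu> \<xi> \<alpha> \<beta> X \<psi>
  for M :: "'a measure" and p \<gamma> :: real and \<mu> :: "nat \<Rightarrow> real" and \<xi> :: "nat \<Rightarrow> 'a \<Rightarrow> real"
    and \<alpha> :: "nat \<Rightarrow> 'a \<Rightarrow> bool" and \<beta> :: "nat \<Rightarrow> 'a \<Rightarrow> nat" and X :: "nat \<Rightarrow> 'a \<Rightarrow> real"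
    and \<psi> :: "real \<Rightarrow> real" +
  fixes C :: real
  assumes psi_bound: "\<bar>\<psi> y\<bar> \<le> C"
begin

lemma C_nonneg: "C \<ge> 0" using psi_bound[of 0] by (meson abs_ge_zero order_trans)

lemma psi_sq_le: "(\<psi> y)\<^sup>2 \<le> C\<^sup>2"
  using psi_bound[of y] C_nonneg by (metis abs_le_square_iff abs_of_nonneg)

text \<open>Boundedness supplies the fourth moment that makes the centred squares square integrable;
  all results on functionals, in particular the decay of the drift, then hold for them.\<close>

lemma square_functional: "srrw_functional M p \<gamma> \<mu> \<xi> \<alpha> \<beta> X (\<lambda>y. (\<psi> y)\<^sup>2 - s2)"
proof
  have [measurable]: "\<xi> 1 \<in> borel_measurable M" using innovation_indep by (simp add: indep_vars_def)
  note [measurable] = psi_measurable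
  show "(\<lambda>y. (\<psi> y)\<^sup>2 - s2) \<in> borel_measurable borel" by measurable
  have m: "(\<lambda>\<omega>. ((\<psi> (\<xi> 1 \<omega>))\<^sup>2 - s2)\<^sup>2) \<in> borel_measurable M" by measurable
  have "\<bar>(\<psi> y)\<^sup>2 - s2\<bar> \<le> C\<^sup>2 + s2" for y
    using psi_sq_le[of y] s2_nonneg zero_le_power2[of "\<psi> y"] by linarith
  then have "((\<psi> y)\<^sup>2 - s2)\<^sup>2 \<le> (C\<^sup>2 + s2)\<^sup>2" for y
    using s2_nonneg by (metis abs_ge_zero order_trans power2_abs power_mono)
  then show "integrable M (\<lambda>\<omega>. ((\<psi> (\<xi> 1 \<omega>))\<^sup>2 - s2)\<^sup>2)"
    by (intro integrable_const_bound[OF _ m, of "(C\<^sup>2 + s2)\<^sup>2"] AE_I2) simp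
  show "expectation (\<lambda>\<omega>. (\<psi> (\<xi> 1 \<omega>))\<^sup>2 - s2) = 0"
    using psi_square by (simp only: Bochner_Integration.integral_diff integrable_const integral_const) (simp add: prob_space s2_def)
qed

sublocale Q: srrw_functional M p \<gamma> \<mu> \<xi> \<alpha> \<beta> X "\<lambda>y. (\<psi> y)\<^sup>2 - s2"
  by (rule square_functional)

text \<open>Bounds the distance in mean between the conditional variance of the next normalised step
  and \<open>s2\<close>.\<close>

definition delta :: "nat \<Rightarrow> real" where
  "delta n = expectation (\<lambda>\<omega>. \<bar>Q.drift n \<omega>\<bar>) + expectation (\<lambda>\<omega>. (drift n \<omega>)\<^sup>2)"

lemma delta_nonneg: "delta n \<ge> 0"
  unfolding delta_def by (intro add_nonneg_nonneg Bochner_Integration.integral_nonneg) auto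

lemma delta_tendsto:
  assumes "critical_regime \<mu> p c \<rho>"
  shows "delta \<longlonglongrightarrow> 0"
proof -
  have "(\<lambda>n. sqrt (expectation (\<lambda>\<omega>. (Q.drift n \<omega>)\<^sup>2)) + expectation (\<lambda>\<omega>. (drift n \<omega>)\<^sup>2)) \<longlonglongrightarrow> sqrt 0 + 0"
    by (intro tendsto_add tendsto_real_sqrt drift_square_tendsto[OF assms] Q.drift_square_tendsto[OF assms])
  then have lim: "(\<lambda>n. sqrt (expectation (\<lambda>\<omega>. (Q.drift n \<omega>)\<^sup>2)) + expectation (\<lambda>\<omega>. (drift n \<omega>)\<^sup>2)) \<longlonglongrightarrow> 0" by simp
  show ?thesis
  proof (rule Lim_null_comparison[OF _ lim])
    have "norm (delta n) \<le> sqrt (expectation (\<lambda>\<omega>. (Q.drift n \<omega>)\<^sup>2)) + expectation (\<lambda>\<omega>. (drift n \<omega>)\<^sup>2)" for n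
      using expectation_abs_le_sqrt[OF l2_measurable[OF Q.l2_drift] l2_square[OF Q.l2_drift], of n] delta_nonneg[of n]
      by (simp add: delta_def)
    then show "\<forall>\<^sub>F n in sequentially. norm (delta n) \<le> sqrt (expectation (\<lambda>\<omega>. (Q.drift n \<omega>)\<^sup>2)) + expectation (\<lambda>\<omega>. (drift n \<omega>)\<^sup>2)"
      by simp
  qed
qed

lemma x_bound: "\<bar>x k \<omega>\<bar> \<le> C" by (simp add: x_def psi_bound)

lemma drift_bound:
  assumes n: "n \<ge> 1" shows "\<bar>drift n \<omega>\<bar> \<le> C"
proof -
  have "\<bar>Y n \<omega>\<bar> \<le> (\<Sum>k=1..n. \<mu> k * C)"
    unfolding Y_def
  proof (rule order_trans[OF sum_abs], rule sum_mono)
    fix k assume "k \<in> {1..n}"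
    then have "\<mu> k > 0" by (intro memory_pos) auto
    then show "\<bar>\<mu> k * x k \<omega>\<bar> \<le> \<mu> k * C" using x_bound[of k \<omega>] by (simp add: abs_mult)
  qed
  also have "\<dots> = total_memory \<mu> n * C" by (simp add: total_memory_def sum_distrib_right)
  finally have "\<bar>Y n \<omega>\<bar> / total_memory \<mu> n \<le> C" using nu_pos[OF n] by (simp add: pos_divide_le_eq mult.commute)
  moreover have "\<bar>drift n \<omega>\<bar> = p * (\<bar>Y n \<omega>\<bar> / total_memory \<mu> n)"
    using nu_pos[OF n] p_range by (simp add: drift_def abs_mult)
  moreover have "p * (\<bar>Y n \<omega>\<bar> / total_memory \<mu> n) \<le> \<bar>Y n \<omega>\<bar> / total_memory \<mu> n"
    using nu_pos[OF n] p_range by (intro mult_left_le_one_le) auto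
  ultimately show ?thesis by linarith
qed

lemma D_bound: "n \<ge> 1 \<Longrightarrow> \<bar>D n \<omega>\<bar> \<le> 2 * C * mart_weight \<mu> p (Suc n)"
proof -
  assume n: "n \<ge> 1"
  have "\<bar>x (Suc n) \<omega> - drift n \<omega>\<bar> \<le> 2 * C" using x_bound[of "Suc n" \<omega>] drift_bound[OF n, of \<omega>] by linarith
  then have "mart_weight \<mu> p (Suc n) * \<bar>x (Suc n) \<omega> - drift n \<omega>\<bar> \<le> mart_weight \<mu> p (Suc n) * (2 * C)"
    using weight_pos[of n] by (intro mult_left_mono) auto
  then show ?thesis using weight_pos[of n] by (simp add: D_def abs_mult mult_ac)
qed

text \<open>The cost of one replacement: the cubic Taylor remainder of the exponential (the
  \<open>2\<close> rounds up \<open>2^3 / 6\<close>, the increment being at most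
  \<open>2 * C\<close> times its weight), the random part of the conditional variance, and the error
  of \<open>1 - y\<close> against \<open>exp (- y)\<close>.\<close>

definition err :: "nat \<Rightarrow> real \<Rightarrow> real" where
  "err n \<tau> = 2 * C ^ 3 * (\<bar>\<tau>\<bar> * mart_weight \<mu> p (Suc n)) ^ 3
     + (\<tau> * mart_weight \<mu> p (Suc n))\<^sup>2 * delta n + (\<tau>\<^sup>2 * s2 * (mart_weight \<mu> p (Suc n))\<^sup>2 / 2)\<^sup>2"

lemma err_nonneg: "err n \<tau> \<ge> 0"
  unfolding err_def using weight_pos[of n] C_nonneg delta_nonneg[of n]
  by (intro add_nonneg_nonneg mult_nonneg_nonneg zero_le_power zero_le_power2) auto

text \<open>Second-order expansion of the exponential. The linear term vanishes, and the quadratic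
  one has conditional mean \<open>b^2 * (s2 + Q.drift n - (drift n)^2)\<close> with \<open>b\<close>
  the weight of the increment; exchanging it for \<open>b^2 * s2\<close> costs \<open>delta\<close>.
  \<open>G\<close> is only required to be bounded by one and to depend on the past, so it can hold
  all earlier factors.\<close>

lemma char_step:
  fixes G :: "'a \<Rightarrow> complex"
  assumes n: "n \<ge> 1" and G: "G \<in> borel_measurable (filt n)" "\<And>\<omega>. cmod (G \<omega>) \<le> 1"
  shows "cmod (expectation (\<lambda>\<omega>. G \<omega> * iexp (\<tau> * D n \<omega>)) -
     expectation G * of_real (exp (- (\<tau>\<^sup>2 * s2 * (mart_weight \<mu> p (Suc n))\<^sup>2 / 2)))) \<le> err n \<tau>"
proof -
  define b where "b = mart_weight \<mu> p (Suc n)"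
  have b: "b > 0" unfolding b_def by (rule weight_pos)
  have GM: "G \<in> borel_measurable M" by (rule filt_measurable[OF G(1)])
  note bd = norm_expectation_mult_le[OF GM G(2)]
  have intG: "integrable M G" using bd(1)[of "\<lambda>_. 1"] by simp
  have xi: "integrable M (\<lambda>\<omega>. G \<omega> * of_real (x k \<omega>))" if "k \<in> {1..n}" for k
    by (rule bd(1)[OF l2_integrable[OF l2_x[of k n]]]) (use that in auto)
  have iD: "integrable M (\<lambda>\<omega>. G \<omega> * of_real (D n \<omega>))" by (rule bd(1)[OF l2_integrable[OF l2_D]])
  have iD2: "integrable M (\<lambda>\<omega>. G \<omega> * of_real ((D n \<omega>)\<^sup>2))" by (rule bd(1)[OF l2_square[OF l2_D]])
  have ED: "expectation (\<lambda>\<omega>. G \<omega> * of_real (D n \<omega>)) = 0"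
  proof -
    have "expectation (\<lambda>\<omega>. G \<omega> * of_real (D n \<omega>)) =
      expectation (\<lambda>\<omega>. of_real b * (G \<omega> * of_real (x (Suc n) \<omega>) - G \<omega> * of_real (drift n \<omega>)))"
      by (intro Bochner_Integration.integral_cong) (simp_all add: D_def b_def algebra_simps)
    also have "\<dots> = of_real b * (expectation (\<lambda>\<omega>. G \<omega> * of_real (x (Suc n) \<omega>)) - expectation (\<lambda>\<omega>. G \<omega> * of_real (drift n \<omega>)))"
      using next_integrable[OF n G(1) intG xi] drift_integrable[OF n G(1) intG xi]
      by (simp only: integral_mult_right_zero Bochner_Integration.integral_diff)
    also have "\<dots> = 0" using next_expectation[OF n G(1) intG xi] by simp
    finally show ?thesis .
  qed
  have ED2: "cmod (expectation (\<lambda>\<omega>. G \<omega> * of_real ((D n \<omega>)\<^sup>2)) - of_real (b\<^sup>2 * s2) * expectation G) \<le> b\<^sup>2 * delta n"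
  proof -
    \<comment> \<open>In \<open>(x - drift)^2 = x^2 - drift^2 - 2 * drift * (x - drift)\<close> the
      last term has mean zero against \<open>G\<close>, by the martingale property tested with
      \<open>H\<close>.\<close>
    define H where "H \<omega> = G \<omega> * of_real (drift n \<omega>)" for \<omega>
    have H: "H \<in> borel_measurable (filt n)"
      unfolding H_def[abs_def] using G(1) l2_drift[of n] unfolding l2_def by (intro borel_measurable_times borel_measurable_of_real) auto
    have iH: "integrable M H" unfolding H_def[abs_def] by (rule bd(1)[OF l2_integrable[OF l2_drift]])
    have Hx: "integrable M (\<lambda>\<omega>. H \<omega> * of_real (x k \<omega>))" if "k \<in> {1..n}" for k
    proof -
      have "integrable M (\<lambda>\<omega>. drift n \<omega> * x k \<omega>)" by (rule l2_mult[OF l2_drift l2_x[of k n]]) (use that in auto)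
      from bd(1)[OF this] show ?thesis by (simp add: H_def mult.assoc)
    qed
    note Hf = next_integrable[OF n H iH Hx] drift_integrable[OF n H iH Hx] next_expectation[OF n H iH Hx]
    have Qi: "integrable M (\<lambda>\<omega>. G \<omega> * of_real (Q.x k \<omega>))" if "k \<in> {1..n}" for k
      by (rule bd(1)[OF l2_integrable[OF Q.l2_x[of k n]]]) (use that in auto)
    note Qf = Q.next_integrable[OF n G(1) intG Qi] Q.next_expectation[OF n G(1) intG Qi]
    have idr: "integrable M (\<lambda>\<omega>. G \<omega> * of_real ((drift n \<omega>)\<^sup>2))" by (rule bd(1)[OF l2_square[OF l2_drift]])
    have pw: "G \<omega> * of_real ((D n \<omega>)\<^sup>2) = of_real (b\<^sup>2) * (G \<omega> * of_real (Q.x (Suc n) \<omega>) + of_real s2 * G \<omega>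
        - G \<omega> * of_real ((drift n \<omega>)\<^sup>2) - 2 * (H \<omega> * of_real (x (Suc n) \<omega>) - H \<omega> * of_real (drift n \<omega>)))" for \<omega>
    proof -
      have "(D n \<omega>)\<^sup>2 = b\<^sup>2 * (Q.x (Suc n) \<omega> + s2 - (drift n \<omega>)\<^sup>2 - 2 * (drift n \<omega> * x (Suc n) \<omega> - drift n \<omega> * drift n \<omega>))"
      proof -
        have q: "Q.x (Suc n) \<omega> = (x (Suc n) \<omega>)\<^sup>2 - s2" by (simp add: Q.x_def x_def)
        show ?thesis unfolding q D_def b_def[symmetric] by (simp add: power2_eq_square algebra_simps)
      qed
      then show ?thesis unfolding H_def by (simp only:) (simp add: algebra_simps)
    qed
    have e1: "expectation (\<lambda>\<omega>. G \<omega> * of_real ((D n \<omega>)\<^sup>2)) = of_real (b\<^sup>2) * (expectation (\<lambda>\<omega>. G \<omega> * of_real (Q.x (Suc n) \<omega>)) + of_real s2 * expectation G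
        - expectation (\<lambda>\<omega>. G \<omega> * of_real ((drift n \<omega>)\<^sup>2)) - 2 * (expectation (\<lambda>\<omega>. H \<omega> * of_real (x (Suc n) \<omega>)) - expectation (\<lambda>\<omega>. H \<omega> * of_real (drift n \<omega>))))"
      unfolding pw using Hf Qf intG idr
      by (simp only: integral_mult_right_zero Bochner_Integration.integral_diff Bochner_Integration.integral_add
          Bochner_Integration.integrable_diff Bochner_Integration.integrable_add integrable_mult_right)
    define T1 where "T1 = expectation (\<lambda>\<omega>. G \<omega> * of_real (Q.drift n \<omega>))"
    define T2 where "T2 = expectation (\<lambda>\<omega>. G \<omega> * of_real ((drift n \<omega>)\<^sup>2))"
    have e2: "expectation (\<lambda>\<omega>. G \<omega> * of_real ((D n \<omega>)\<^sup>2)) - of_real (b\<^sup>2 * s2) * expectation G = of_real (b\<^sup>2) * (T1 - T2)"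
    proof -
      have "expectation (\<lambda>\<omega>. H \<omega> * of_real (x (Suc n) \<omega>)) = expectation (\<lambda>\<omega>. H \<omega> * of_real (drift n \<omega>))"
        by (rule next_expectation[OF n H iH Hx])
      moreover have "expectation (\<lambda>\<omega>. G \<omega> * of_real (Q.x (Suc n) \<omega>)) = T1"
        unfolding T1_def by (rule Q.next_expectation[OF n G(1) intG Qi])
      ultimately show ?thesis unfolding e1 T2_def by (simp add: algebra_simps)
    qed
    have t: "cmod T1 \<le> expectation (\<lambda>\<omega>. \<bar>Q.drift n \<omega>\<bar>)" "cmod T2 \<le> expectation (\<lambda>\<omega>. (drift n \<omega>)\<^sup>2)"
      unfolding T1_def T2_def using bd(2)[OF l2_integrable[OF Q.l2_drift], of n] bd(2)[OF l2_square[OF l2_drift], of n] by simp_all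
    have "cmod (T1 - T2) \<le> delta n" unfolding delta_def using norm_triangle_ineq4[of T1 T2] t by linarith
    then have "b\<^sup>2 * cmod (T1 - T2) \<le> b\<^sup>2 * delta n" by (rule mult_left_mono) simp
    then show ?thesis unfolding e2 norm_mult norm_of_real by simp
  qed
  define R where "R \<omega> = iexp (\<tau> * D n \<omega>) - (1 + \<i> * (\<tau> * D n \<omega>) - of_real ((\<tau> * D n \<omega>)\<^sup>2 / 2))" for \<omega>
  have DM [measurable]: "D n \<in> borel_measurable M" by (rule l2_measurable[OF l2_D])
  have Rb: "cmod (R \<omega>) \<le> 2 * C ^ 3 * (\<bar>\<tau>\<bar> * b) ^ 3" for \<omega>
  proof -
    have "cmod (R \<omega>) \<le> \<bar>\<tau> * D n \<omega>\<bar> ^ 3 / 6" unfolding R_def of_real_mult[symmetric] by (rule iexp_approx_2)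
    also have "\<dots> \<le> (\<bar>\<tau>\<bar> * (2 * C * b)) ^ 3 / 6"
      using D_bound[OF n, of \<omega>] unfolding b_def abs_mult
      by (intro divide_right_mono power_mono mult_left_mono mult_nonneg_nonneg) auto
    also have "\<dots> = 8 / 6 * (C ^ 3 * (\<bar>\<tau>\<bar> * b) ^ 3)" by (simp add: power_mult_distrib)
    also have "\<dots> \<le> 2 * (C ^ 3 * (\<bar>\<tau>\<bar> * b) ^ 3)"
      using C_nonneg b by (intro mult_right_mono mult_nonneg_nonneg zero_le_power) auto
    finally show ?thesis by simp
  qed
  have RM: "R \<in> borel_measurable M" unfolding R_def[abs_def] by measurable
  have Rbd0: "2 * C ^ 3 * (\<bar>\<tau>\<bar> * b) ^ 3 \<ge> 0" using C_nonneg b by (intro mult_nonneg_nonneg zero_le_power) auto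
  have GR: "cmod (G \<omega> * R \<omega>) \<le> 2 * C ^ 3 * (\<bar>\<tau>\<bar> * b) ^ 3" for \<omega>
    unfolding norm_mult using mult_mono[OF G(2) Rb] by simp
  have iR: "integrable M (\<lambda>\<omega>. G \<omega> * R \<omega>)"
    by (rule integrable_const_bound[of _ "2 * C ^ 3 * (\<bar>\<tau>\<bar> * b) ^ 3"]) (use GR GM RM in auto)
  have ER: "cmod (expectation (\<lambda>\<omega>. G \<omega> * R \<omega>)) \<le> 2 * C ^ 3 * (\<bar>\<tau>\<bar> * b) ^ 3"
  proof -
    have "cmod (expectation (\<lambda>\<omega>. G \<omega> * R \<omega>)) \<le> expectation (\<lambda>\<omega>. cmod (G \<omega> * R \<omega>))" by (rule integral_norm_bound)
    also have "\<dots> \<le> expectation (\<lambda>\<omega>. 2 * C ^ 3 * (\<bar>\<tau>\<bar> * b) ^ 3)"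
      using iR GR by (intro integral_mono) auto
    finally show ?thesis by (simp add: prob_space)
  qed
  have pw: "G \<omega> * iexp (\<tau> * D n \<omega>) = G \<omega> + (\<i> * of_real \<tau>) * (G \<omega> * of_real (D n \<omega>))
      - of_real (\<tau>\<^sup>2 / 2) * (G \<omega> * of_real ((D n \<omega>)\<^sup>2)) + G \<omega> * R \<omega>" for \<omega>
    unfolding R_def by (simp add: algebra_simps power_mult_distrib)
  have E1: "expectation (\<lambda>\<omega>. G \<omega> * iexp (\<tau> * D n \<omega>)) = expectation G
      - of_real (\<tau>\<^sup>2 / 2) * expectation (\<lambda>\<omega>. G \<omega> * of_real ((D n \<omega>)\<^sup>2)) + expectation (\<lambda>\<omega>. G \<omega> * R \<omega>)"
    unfolding pw using intG iD iD2 iR ED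
    by (simp only: integral_mult_right_zero Bochner_Integration.integral_diff Bochner_Integration.integral_add
          Bochner_Integration.integrable_diff Bochner_Integration.integrable_add integrable_mult_right) simp
  define y where "y = \<tau>\<^sup>2 * s2 * b\<^sup>2 / 2"
  have y: "y \<ge> 0" using s2_nonneg by (simp add: y_def)
  have EG: "cmod (expectation G) \<le> 1" using bd(2)[of "\<lambda>_. 1"] by (simp add: prob_space)
  have split: "expectation (\<lambda>\<omega>. G \<omega> * iexp (\<tau> * D n \<omega>)) - expectation G * of_real (exp (- y)) =
      expectation (\<lambda>\<omega>. G \<omega> * R \<omega>)
      - of_real (\<tau>\<^sup>2 / 2) * (expectation (\<lambda>\<omega>. G \<omega> * of_real ((D n \<omega>)\<^sup>2)) - of_real (b\<^sup>2 * s2) * expectation G)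
      - expectation G * of_real (exp (- y) - (1 - y))"
    unfolding E1 by (simp add: y_def algebra_simps)
  have tri: "cmod (a1 - a2 - a3) \<le> cmod a1 + cmod a2 + cmod a3" for a1 a2 a3
    by (rule order_trans[OF norm_triangle_ineq4 add_right_mono[OF norm_triangle_ineq4]])
  have T2: "cmod (of_real (\<tau>\<^sup>2 / 2) * (expectation (\<lambda>\<omega>. G \<omega> * of_real ((D n \<omega>)\<^sup>2)) - of_real (b\<^sup>2 * s2) * expectation G)) \<le> \<tau>\<^sup>2 / 2 * (b\<^sup>2 * delta n)"
    unfolding norm_mult norm_of_real using ED2 by (intro mult_mono) auto
  have T2': "\<tau>\<^sup>2 / 2 * (b\<^sup>2 * delta n) \<le> (\<tau> * b)\<^sup>2 * delta n"
    using delta_nonneg[of n] by (simp add: power_mult_distrib field_simps)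
  have T3: "cmod (expectation G * of_real (exp (- y) - (1 - y))) \<le> 1 * y\<^sup>2"
    unfolding norm_mult norm_of_real using EG abs_exp_minus_le[OF y] by (intro mult_mono) auto
  have "cmod (expectation (\<lambda>\<omega>. G \<omega> * iexp (\<tau> * D n \<omega>)) - expectation G * of_real (exp (- y))) \<le>
     2 * C ^ 3 * (\<bar>\<tau>\<bar> * b) ^ 3 + (\<tau> * b)\<^sup>2 * delta n + y\<^sup>2"
    unfolding split by (rule order_trans[OF tri]) (use ER T2 T2' T3 in linarith)
  then show ?thesis unfolding err_def b_def[symmetric] y_def .
qed

text \<open>\<open>char_step\<close> replaces the newest increment while the event and all older
  increments sit in \<open>G\<close>. Each replacement multiplies the older error by
  \<open>exp (- y) \<le> 1\<close>, so errors only add up.\<close>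

lemma char_increment:
  assumes mn: "1 \<le> m" "m \<le> n" and A: "A \<in> sets (filt m)"
  shows "cmod (expectation (\<lambda>\<omega>. indicator A \<omega> * iexp (\<tau> * (mart n \<omega> - mart m \<omega>))) -
     prob A * of_real (exp (- (\<tau>\<^sup>2 * s2 * (clock \<mu> p n - clock \<mu> p m) / 2)))) \<le> (\<Sum>k=m..<n. err k \<tau>)"
  using mn(2)
proof (induction n rule: dec_induct)
  case base
  have AM: "A \<in> events" using A sets_Sig_events[OF past_idx] by blast
  then have "expectation (\<lambda>\<omega>. indicator A \<omega> :: complex) = of_real (prob A)"
  proof -
    have "(\<lambda>\<omega>. indicator A \<omega> :: complex) = (\<lambda>\<omega>. of_real (indicator A \<omega>))" by (auto simp: indicator_def)
    then show ?thesis using AM sets.sets_into_space[OF AM] by (simp add: Int_absorb2)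
  qed
  then show ?case by simp
next
  case (step n)
  have n: "n \<ge> 1" using step mn by simp
  define G where "G \<omega> = indicator A \<omega> * iexp (\<tau> * (mart n \<omega> - mart m \<omega>))" for \<omega>
  have [measurable]: "mart n \<in> borel_measurable (filt n)" "mart m \<in> borel_measurable (filt n)"
    using l2_mart[of n] l2_mono[OF l2_mart step(1)] by (simp_all add: l2_def)
  have [measurable]: "A \<in> sets (filt n)" using A sets_Sig_mono[OF past_mono[OF step(1)]] by blast
  have G: "G \<in> borel_measurable (filt n)" unfolding G_def[abs_def] by measurable
  have G1: "cmod (G \<omega>) \<le> 1" for \<omega> by (simp add: G_def norm_mult indicator_def)
  define y where "y = \<tau>\<^sup>2 * s2 * (mart_weight \<mu> p (Suc n))\<^sup>2 / 2"
  have y: "y \<ge> 0" using s2_nonneg by (simp add: y_def)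
  define z where "z = prob A * of_real (exp (- (\<tau>\<^sup>2 * s2 * (clock \<mu> p n - clock \<mu> p m) / 2)))"
  have 1: "indicator A \<omega> * iexp (\<tau> * (mart (Suc n) \<omega> - mart m \<omega>)) = G \<omega> * iexp (\<tau> * D n \<omega>)" for \<omega>
    unfolding G_def mart_Suc[OF n] by (simp add: exp_add[symmetric] algebra_simps)
  have 2: "prob A * of_real (exp (- (\<tau>\<^sup>2 * s2 * (clock \<mu> p (Suc n) - clock \<mu> p m) / 2))) = z * of_real (exp (- y))"
  proof -
    have "- (\<tau>\<^sup>2 * s2 * (clock \<mu> p (Suc n) - clock \<mu> p m) / 2) = - (\<tau>\<^sup>2 * s2 * (clock \<mu> p n - clock \<mu> p m) / 2) + - y"
      unfolding clock_Suc[OF n] y_def by (simp add: field_simps)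
    then show ?thesis unfolding z_def by (simp only: exp_add of_real_mult mult.assoc)
  qed
  have split: "cmod (expectation (\<lambda>\<omega>. G \<omega> * iexp (\<tau> * D n \<omega>)) - z * of_real (exp (- y))) \<le>
     cmod (expectation (\<lambda>\<omega>. G \<omega> * iexp (\<tau> * D n \<omega>)) - expectation G * of_real (exp (- y))) + cmod ((expectation G - z) * of_real (exp (- y)))"
    by (rule order_trans[OF _ norm_triangle_ineq]) (simp add: left_diff_distrib)
  have s1: "cmod (expectation (\<lambda>\<omega>. G \<omega> * iexp (\<tau> * D n \<omega>)) - expectation G * of_real (exp (- y))) \<le> err n \<tau>"
    unfolding y_def by (rule char_step[OF n G G1])
  have s2': "cmod ((expectation G - z) * of_real (exp (- y))) \<le> cmod (expectation G - z)"
    unfolding norm_mult norm_of_real using y by (intro mult_left_le) auto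
  have s3: "cmod (expectation G - z) \<le> (\<Sum>k=m..<n. err k \<tau>)" using step.IH unfolding G_def z_def .
  have "(\<Sum>k=m..<Suc n. err k \<tau>) = (\<Sum>k=m..<n. err k \<tau>) + err n \<tau>" using step(1) by simp
  with split s1 s2' s3 show ?case unfolding 1 2 by linarith
qed

end

lemma critical_regime_bounds:
  assumes reg: "critical_regime \<mu> p c \<rho>"
  shows critical_regime_weight: "\<exists>B. \<forall>n. \<bar>mart_weight \<mu> p n\<bar> \<le> B"
    and critical_regime_clock: "filterlim (clock \<mu> p) at_top sequentially"
proof -
  have w: "(\<lambda>n. (mart_weight \<mu> p n)\<^sup>2 * (real n * ln (real n))) \<longlonglongrightarrow> c"
    and cl: "(\<lambda>n. clock \<mu> p n / ln (ln (real n))) \<longlonglongrightarrow> c" and c: "c > 0"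
    using reg by (simp_all add: critical_regime_def)
  have "(\<lambda>n. (mart_weight \<mu> p n)\<^sup>2 * (real n * ln (real n)) * (1 / (real n * ln (real n)))) \<longlonglongrightarrow> c * 0"
    by (intro tendsto_mult w) real_asymp
  moreover have "\<forall>\<^sub>F n in sequentially. (mart_weight \<mu> p n)\<^sup>2 * (real n * ln (real n)) * (1 / (real n * ln (real n))) = (mart_weight \<mu> p n)\<^sup>2"
    using eventually_ge_at_top[of 2] by eventually_elim simp
  ultimately have "(\<lambda>n. (mart_weight \<mu> p n)\<^sup>2) \<longlonglongrightarrow> c * 0" by (rule Lim_transform_eventually)
  then have "(\<lambda>n. sqrt ((mart_weight \<mu> p n)\<^sup>2)) \<longlonglongrightarrow> sqrt (c * 0)" by (rule tendsto_real_sqrt)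
  then have "Bseq (\<lambda>n. \<bar>mart_weight \<mu> p n\<bar>)" by (simp add: convergent_imp_Bseq convergentI)
  then show "\<exists>B. \<forall>n. \<bar>mart_weight \<mu> p n\<bar> \<le> B" unfolding Bseq_def by auto
  have "filterlim (\<lambda>n. clock \<mu> p n / ln (ln (real n)) * ln (ln (real n))) at_top sequentially"
    by (rule filterlim_tendsto_pos_mult_at_top[OF cl c]) real_asymp
  moreover have "\<forall>\<^sub>F n in sequentially. ln (ln (real n)) > 0" by real_asymp
  then have "\<forall>\<^sub>F n in sequentially. clock \<mu> p n / ln (ln (real n)) * ln (ln (real n)) = clock \<mu> p n"
    by eventually_elim simp
  ultimately show "filterlim (clock \<mu> p) at_top sequentially"
    using filterlim_cong[OF refl refl] by fastforce
qed

lemma sum_one_shift: "(\<Sum>k=1..<Suc n. f k) = (\<Sum>k<n. f (Suc k))" for f :: "nat \<Rightarrow> real"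
  by (induction n) simp_all

context srrw_bounded
begin

text \<open>\<open>delta\<close> tends to zero without a rate, so its weighted sum is compared with
  the diverging clock as a weighted Cesaro mean. The index shift matches sums from \<open>1\<close>
  with sums over \<open>{..<n}\<close>.\<close>

lemma delta_average_tendsto:
  assumes reg: "critical_regime \<mu> p c \<rho>"
  shows "(\<lambda>n. (\<Sum>k=1..<n. (mart_weight \<mu> p (Suc k))\<^sup>2 * delta k) / clock \<mu> p n) \<longlonglongrightarrow> 0"
proof -
  have "(\<lambda>n. (\<Sum>k<n. (mart_weight \<mu> p (Suc (Suc k)))\<^sup>2 * delta (Suc k)) / (\<Sum>k<n. (mart_weight \<mu> p (Suc (Suc k)))\<^sup>2)) \<longlonglongrightarrow> 0"
  proof (rule weighted_average_tendsto_0)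
    show "(mart_weight \<mu> p (Suc (Suc n)))\<^sup>2 > 0" for n using weight_pos[of "Suc n"] by simp
    have "filterlim (\<lambda>n. clock \<mu> p (Suc n)) at_top sequentially"
      using critical_regime_clock[OF reg] by (simp add: filterlim_sequentially_Suc)
    then show "filterlim (\<lambda>n. \<Sum>k<n. (mart_weight \<mu> p (Suc (Suc k)))\<^sup>2) at_top sequentially"
      by (simp only: clock_def sum_one_shift)
    show "(\<lambda>n. delta (Suc n)) \<longlonglongrightarrow> 0" by (rule LIMSEQ_Suc[OF delta_tendsto[OF reg]])
  qed
  then have "(\<lambda>n. (\<Sum>k=1..<Suc n. (mart_weight \<mu> p (Suc k))\<^sup>2 * delta k) / clock \<mu> p (Suc n)) \<longlonglongrightarrow> 0"
    by (simp only: clock_def sum_one_shift)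
  then show ?thesis by (rule LIMSEQ_imp_Suc)
qed

text \<open>Bounded weights allow every power of \<open>mart_weight\<close> beyond the second to be
  traded for a constant, which leaves increments of the clock and of the weighted sum of
  \<open>delta\<close>.\<close>

lemma err_le:
  assumes "mart_weight \<mu> p (Suc k) \<le> B"
  shows "err k \<tau> \<le> (2 * C ^ 3 * \<bar>\<tau>\<bar> ^ 3 * B + \<tau> ^ 4 * s2\<^sup>2 / 4 * B\<^sup>2) * (mart_weight \<mu> p (Suc k))\<^sup>2
     + \<tau>\<^sup>2 * ((mart_weight \<mu> p (Suc k))\<^sup>2 * delta k)"
proof -
  define b where "b = mart_weight \<mu> p (Suc k)"
  have b: "0 < b" "b \<le> B" using weight_pos[of k] assms by (auto simp: b_def)
  have "b ^ 3 \<le> B * b\<^sup>2" using b by (simp add: power3_eq_cube power2_eq_square)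
  then have 1: "2 * C ^ 3 * \<bar>\<tau>\<bar> ^ 3 * b ^ 3 \<le> 2 * C ^ 3 * \<bar>\<tau>\<bar> ^ 3 * (B * b\<^sup>2)"
    using C_nonneg by (intro mult_left_mono mult_nonneg_nonneg zero_le_power) auto
  have "b\<^sup>2 * b\<^sup>2 \<le> B\<^sup>2 * b\<^sup>2" using b by (intro mult_right_mono power_mono) auto
  then have 2: "\<tau> ^ 4 * s2\<^sup>2 / 4 * (b\<^sup>2 * b\<^sup>2) \<le> \<tau> ^ 4 * s2\<^sup>2 / 4 * (B\<^sup>2 * b\<^sup>2)"
    by (intro mult_left_mono) auto
  have 3: "(\<tau>\<^sup>2 * s2 * b\<^sup>2 / 2)\<^sup>2 = \<tau> ^ 4 * s2\<^sup>2 / 4 * (b\<^sup>2 * b\<^sup>2)"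
    by (simp add: power_divide power_mult_distrib power2_eq_square power4_eq_xxxx)
  show ?thesis unfolding err_def b_def[symmetric] 3 using 1 2
    by (simp add: power_mult_distrib algebra_simps)
qed

text \<open>With \<open>\<tau> = \<theta> / sqrt L\<close> and a clock of order \<open>L\<close>,
  the cubic terms keep a factor \<open>1 / sqrt L\<close>, the quartic ones a factor
  \<open>1 / L\<close>, and the \<open>delta\<close> terms a weighted average that tends to
  zero.\<close>

lemma err_sum_tendsto:
  assumes reg: "critical_regime \<mu> p c \<rho>"
    and NN: "filterlim NN at_top sequentially" and L: "filterlim L at_top sequentially"
    and W: "(\<lambda>n. clock \<mu> p (NN n) / L n) \<longlonglongrightarrow> \<kappa>"
  shows "(\<lambda>n. \<Sum>k=1..<NN n. err k (\<theta> / sqrt (L n))) \<longlonglongrightarrow> 0"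
proof -
  obtain B where B: "\<And>n. \<bar>mart_weight \<mu> p n\<bar> \<le> B" using critical_regime_weight[OF reg] by blast
  define S where "S n = (\<Sum>k=1..<n. (mart_weight \<mu> p (Suc k))\<^sup>2 * delta k)" for n
  define a where "a n = 2 * C ^ 3 * \<bar>\<theta>\<bar> ^ 3 * B * (1 / sqrt (L n)) + \<theta> ^ 4 * s2\<^sup>2 / 4 * B\<^sup>2 * (1 / L n)" for n
  have Lpos: "\<forall>\<^sub>F n in sequentially. L n > 0" using L by (simp add: filterlim_at_top_dense)
  have Npos: "\<forall>\<^sub>F n in sequentially. clock \<mu> p (NN n) > 0"
    using filterlim_compose[OF critical_regime_clock[OF reg] NN] by (simp add: filterlim_at_top_dense)
  have bound: "\<forall>\<^sub>F n in sequentially. norm (\<Sum>k=1..<NN n. err k (\<theta> / sqrt (L n))) \<le>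
     a n * (clock \<mu> p (NN n) / L n) + \<theta>\<^sup>2 * (clock \<mu> p (NN n) / L n) * (S (NN n) / clock \<mu> p (NN n))"
    using Lpos Npos
  proof eventually_elim
    case (elim n)
    define \<tau> where "\<tau> = \<theta> / sqrt (L n)"
    have bk: "mart_weight \<mu> p (Suc k) \<le> B" for k using B[of "Suc k"] by (simp add: abs_le_iff)
    have "(\<Sum>k=1..<NN n. err k \<tau>) \<le> (\<Sum>k=1..<NN n. (2 * C ^ 3 * \<bar>\<tau>\<bar> ^ 3 * B + \<tau> ^ 4 * s2\<^sup>2 / 4 * B\<^sup>2) * (mart_weight \<mu> p (Suc k))\<^sup>2
     + \<tau>\<^sup>2 * ((mart_weight \<mu> p (Suc k))\<^sup>2 * delta k))"
      by (intro sum_mono err_le bk)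
    also have "\<dots> = (2 * C ^ 3 * \<bar>\<tau>\<bar> ^ 3 * B + \<tau> ^ 4 * s2\<^sup>2 / 4 * B\<^sup>2) * clock \<mu> p (NN n) + \<tau>\<^sup>2 * S (NN n)"
      by (simp only: sum.distrib sum_distrib_left[symmetric] clock_def S_def)
    finally have le: "(\<Sum>k=1..<NN n. err k \<tau>) \<le> (2 * C ^ 3 * \<bar>\<tau>\<bar> ^ 3 * B + \<tau> ^ 4 * s2\<^sup>2 / 4 * B\<^sup>2) * clock \<mu> p (NN n) + \<tau>\<^sup>2 * S (NN n)" .
    have s: "sqrt (L n) * sqrt (L n) = L n" "sqrt (L n) > 0" using elim by simp_all
    have t2: "\<tau>\<^sup>2 = \<theta>\<^sup>2 / L n" using elim by (simp add: \<tau>_def power_divide)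
    have t3: "\<bar>\<tau>\<bar> ^ 3 = \<bar>\<theta>\<bar> ^ 3 * (1 / sqrt (L n)) * (1 / L n)"
    proof -
      have c: "\<bar>y\<bar> ^ 3 = \<bar>y\<bar> * y\<^sup>2" for y :: real
        by (subst power2_abs[symmetric]) (simp only: power3_eq_cube power2_eq_square mult.assoc)
      have t1: "\<bar>\<tau>\<bar> = \<bar>\<theta>\<bar> * (1 / sqrt (L n))" using s(2) by (simp add: \<tau>_def)
      have "\<bar>\<tau>\<bar> ^ 3 = \<bar>\<tau>\<bar> * \<tau>\<^sup>2" by (rule c)
      also have "\<dots> = \<bar>\<theta>\<bar> * (1 / sqrt (L n)) * (\<theta>\<^sup>2 / L n)" by (simp only: t1 t2)
      finally have e: "\<bar>\<tau>\<bar> ^ 3 = \<bar>\<theta>\<bar> * (1 / sqrt (L n)) * (\<theta>\<^sup>2 / L n)" .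
      have "a * (1 / r) * (b / l) = a * b * (1 / r) * (1 / l)" for a b r l :: real by simp
      then show ?thesis unfolding e c[of \<theta>] .
    qed
    have t4: "\<tau> ^ 4 = \<theta> ^ 4 * (1 / L n) * (1 / L n)"
    proof -
      have f: "y ^ 4 = y\<^sup>2 * y\<^sup>2" for y :: real by (simp add: power2_eq_square power4_eq_xxxx)
      have e: "\<tau> ^ 4 = (\<theta>\<^sup>2 / L n) * (\<theta>\<^sup>2 / L n)" by (simp only: f[of \<tau>] t2)
      have "(b / l) * (b / l) = b * b * (1 / l) * (1 / l)" for b l :: real by simp
      then show ?thesis unfolding e f[of \<theta>] .
    qed
    have "(2 * C ^ 3 * \<bar>\<tau>\<bar> ^ 3 * B + \<tau> ^ 4 * s2\<^sup>2 / 4 * B\<^sup>2) * clock \<mu> p (NN n) + \<tau>\<^sup>2 * S (NN n)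
       = a n * (clock \<mu> p (NN n) / L n) + \<theta>\<^sup>2 * (clock \<mu> p (NN n) / L n) * (S (NN n) / clock \<mu> p (NN n))"
    proof -
      have "\<theta>\<^sup>2 * (clock \<mu> p (NN n) / L n) * (S (NN n) / clock \<mu> p (NN n)) = \<tau>\<^sup>2 * S (NN n)"
        using elim by (simp add: t2)
      moreover have "2 * C ^ 3 * \<bar>\<tau>\<bar> ^ 3 * B + \<tau> ^ 4 * s2\<^sup>2 / 4 * B\<^sup>2 = a n * (1 / L n)"
      proof -
        have "c1 * (t * u * w) * c2 + (t' * w * w) * c3 / 4 * c4 = (c1 * t * c2 * u + t' * c3 / 4 * c4 * w) * w"
          for c1 c2 c3 c4 t t' u w :: real by (simp add: algebra_simps)
        then show ?thesis unfolding t3 t4 a_def .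
      qed
      ultimately show ?thesis by simp
    qed
    moreover have "0 \<le> (\<Sum>k=1..<NN n. err k \<tau>)" by (intro sum_nonneg err_nonneg)
    ultimately show ?case using le unfolding \<tau>_def by simp
  qed
  have a: "a \<longlonglongrightarrow> 2 * C ^ 3 * \<bar>\<theta>\<bar> ^ 3 * B * 0 + \<theta> ^ 4 * s2\<^sup>2 / 4 * B\<^sup>2 * 0"
    unfolding a_def[abs_def]
  proof (intro tendsto_add tendsto_mult tendsto_const)
    show "(\<lambda>n. 1 / sqrt (L n)) \<longlonglongrightarrow> 0"
      by (rule real_tendsto_divide_at_top[OF tendsto_const filterlim_compose[OF sqrt_at_top L]])
    show "(\<lambda>n. 1 / L n) \<longlonglongrightarrow> 0" by (rule real_tendsto_divide_at_top[OF tendsto_const L])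
  qed
  have "(\<lambda>n. S (NN n) / clock \<mu> p (NN n)) \<longlonglongrightarrow> 0"
    using filterlim_compose[OF delta_average_tendsto[OF reg] NN] by (simp add: S_def)
  from tendsto_add[OF tendsto_mult[OF a W] tendsto_mult[OF tendsto_mult[OF tendsto_const[of "\<theta>\<^sup>2"] W] this]]
  have "(\<lambda>n. a n * (clock \<mu> p (NN n) / L n) + \<theta>\<^sup>2 * (clock \<mu> p (NN n) / L n) * (S (NN n) / clock \<mu> p (NN n))) \<longlonglongrightarrow> 0"
    by simp
  with bound show ?thesis by (rule Lim_null_comparison)
qed

text \<open>The error in \<open>char_increment\<close> does not involve the event, so
  \<open>A n\<close> may change with \<open>n\<close> without any convergence of its
  probability.\<close>

lemma clt_bounded:
  assumes reg: "critical_regime \<mu> p c \<rho>"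
    and mN: "\<forall>\<^sub>F n in sequentially. 1 \<le> mm n \<and> mm n \<le> NN n"
    and NN: "filterlim NN at_top sequentially" and L: "filterlim L at_top sequentially"
    and W: "(\<lambda>n. clock \<mu> p (NN n) / L n) \<longlonglongrightarrow> \<kappa>"
    and v: "(\<lambda>n. (clock \<mu> p (NN n) - clock \<mu> p (mm n)) / L n) \<longlonglongrightarrow> v"
    and A: "\<And>n. A n \<in> sets (filt (mm n))"
  shows "(\<lambda>n. expectation (\<lambda>\<omega>. indicator (A n) \<omega> * iexp (\<theta> * ((mart (NN n) \<omega> - mart (mm n) \<omega>) / sqrt (L n))))
     - prob (A n) * exp (- (\<theta>\<^sup>2 * s2 * v / 2))) \<longlonglongrightarrow> 0"
proof -
  define g where "g n = (clock \<mu> p (NN n) - clock \<mu> p (mm n)) / L n" for n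
  have g: "(\<lambda>n. exp (- (\<theta>\<^sup>2 * s2 * g n / 2)) - exp (- (\<theta>\<^sup>2 * s2 * v / 2))) \<longlonglongrightarrow> 0"
    using v unfolding g_def[symmetric] by (intro LIM_zero tendsto_intros) simp_all
  have Lpos: "\<forall>\<^sub>F n in sequentially. L n > 0" using L by (simp add: filterlim_at_top_dense)
  have lim: "(\<lambda>n. (\<Sum>k=1..<NN n. err k (\<theta> / sqrt (L n))) + \<bar>exp (- (\<theta>\<^sup>2 * s2 * g n / 2)) - exp (- (\<theta>\<^sup>2 * s2 * v / 2))\<bar>) \<longlonglongrightarrow> 0 + 0"
    by (intro tendsto_add err_sum_tendsto[OF reg NN L W] tendsto_rabs_zero g)
  show ?thesis
  proof (rule Lim_null_comparison)
    show "\<forall>\<^sub>F n in sequentially. norm (expectation (\<lambda>\<omega>. indicator (A n) \<omega> * iexp (\<theta> * ((mart (NN n) \<omega> - mart (mm n) \<omega>) / sqrt (L n))))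
     - prob (A n) * exp (- (\<theta>\<^sup>2 * s2 * v / 2))) \<le> (\<Sum>k=1..<NN n. err k (\<theta> / sqrt (L n))) + \<bar>exp (- (\<theta>\<^sup>2 * s2 * g n / 2)) - exp (- (\<theta>\<^sup>2 * s2 * v / 2))\<bar>"
      using Lpos mN
    proof eventually_elim
      case (elim n)
      define \<tau> where "\<tau> = \<theta> / sqrt (L n)"
      define E where "E = expectation (\<lambda>\<omega>. indicator (A n) \<omega> * iexp (\<tau> * (mart (NN n) \<omega> - mart (mm n) \<omega>)))"
      have t2: "\<tau>\<^sup>2 = \<theta>\<^sup>2 / L n" using elim by (simp add: \<tau>_def power_divide)
      have "\<tau>\<^sup>2 * s2 * (clock \<mu> p (NN n) - clock \<mu> p (mm n)) / 2 = \<theta>\<^sup>2 * s2 * g n / 2"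
        unfolding t2 g_def by simp
      with char_increment[of "mm n" "NN n" "A n" \<tau>] elim A[of n]
      have 1: "cmod (E - prob (A n) * exp (- (\<theta>\<^sup>2 * s2 * g n / 2))) \<le> (\<Sum>k=mm n..<NN n. err k \<tau>)"
        unfolding E_def by simp
      \<comment> \<open>The sum is extended down to \<open>1\<close> because
        \<open>err_sum_tendsto\<close> controls the whole sum, whatever the starting time
        \<open>mm n\<close>.\<close>
      also have 2: "\<dots> \<le> (\<Sum>k=1..<NN n. err k \<tau>)"
        using elim by (intro sum_mono2 err_nonneg) auto
      finally have 1: "cmod (E - prob (A n) * exp (- (\<theta>\<^sup>2 * s2 * g n / 2))) \<le> (\<Sum>k=1..<NN n. err k \<tau>)" .
      have 3: "cmod (complex_of_real (prob (A n) * exp (- (\<theta>\<^sup>2 * s2 * g n / 2))) - complex_of_real (prob (A n) * exp (- (\<theta>\<^sup>2 * s2 * v / 2)))) \<le>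
         \<bar>exp (- (\<theta>\<^sup>2 * s2 * g n / 2)) - exp (- (\<theta>\<^sup>2 * s2 * v / 2))\<bar>"
        unfolding of_real_diff[symmetric] right_diff_distrib[symmetric] norm_of_real abs_mult
        by (intro mult_left_le_one_le) auto
      have 4: "\<theta> * ((mart (NN n) \<omega> - mart (mm n) \<omega>) / sqrt (L n)) = \<tau> * (mart (NN n) \<omega> - mart (mm n) \<omega>)" for \<omega>
        by (simp add: \<tau>_def)
      have tri: "cmod (a - z) \<le> cmod (a - y) + cmod (y - z)" for a y z
        using norm_triangle_ineq[of "a - y" "y - z"] by simp
      show ?case unfolding 4 E_def[symmetric] \<tau>_def[symmetric]
        by (rule order_trans[OF tri add_mono[OF 1 3]])
    qed
  qed (use lim in simp)
qed

end

section \<open>Truncation of the innovations\<close>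

context srrw_functional
begin

definition cen :: "nat \<Rightarrow> real" where
  "cen K = expectation (\<lambda>\<omega>. \<psi> (\<xi> 1 \<omega>) * of_bool (\<bar>\<psi> (\<xi> 1 \<omega>)\<bar> \<le> real K))"

text \<open>Recentred by \<open>cen K\<close> because \<open>srrw_functional\<close> demands mean
  zero. The tail is then centred as well, so both parts are functionals of the same steps.\<close>

definition trunc :: "nat \<Rightarrow> real \<Rightarrow> real" where
  "trunc K y = \<psi> y * of_bool (\<bar>\<psi> y\<bar> \<le> real K) - cen K"

definition tail :: "nat \<Rightarrow> real \<Rightarrow> real" where
  "tail K y = \<psi> y - trunc K y"

lemma trunc_measurable [measurable]: "trunc K \<in> borel_measurable borel" "tail K \<in> borel_measurable borel"
proof -
  note [measurable] = psi_measurable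
  show "trunc K \<in> borel_measurable borel" unfolding trunc_def[abs_def] by measurable
  then show "tail K \<in> borel_measurable borel" unfolding tail_def[abs_def] by measurable
qed

lemma psi_xi_measurable: "(\<lambda>\<omega>. \<psi> (\<xi> 1 \<omega>)) \<in> borel_measurable M"
  by (rule borel_measurable_integrable[OF psi_integrable])

lemma cut_integrable: "integrable M (\<lambda>\<omega>. \<psi> (\<xi> 1 \<omega>) * of_bool (\<bar>\<psi> (\<xi> 1 \<omega>)\<bar> \<le> real K))"
  by (rule Bochner_Integration.integrable_bound[OF psi_integrable])
    (use psi_xi_measurable in \<open>auto intro!: AE_I2\<close>)

lemma cen_le: "\<bar>cen K\<bar> \<le> expectation (\<lambda>\<omega>. \<bar>\<psi> (\<xi> 1 \<omega>)\<bar>)"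
proof -
  have "\<bar>cen K\<bar> \<le> expectation (\<lambda>\<omega>. \<bar>\<psi> (\<xi> 1 \<omega>) * of_bool (\<bar>\<psi> (\<xi> 1 \<omega>)\<bar> \<le> real K)\<bar>)"
    unfolding cen_def by (rule integral_abs_bound)
  also have "\<dots> \<le> expectation (\<lambda>\<omega>. \<bar>\<psi> (\<xi> 1 \<omega>)\<bar>)"
    using cut_integrable psi_integrable by (intro integral_mono integrable_abs) (auto simp: of_bool_def)
  finally show ?thesis .
qed

lemma cut_eventually: "\<forall>\<^sub>F K in sequentially. \<psi> y * of_bool (\<bar>\<psi> y\<bar> \<le> real K) = \<psi> y"
proof -
  obtain K0 :: nat where "\<bar>\<psi> y\<bar> \<le> real K0" using real_arch_simple by blast
  then have "\<bar>\<psi> y\<bar> \<le> real K" if "K \<ge> K0" for K using that by linarith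
  then show ?thesis unfolding eventually_sequentially by (intro exI[of _ K0]) auto
qed

lemma cen_tendsto: "cen \<longlonglongrightarrow> 0"
proof -
  have "(\<lambda>K. expectation (\<lambda>\<omega>. \<psi> (\<xi> 1 \<omega>) * of_bool (\<bar>\<psi> (\<xi> 1 \<omega>)\<bar> \<le> real K))) \<longlonglongrightarrow> expectation (\<lambda>\<omega>. \<psi> (\<xi> 1 \<omega>))"
  proof (rule integral_dominated_convergence[where w="\<lambda>\<omega>. \<bar>\<psi> (\<xi> 1 \<omega>)\<bar>"])
    show "AE \<omega> in M. (\<lambda>K. \<psi> (\<xi> 1 \<omega>) * of_bool (\<bar>\<psi> (\<xi> 1 \<omega>)\<bar> \<le> real K)) \<longlonglongrightarrow> \<psi> (\<xi> 1 \<omega>)"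
      by (intro AE_I2 tendsto_eventually cut_eventually)
    show "AE \<omega> in M. norm (\<psi> (\<xi> 1 \<omega>) * of_bool (\<bar>\<psi> (\<xi> 1 \<omega>)\<bar> \<le> real K)) \<le> \<bar>\<psi> (\<xi> 1 \<omega>)\<bar>" for K
      by (intro AE_I2) (auto simp: of_bool_def)
  qed (intro psi_xi_measurable borel_measurable_integrable[OF cut_integrable] integrable_abs psi_integrable)+
  then show ?thesis unfolding psi_mean cen_def[abs_def] .
qed

text \<open>Dominated convergence. The centring is at most \<open>m\<close>, the mean of
  \<open>\<bar>\<psi>\<bar>\<close>, for every \<open>K\<close>, so
  \<open>2 * \<psi>^2 + 2 * m^2\<close> dominates both squares uniformly in
  \<open>K\<close>.\<close>

lemma
  shows trunc_square_tendsto: "(\<lambda>K. expectation (\<lambda>\<omega>. (trunc K (\<xi> 1 \<omega>))\<^sup>2)) \<longlonglongrightarrow> s2"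
    and tail_square_tendsto: "(\<lambda>K. expectation (\<lambda>\<omega>. (tail K (\<xi> 1 \<omega>))\<^sup>2)) \<longlonglongrightarrow> 0"
    and trunc_square: "integrable M (\<lambda>\<omega>. (trunc K (\<xi> 1 \<omega>))\<^sup>2)"
    and tail_square: "integrable M (\<lambda>\<omega>. (tail K (\<xi> 1 \<omega>))\<^sup>2)"
proof -
  define m where "m = expectation (\<lambda>\<omega>. \<bar>\<psi> (\<xi> 1 \<omega>)\<bar>)"
  define w where "w \<omega> = 2 * (\<psi> (\<xi> 1 \<omega>))\<^sup>2 + 2 * m\<^sup>2" for \<omega>
  have w: "integrable M w" unfolding w_def[abs_def] using psi_square by simp
  have bd: "(a - b)\<^sup>2 \<le> 2 * z\<^sup>2 + 2 * m\<^sup>2" if "\<bar>a\<bar> \<le> \<bar>z\<bar>" "\<bar>b\<bar> \<le> m" for a b z :: real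
  proof -
    have "a\<^sup>2 \<le> z\<^sup>2" using that(1) by (simp add: abs_le_square_iff)
    moreover have "b\<^sup>2 \<le> m\<^sup>2" using that(2) by (metis abs_ge_zero order_trans power2_abs power_mono)
    moreover have "(a - b)\<^sup>2 \<le> 2 * a\<^sup>2 + 2 * b\<^sup>2" using sum_squares_bound[of a "- b"] by (simp add: power2_diff)
    ultimately show ?thesis by linarith
  qed
  have b1: "(trunc K y)\<^sup>2 \<le> 2 * (\<psi> y)\<^sup>2 + 2 * m\<^sup>2" for K y
    unfolding trunc_def using cen_le[of K] by (intro bd) (auto simp: m_def of_bool_def)
  have b2: "(tail K y)\<^sup>2 \<le> 2 * (\<psi> y)\<^sup>2 + 2 * m\<^sup>2" for K y
  proof -
    have "tail K y = (\<psi> y - \<psi> y * of_bool (\<bar>\<psi> y\<bar> \<le> real K)) - (- cen K)" by (simp add: tail_def trunc_def)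
    then show ?thesis using cen_le[of K] by (simp only:) (intro bd, auto simp: m_def of_bool_def)
  qed
  have \<xi>m [measurable]: "\<xi> 1 \<in> borel_measurable M" using innovation_indep by (simp add: indep_vars_def)
  have meas: "(\<lambda>\<omega>. (trunc K (\<xi> 1 \<omega>))\<^sup>2) \<in> borel_measurable M" "(\<lambda>\<omega>. (tail K (\<xi> 1 \<omega>))\<^sup>2) \<in> borel_measurable M" for K
    by (measurable)
  have tl: "(\<lambda>K. trunc K y) \<longlonglongrightarrow> \<psi> y - 0" for y
    unfolding trunc_def by (intro tendsto_diff cen_tendsto tendsto_eventually cut_eventually)
  have tt: "(\<lambda>K. tail K y) \<longlonglongrightarrow> \<psi> y - (\<psi> y - 0)" for y
    unfolding tail_def by (intro tendsto_diff tendsto_const tl)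
  show "(\<lambda>K. expectation (\<lambda>\<omega>. (trunc K (\<xi> 1 \<omega>))\<^sup>2)) \<longlonglongrightarrow> s2"
    unfolding s2_def
  proof (rule integral_dominated_convergence[OF _ _ w])
    show "AE \<omega> in M. (\<lambda>K. (trunc K (\<xi> 1 \<omega>))\<^sup>2) \<longlonglongrightarrow> (\<psi> (\<xi> 1 \<omega>))\<^sup>2"
    proof (rule AE_I2)
      fix \<omega>
      from tendsto_power[OF tl[of "\<xi> 1 \<omega>"], of 2]
      show "(\<lambda>K. (trunc K (\<xi> 1 \<omega>))\<^sup>2) \<longlonglongrightarrow> (\<psi> (\<xi> 1 \<omega>))\<^sup>2" by simp
    qed
    show "AE \<omega> in M. norm ((trunc K (\<xi> 1 \<omega>))\<^sup>2) \<le> w \<omega>" for K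
      using b1[of K] by (intro AE_I2) (simp add: w_def)
  qed (intro meas borel_measurable_integrable[OF psi_square])+
  show "(\<lambda>K. expectation (\<lambda>\<omega>. (tail K (\<xi> 1 \<omega>))\<^sup>2)) \<longlonglongrightarrow> 0"
  proof -
    have "(\<lambda>K. expectation (\<lambda>\<omega>. (tail K (\<xi> 1 \<omega>))\<^sup>2)) \<longlonglongrightarrow> expectation (\<lambda>\<omega>. 0)"
    proof (rule integral_dominated_convergence[OF _ _ w])
      show "AE \<omega> in M. (\<lambda>K. (tail K (\<xi> 1 \<omega>))\<^sup>2) \<longlonglongrightarrow> 0"
      proof (rule AE_I2)
        fix \<omega>
        from tendsto_power[OF tt[of "\<xi> 1 \<omega>"], of 2]
        show "(\<lambda>K. (tail K (\<xi> 1 \<omega>))\<^sup>2) \<longlonglongrightarrow> 0" by simp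
      qed
      show "AE \<omega> in M. norm ((tail K (\<xi> 1 \<omega>))\<^sup>2) \<le> w \<omega>" for K
        using b2[of K] by (intro AE_I2) (simp add: w_def)
    qed (intro meas borel_measurable_const)+
    then show ?thesis by simp
  qed
  show "integrable M (\<lambda>\<omega>. (trunc K (\<xi> 1 \<omega>))\<^sup>2)"
    by (rule Bochner_Integration.integrable_bound[OF w meas(1)])
      (use b1[of K] in \<open>auto simp: w_def intro!: AE_I2\<close>)
  show "integrable M (\<lambda>\<omega>. (tail K (\<xi> 1 \<omega>))\<^sup>2)"
    by (rule Bochner_Integration.integrable_bound[OF w meas(2)])
      (use b2[of K] in \<open>auto simp: w_def intro!: AE_I2\<close>)
qed

lemma trunc_mean: "expectation (\<lambda>\<omega>. trunc K (\<xi> 1 \<omega>)) = 0"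
proof -
  have "expectation (\<lambda>\<omega>. trunc K (\<xi> 1 \<omega>)) = expectation (\<lambda>\<omega>. \<psi> (\<xi> 1 \<omega>) * of_bool (\<bar>\<psi> (\<xi> 1 \<omega>)\<bar> \<le> real K)) - expectation (\<lambda>\<omega>. cen K)"
    unfolding trunc_def by (rule Bochner_Integration.integral_diff[OF cut_integrable integrable_const])
  then show ?thesis by (simp add: cen_def prob_space)
qed

lemma trunc_bounded: "srrw_bounded M p \<gamma> \<mu> \<xi> \<alpha> \<beta> X (trunc K) (2 * real K)"
proof
  show "trunc K \<in> borel_measurable borel" by (rule trunc_measurable)
  show "integrable M (\<lambda>\<omega>. (trunc K (\<xi> 1 \<omega>))\<^sup>2)" by (rule trunc_square)
  show "expectation (\<lambda>\<omega>. trunc K (\<xi> 1 \<omega>)) = 0" by (rule trunc_mean)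
  have 1: "\<bar>\<psi> y * of_bool (\<bar>\<psi> y\<bar> \<le> real K)\<bar> \<le> real K" for y by (auto simp: of_bool_def)
  have "\<bar>cen K\<bar> \<le> expectation (\<lambda>\<omega>. \<bar>\<psi> (\<xi> 1 \<omega>) * of_bool (\<bar>\<psi> (\<xi> 1 \<omega>)\<bar> \<le> real K)\<bar>)"
    unfolding cen_def by (rule integral_abs_bound)
  also have "\<dots> \<le> expectation (\<lambda>\<omega>. real K)"
    using cut_integrable 1 by (intro integral_mono integrable_abs integrable_const)
  finally have "\<bar>cen K\<bar> \<le> real K" by (simp add: prob_space)
  then show "\<bar>trunc K y\<bar> \<le> 2 * real K" for y unfolding trunc_def using 1[of y] by linarith
qed

lemma tail_functional: "srrw_functional M p \<gamma> \<mu> \<xi> \<alpha> \<beta> X (tail K)"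
proof
  interpret K: srrw_bounded M p \<gamma> \<mu> \<xi> \<alpha> \<beta> X "trunc K" "2 * real K" by (rule trunc_bounded)
  show "tail K \<in> borel_measurable borel" by (rule trunc_measurable)
  show "integrable M (\<lambda>\<omega>. (tail K (\<xi> 1 \<omega>))\<^sup>2)" by (rule tail_square)
  show "expectation (\<lambda>\<omega>. tail K (\<xi> 1 \<omega>)) = 0"
    unfolding tail_def using Bochner_Integration.integral_diff[OF psi_integrable K.psi_integrable] psi_mean trunc_mean by simp
qed

text \<open>\<open>mart\<close> splits linearly into the martingale of the truncated steps, to which
  \<open>clt_bounded\<close> applies, and that of the tails. The latter is bounded in mean square by
  the tail variance times the clock, for all large \<open>n\<close> at once, so the truncation level
  can be fixed before \<open>n\<close> grows.\<close>

theorem clt: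
  assumes reg: "critical_regime \<mu> p c \<rho>"
    and mN: "\<forall>\<^sub>F n in sequentially. 1 \<le> mm n \<and> mm n \<le> NN n"
    and NN: "filterlim NN at_top sequentially" and L: "filterlim L at_top sequentially"
    and W: "(\<lambda>n. clock \<mu> p (NN n) / L n) \<longlonglongrightarrow> \<kappa>"
    and v: "(\<lambda>n. (clock \<mu> p (NN n) - clock \<mu> p (mm n)) / L n) \<longlonglongrightarrow> v"
    and A: "\<And>n. A n \<in> sets (filt (mm n))"
  shows "(\<lambda>n. expectation (\<lambda>\<omega>. indicator (A n) \<omega> * iexp (\<theta> * ((mart (NN n) \<omega> - mart (mm n) \<omega>) / sqrt (L n))))
     - prob (A n) * exp (- (\<theta>\<^sup>2 * s2 * v / 2))) \<longlonglongrightarrow> 0"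
proof (rule tendstoI)
  fix e :: real assume e: "e > 0"
  define sK where "sK K = expectation (\<lambda>\<omega>. (trunc K (\<xi> 1 \<omega>))\<^sup>2)" for K
  define tK where "tK K = expectation (\<lambda>\<omega>. (tail K (\<xi> 1 \<omega>))\<^sup>2)" for K
  \<comment> \<open>The two costs of truncation: the tail martingale, with \<open>v + 1\<close> as
    eventual bound for the relative clock increment, and the changed variance in the Gaussian
    limit.\<close>
  have "(\<lambda>K. \<bar>\<theta>\<bar> * sqrt (tK K * (v + 1)) + \<bar>exp (- (\<theta>\<^sup>2 * sK K * v / 2)) - exp (- (\<theta>\<^sup>2 * s2 * v / 2))\<bar>)
      \<longlonglongrightarrow> \<bar>\<theta>\<bar> * sqrt (0 * (v + 1)) + \<bar>exp (- (\<theta>\<^sup>2 * s2 * v / 2)) - exp (- (\<theta>\<^sup>2 * s2 * v / 2))\<bar>"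
    using trunc_square_tendsto tail_square_tendsto unfolding sK_def tK_def by (intro tendsto_intros) auto
  then have "\<forall>\<^sub>F K in sequentially. \<bar>\<theta>\<bar> * sqrt (tK K * (v + 1)) + \<bar>exp (- (\<theta>\<^sup>2 * sK K * v / 2)) - exp (- (\<theta>\<^sup>2 * s2 * v / 2))\<bar> < e / 2"
    using e by (intro order_tendstoD(2)) auto
  then obtain K where K: "\<bar>\<theta>\<bar> * sqrt (tK K * (v + 1)) + \<bar>exp (- (\<theta>\<^sup>2 * sK K * v / 2)) - exp (- (\<theta>\<^sup>2 * s2 * v / 2))\<bar> < e / 2"
    unfolding eventually_sequentially by blast
  interpret K: srrw_bounded M p \<gamma> \<mu> \<xi> \<alpha> \<beta> X "trunc K" "2 * real K" by (rule trunc_bounded)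
  interpret T: srrw_functional M p \<gamma> \<mu> \<xi> \<alpha> \<beta> X "tail K" by (rule tail_functional)
  have split: "mart n \<omega> = K.mart n \<omega> + T.mart n \<omega>" for n \<omega>
  proof -
    have "x k \<omega> = K.x k \<omega> + T.x k \<omega>" for k by (simp add: x_def K.x_def T.x_def tail_def)
    then have "Y n \<omega> = K.Y n \<omega> + T.Y n \<omega>"
      by (simp add: Y_def K.Y_def T.Y_def sum.distrib distrib_left)
    then show ?thesis by (simp add: mart_def K.mart_def T.mart_def add_divide_distrib)
  qed
  have sKs: "K.s2 = sK K" by (simp add: K.s2_def sK_def)
  have Ts: "T.s2 = tK K" by (simp add: T.s2_def tK_def)
  have "\<forall>\<^sub>F n in sequentially. dist (expectation (\<lambda>\<omega>. indicator (A n) \<omega> * iexp (\<theta> * ((K.mart (NN n) \<omega> - K.mart (mm n) \<omega>) / sqrt (L n))))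
     - prob (A n) * exp (- (\<theta>\<^sup>2 * K.s2 * v / 2))) 0 < e / 2"
    by (rule tendstoD[OF K.clt_bounded[OF reg mN NN L W v A]]) (use e in simp)
  moreover have "\<forall>\<^sub>F n in sequentially. (clock \<mu> p (NN n) - clock \<mu> p (mm n)) / L n < v + 1"
    by (rule order_tendstoD(2)[OF v]) simp
  moreover have "\<forall>\<^sub>F n in sequentially. L n > 0" using L by (simp add: filterlim_at_top_dense)
  ultimately show "\<forall>\<^sub>F n in sequentially. dist (expectation (\<lambda>\<omega>. indicator (A n) \<omega> * iexp (\<theta> * ((mart (NN n) \<omega> - mart (mm n) \<omega>) / sqrt (L n))))
     - prob (A n) * exp (- (\<theta>\<^sup>2 * s2 * v / 2))) 0 < e"
    using mN
  proof eventually_elim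
    case (elim n)
    define P where "P \<omega> = indicator (A n) \<omega> * iexp (\<theta> * ((mart (NN n) \<omega> - mart (mm n) \<omega>) / sqrt (L n)))" for \<omega>
    define PK where "PK \<omega> = indicator (A n) \<omega> * iexp (\<theta> * ((K.mart (NN n) \<omega> - K.mart (mm n) \<omega>) / sqrt (L n)))" for \<omega>
    have [measurable]: "mart k \<in> borel_measurable M" "K.mart k \<in> borel_measurable M" for k
      by (rule l2_measurable[OF l2_mart] l2_measurable[OF K.l2_mart])+
    have [measurable]: "A n \<in> events" using A[of n] sets_Sig_events[OF past_idx] by blast
    have iP: "integrable M P" "integrable M PK"
      unfolding P_def[abs_def] PK_def[abs_def]
      by (rule integrable_const_bound[of _ 1]; simp add: norm_mult indicator_def)+
    have l2T: "l2 (NN n) (\<lambda>\<omega>. T.mart (NN n) \<omega> - T.mart (mm n) \<omega>)"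
      using elim by (intro l2_diff T.l2_mart l2_mono[OF T.l2_mart]) auto
    have diff: "cmod (P \<omega> - PK \<omega>) \<le> \<bar>\<theta>\<bar> / sqrt (L n) * \<bar>T.mart (NN n) \<omega> - T.mart (mm n) \<omega>\<bar>" for \<omega>
    proof -
      let ?a = "\<theta> * ((mart (NN n) \<omega> - mart (mm n) \<omega>) / sqrt (L n))" and ?b = "\<theta> * ((K.mart (NN n) \<omega> - K.mart (mm n) \<omega>) / sqrt (L n))"
      have "P \<omega> - PK \<omega> = indicator (A n) \<omega> * (iexp ?a - iexp ?b)" by (simp add: P_def PK_def right_diff_distrib)
      then have "cmod (P \<omega> - PK \<omega>) \<le> cmod (iexp ?a - iexp ?b)" by (simp add: norm_mult indicator_def)
      also have "\<dots> \<le> \<bar>?a - ?b\<bar>" by (rule cmod_iexp_diff_le)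
      also have "?a - ?b = \<theta> / sqrt (L n) * (T.mart (NN n) \<omega> - T.mart (mm n) \<omega>)"
        unfolding split by (simp add: diff_divide_distrib add_divide_distrib algebra_simps)
      finally show ?thesis using elim(3) by (simp add: abs_mult)
    qed
    have "cmod (expectation P - expectation PK) \<le> expectation (\<lambda>\<omega>. cmod (P \<omega> - PK \<omega>))"
      using integral_norm_bound[of M "\<lambda>\<omega>. P \<omega> - PK \<omega>"] iP by simp
    also have "\<dots> \<le> expectation (\<lambda>\<omega>. \<bar>\<theta>\<bar> / sqrt (L n) * \<bar>T.mart (NN n) \<omega> - T.mart (mm n) \<omega>\<bar>)"
    proof (rule integral_mono[OF _ _ diff])
      show "integrable M (\<lambda>\<omega>. cmod (P \<omega> - PK \<omega>))"
        by (rule integrable_norm[OF Bochner_Integration.integrable_diff[OF iP]])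
      show "integrable M (\<lambda>\<omega>. \<bar>\<theta>\<bar> / sqrt (L n) * \<bar>T.mart (NN n) \<omega> - T.mart (mm n) \<omega>\<bar>)"
        by (rule integrable_mult_right[OF integrable_abs[OF l2_integrable[OF l2T]]])
    qed
    also have "\<dots> = \<bar>\<theta>\<bar> / sqrt (L n) * expectation (\<lambda>\<omega>. \<bar>T.mart (NN n) \<omega> - T.mart (mm n) \<omega>\<bar>)" by simp
    also have "\<dots> \<le> \<bar>\<theta>\<bar> / sqrt (L n) * sqrt (expectation (\<lambda>\<omega>. (T.mart (NN n) \<omega> - T.mart (mm n) \<omega>)\<^sup>2))"
      using elim(3) by (intro mult_left_mono expectation_abs_le_sqrt l2_measurable[OF l2T] l2_square[OF l2T]) auto
    also have "\<dots> \<le> \<bar>\<theta>\<bar> / sqrt (L n) * sqrt (tK K * (clock \<mu> p (NN n) - clock \<mu> p (mm n)))"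
      using elim(3,4) T.mart_diff_square[of "mm n" "NN n"] unfolding Ts by (intro mult_left_mono real_sqrt_le_mono) auto
    also have "\<dots> = \<bar>\<theta>\<bar> * sqrt (tK K * ((clock \<mu> p (NN n) - clock \<mu> p (mm n)) / L n))"
      by (simp add: real_sqrt_mult real_sqrt_divide)
    also have "\<dots> \<le> \<bar>\<theta>\<bar> * sqrt (tK K * (v + 1))"
      using elim(2) T.s2_nonneg unfolding Ts by (intro mult_left_mono real_sqrt_le_mono) auto
    finally have 1: "cmod (expectation P - expectation PK) \<le> \<bar>\<theta>\<bar> * sqrt (tK K * (v + 1))" .
    have 2: "cmod (expectation PK - prob (A n) * exp (- (\<theta>\<^sup>2 * sK K * v / 2))) < e / 2"
      using elim(1) unfolding PK_def sKs by (simp add: dist_norm)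
    have 3: "cmod (complex_of_real (prob (A n) * exp (- (\<theta>\<^sup>2 * sK K * v / 2))) - complex_of_real (prob (A n) * exp (- (\<theta>\<^sup>2 * s2 * v / 2)))) \<le>
       \<bar>exp (- (\<theta>\<^sup>2 * sK K * v / 2)) - exp (- (\<theta>\<^sup>2 * s2 * v / 2))\<bar>"
      unfolding of_real_diff[symmetric] right_diff_distrib[symmetric] norm_of_real abs_mult
      by (intro mult_left_le_one_le) auto
    have tri: "cmod (a - z) \<le> cmod (a - b) + cmod (b - y) + cmod (y - z)" for a b y z
      using norm_triangle_ineq[of "a - b" "b - y"] norm_triangle_ineq[of "a - y" "y - z"] by simp
    show ?case unfolding P_def[symmetric] dist_norm diff_zero
      using tri[of "expectation P" "complex_of_real (prob (A n) * exp (- (\<theta>\<^sup>2 * s2 * v / 2)))" "expectation PK"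
          "complex_of_real (prob (A n) * exp (- (\<theta>\<^sup>2 * sK K * v / 2)))"] 1 2 3 K by linarith
  qed
qed

end

section \<open>Finite-dimensional distributions of the walk\<close>

lemma continuous_on_cut_off_linear:
  fixes f :: "(nat \<Rightarrow> real) \<Rightarrow> real"
  assumes "continuous_on UNIV f"
  shows "continuous_on UNIV (\<lambda>u::nat \<Rightarrow> real. f (cut_off k (\<lambda>i. w i * (\<Sum>j<N i. s j * u j))))"
proof (rule continuous_on_compose2[OF assms])
  show "continuous_on UNIV (\<lambda>u::nat \<Rightarrow> real. cut_off k (\<lambda>i. w i * (\<Sum>j<N i. s j * u j)))"
  proof (rule continuous_on_coordinatewise_then_product)
    fix i
    show "continuous_on UNIV (\<lambda>u::nat \<Rightarrow> real. cut_off k (\<lambda>i. w i * (\<Sum>j<N i. s j * u j)) i)"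
    proof (cases "i < k")
      case True
      have "continuous_on UNIV (\<lambda>u::nat \<Rightarrow> real. u j)" for j
        by (rule continuous_on_product_then_coordinatewise[OF continuous_on_id])
      then have "continuous_on UNIV (\<lambda>u::nat \<Rightarrow> real. w i * (\<Sum>j<N i. s j * u j))"
        by (intro continuous_on_mult continuous_on_sum continuous_on_const)
      then show ?thesis using True by (simp only: cut_off_def if_True)
    next
      case False
      then show ?thesis by (simp add: cut_off_def)
    qed
  qed
qed simp

context srrw_functional
begin

text \<open>In \<open>remainder_square\<close> the sum has bounded terms, hence is
  \<open>O(n)\<close>, and the first term is of the order of the squared \<open>drift_sum\<close>,
  that is \<open>n * ln n\<close>. The further factor \<open>ln (ln n)\<close> makes the quotient
  vanish.\<close>

lemma remainder_tendsto:
  assumes reg: "critical_regime \<mu> p c \<rho>"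
  shows "(\<lambda>n. expectation (\<lambda>\<omega>. (remainder n \<omega>)\<^sup>2) / (real n * ln (real n) * ln (ln (real n)))) \<longlonglongrightarrow> 0"
proof -
  have w: "(\<lambda>n. (mart_weight \<mu> p n)\<^sup>2 * (real n * ln (real n))) \<longlonglongrightarrow> c"
    and d: "(\<lambda>n. drift_sum \<mu> p n / sqrt (real n * ln (real n))) \<longlonglongrightarrow> \<rho>"
    using reg by (simp_all add: critical_regime_def)
  have "(\<lambda>n. (drift_sum \<mu> p n / sqrt (real n * ln (real n)))\<^sup>2 * ((mart_weight \<mu> p n)\<^sup>2 * (real n * ln (real n)))) \<longlonglongrightarrow> \<rho>\<^sup>2 * c"
    by (intro tendsto_mult tendsto_power w d)
  moreover have "\<forall>\<^sub>F n in sequentially. (drift_sum \<mu> p n / sqrt (real n * ln (real n)))\<^sup>2 * ((mart_weight \<mu> p n)\<^sup>2 * (real n * ln (real n))) =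
     (drift_sum \<mu> p n * mart_weight \<mu> p n)\<^sup>2"
    using eventually_ge_at_top[of 2]
  proof eventually_elim
    case (elim n)
    define z where "z = real n * ln (real n)"
    have pos: "z > 0" using elim by (simp add: z_def)
    have "(drift_sum \<mu> p n / sqrt z)\<^sup>2 = (drift_sum \<mu> p n)\<^sup>2 / z"
      by (simp only: power_divide real_sqrt_pow2[OF less_imp_le[OF pos]])
    then show ?case using pos unfolding z_def[symmetric] by (simp add: power_mult_distrib)
  qed
  ultimately have "(\<lambda>n. (drift_sum \<mu> p n * mart_weight \<mu> p n)\<^sup>2) \<longlonglongrightarrow> \<rho>\<^sup>2 * c"
    by (rule Lim_transform_eventually)
  then have "Bseq (\<lambda>n. (drift_sum \<mu> p n * mart_weight \<mu> p n)\<^sup>2)" by (simp add: convergent_imp_Bseq convergentI)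
  then obtain B where B: "\<And>n. (drift_sum \<mu> p n * mart_weight \<mu> p n)\<^sup>2 \<le> B"
    by (elim BseqE) (metis abs_le_D1 real_norm_def)
  have B': "(1 - drift_sum \<mu> p n * mart_weight \<mu> p n)\<^sup>2 \<le> 2 + 2 * B" for n
    using B[of n] sum_squares_bound[of 1 "- (drift_sum \<mu> p n * mart_weight \<mu> p n)"] by (simp add: power2_diff)
  have B0: "B \<ge> 0" using B[of 0] zero_le_power2 order_trans by blast
  have bound: "expectation (\<lambda>\<omega>. (remainder n \<omega>)\<^sup>2) \<le> 2 * s2 * ((1 + drift_sum \<mu> p n * \<mu> 1)\<^sup>2 + real n * (2 + 2 * B))" if "n \<ge> 1" for n
  proof -
    have "(\<Sum>k=1..<n. (1 - drift_sum \<mu> p (Suc k) * mart_weight \<mu> p (Suc k))\<^sup>2) \<le> (\<Sum>k=1..<n. 2 + 2 * B)"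
      by (intro sum_mono B')
    also have "\<dots> = real (n - 1) * (2 + 2 * B)" by simp
    also have "\<dots> \<le> real n * (2 + 2 * B)" using B0 by (intro mult_right_mono) auto
    finally have "2 * s2 * ((1 + drift_sum \<mu> p n * \<mu> 1)\<^sup>2 + (\<Sum>k=1..<n. (1 - drift_sum \<mu> p (Suc k) * mart_weight \<mu> p (Suc k))\<^sup>2))
       \<le> 2 * s2 * ((1 + drift_sum \<mu> p n * \<mu> 1)\<^sup>2 + real n * (2 + 2 * B))"
      using s2_nonneg by (intro mult_left_mono add_left_mono) auto
    with remainder_square[OF that] show ?thesis by linarith
  qed
  define g where "g n = 2 * s2 * ((1 / sqrt (real n * ln (real n)) + drift_sum \<mu> p n / sqrt (real n * ln (real n)) * \<mu> 1)\<^sup>2 + (2 + 2 * B) * (1 / ln (real n))) * (1 / ln (ln (real n)))" for n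
  have g: "g \<longlonglongrightarrow> 2 * s2 * ((0 + \<rho> * \<mu> 1)\<^sup>2 + (2 + 2 * B) * 0) * 0"
    unfolding g_def[abs_def]
    by (intro tendsto_mult tendsto_add tendsto_power tendsto_const d; real_asymp)
  show ?thesis
  proof (rule Lim_null_comparison)
    have "\<forall>\<^sub>F n in sequentially. ln (real n) > 1" by real_asymp
    then show "\<forall>\<^sub>F n in sequentially. norm (expectation (\<lambda>\<omega>. (remainder n \<omega>)\<^sup>2) / (real n * ln (real n) * ln (ln (real n)))) \<le> g n"
      using eventually_ge_at_top[of 2]
    proof eventually_elim
      case (elim n)
      define z where "z = real n * ln (real n)"
      have z: "z > 0" "ln (real n) > 0" unfolding z_def using elim by (auto intro!: mult_pos_pos)
      have ll: "ln (ln (real n)) > 0" using elim(1) by (rule ln_gt_zero)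
      note z = z(1) ll z(2)
      have e0: "expectation (\<lambda>\<omega>. (remainder n \<omega>)\<^sup>2) \<ge> 0" by (intro Bochner_Integration.integral_nonneg) simp
      have sq: "(sqrt z)\<^sup>2 = z" using z by simp
      have "(1 / sqrt z + drift_sum \<mu> p n / sqrt z * \<mu> 1)\<^sup>2 = ((1 + drift_sum \<mu> p n * \<mu> 1) / sqrt z)\<^sup>2"
        by (simp add: add_divide_distrib)
      also have "\<dots> = (1 + drift_sum \<mu> p n * \<mu> 1)\<^sup>2 / z" by (simp only: power_divide sq)
      finally have 1: "(1 / sqrt z + drift_sum \<mu> p n / sqrt z * \<mu> 1)\<^sup>2 = (1 + drift_sum \<mu> p n * \<mu> 1)\<^sup>2 / z" .
      have 2: "(2 + 2 * B) * (1 / ln (real n)) = real n * (2 + 2 * B) / z" using elim z by (simp add: z_def)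
      have "g n = 2 * s2 * ((1 + drift_sum \<mu> p n * \<mu> 1)\<^sup>2 + real n * (2 + 2 * B)) / (z * ln (ln (real n)))"
        unfolding g_def z_def[symmetric] 1 2 add_divide_distrib[symmetric] by simp
      moreover have "expectation (\<lambda>\<omega>. (remainder n \<omega>)\<^sup>2) / (z * ln (ln (real n))) \<le> 2 * s2 * ((1 + drift_sum \<mu> p n * \<mu> 1)\<^sup>2 + real n * (2 + 2 * B)) / (z * ln (ln (real n)))"
        using bound[of n] elim(2) z by (intro divide_right_mono) auto
      moreover have "expectation (\<lambda>\<omega>. (remainder n \<omega>)\<^sup>2) / (z * ln (ln (real n))) \<ge> 0"
        using e0 z by (intro divide_nonneg_pos) auto
      ultimately show ?case unfolding z_def by simp
    qed
  qed (use g in simp)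
qed

text \<open>\<open>T\<close> lists limiting values of the clock relative to \<open>L n\<close>, and
  \<open>K j n\<close> is a time at which \<open>T (Suc j)\<close> is approached. The sampling times
  of the walk enter only in \<open>walk_fdd\<close>, because several of them may share one limiting
  clock value, as for \<open>n powr t\<close>.\<close>

context
  fixes K :: "nat \<Rightarrow> nat \<Rightarrow> nat" and T :: "nat \<Rightarrow> real" and L :: "nat \<Rightarrow> real" and m :: nat and c \<rho> :: real
  assumes reg: "critical_regime \<mu> p c \<rho>" and s2: "s2 = 1"
    and L: "filterlim L at_top sequentially"
    and T: "T 0 = 0" "\<And>j. j < m \<Longrightarrow> T j < T (Suc j)"
    and K: "\<And>j. j < m \<Longrightarrow> filterlim (K j) at_top sequentially"
    and K_mono: "\<forall>\<^sub>F n in sequentially. \<forall>i j. i \<le> j \<and> j < m \<longrightarrow> K i n \<le> K j n"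
    and K_clock: "\<And>j. j < m \<Longrightarrow> (\<lambda>n. clock \<mu> p (K j n) / L n) \<longlonglongrightarrow> T (Suc j)"
begin

text \<open>Time \<open>1\<close> represents \<open>T 0 = 0\<close>, since the clock vanishes
  there.\<close>

definition Kp :: "nat \<Rightarrow> nat \<Rightarrow> nat" where "Kp j n = (case j of 0 \<Rightarrow> 1 | Suc i \<Rightarrow> K i n)"

definition U :: "nat \<Rightarrow> nat \<Rightarrow> 'a \<Rightarrow> real" where
  "U n j \<omega> = (mart (K j n) \<omega> - mart (Kp j n) \<omega>) / sqrt (L n * (T (Suc j) - T j))"

lemma L_pos: "\<forall>\<^sub>F n in sequentially. L n > 0"
  using L by (simp add: filterlim_at_top_dense)

lemma K_ge_1: "j < m \<Longrightarrow> \<forall>\<^sub>F n in sequentially. K j n \<ge> 1"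
  using K[of j] by (simp add: filterlim_at_top)

lemma Kp_le: "j < m \<Longrightarrow> \<forall>\<^sub>F n in sequentially. 1 \<le> Kp j n \<and> Kp j n \<le> K j n"
proof (cases j)
  case 0
  assume "j < m"
  from K_ge_1[OF this] show ?thesis by eventually_elim (simp add: Kp_def 0)
next
  case (Suc i)
  assume j: "j < m"
  then have "i < m" using Suc by simp
  from K_ge_1[OF this] K_mono show ?thesis
    by eventually_elim (use j Suc in \<open>simp add: Kp_def\<close>)
qed

lemma Kp_clock: "j < m \<Longrightarrow> (\<lambda>n. clock \<mu> p (Kp j n) / L n) \<longlonglongrightarrow> T j"
proof (cases j)
  case 0
  have "clock \<mu> p 1 = 0" by (simp add: clock_def)
  then show ?thesis unfolding 0 T Kp_def by simp
next
  case (Suc i)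
  assume "j < m"
  then show ?thesis unfolding Suc Kp_def using K_clock[of i] Suc by simp
qed

lemma incr_clock:
  assumes j: "j < m"
  shows "(\<lambda>n. (clock \<mu> p (K j n) - clock \<mu> p (Kp j n)) / (L n * (T (Suc j) - T j))) \<longlonglongrightarrow> 1"
proof -
  have "(\<lambda>n. (clock \<mu> p (K j n) / L n - clock \<mu> p (Kp j n) / L n) / (T (Suc j) - T j)) \<longlonglongrightarrow> (T (Suc j) - T j) / (T (Suc j) - T j)"
    using T(2)[OF j] by (intro tendsto_divide tendsto_diff tendsto_const K_clock[OF j] Kp_clock[OF j]) simp
  then show ?thesis using T(2)[OF j] by (simp add: diff_divide_distrib)
qed

lemma U_measurable: "U n j \<in> borel_measurable M"
  unfolding U_def[abs_def] by (intro borel_measurable_divide borel_measurable_diff l2_measurable[OF l2_mart] borel_measurable_const)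

lemma U_square:
  assumes j: "j < m"
  shows "\<forall>\<^sub>F n in sequentially. integrable M (\<lambda>\<omega>. (U n j \<omega>)\<^sup>2) \<and> expectation (\<lambda>\<omega>. (U n j \<omega>)\<^sup>2) \<le> 2"
proof -
  have "\<forall>\<^sub>F n in sequentially. (clock \<mu> p (K j n) - clock \<mu> p (Kp j n)) / (L n * (T (Suc j) - T j)) < 2"
    by (rule order_tendstoD(2)[OF incr_clock[OF j]]) simp
  with L_pos Kp_le[OF j] show ?thesis
  proof eventually_elim
    case (elim n)
    define r where "r = L n * (T (Suc j) - T j)"
    have r: "r > 0" using elim T(2)[OF j] by (simp add: r_def)
    have eq: "(U n j \<omega>)\<^sup>2 = (mart (K j n) \<omega> - mart (Kp j n) \<omega>)\<^sup>2 / r" for \<omega>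
      using r by (simp add: U_def r_def[symmetric] power_divide)
    have l: "l2 (K j n) (\<lambda>\<omega>. mart (K j n) \<omega> - mart (Kp j n) \<omega>)"
      using elim by (intro l2_diff l2_mart l2_mono[OF l2_mart]) auto
    have "expectation (\<lambda>\<omega>. (U n j \<omega>)\<^sup>2) = expectation (\<lambda>\<omega>. (mart (K j n) \<omega> - mart (Kp j n) \<omega>)\<^sup>2) / r"
      unfolding eq by simp
    also have "\<dots> \<le> (clock \<mu> p (K j n) - clock \<mu> p (Kp j n)) / r"
      using mart_diff_square[of "Kp j n" "K j n"] elim r s2 by (intro divide_right_mono) auto
    finally have "expectation (\<lambda>\<omega>. (U n j \<omega>)\<^sup>2) \<le> 2" using elim unfolding r_def by linarith
    then show ?case unfolding eq using l2_square[OF l] by simp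
  qed
qed

text \<open>Once the grid times are ordered, events about the earlier coordinates belong to the past
  of time \<open>Kp j n\<close>, and \<open>clt\<close> applies to the next increment on
  them.\<close>

lemma asymp_gauss_U: "asymp_gauss M U m"
  unfolding asymp_gauss_def
proof (intro conjI allI impI prob_space_axioms U_measurable)
  fix j assume j: "j < m"
  show "\<exists>C. \<forall>\<^sub>F n in sequentially. integrable M (\<lambda>\<omega>. (U n j \<omega>)\<^sup>2) \<and> expectation (\<lambda>\<omega>. (U n j \<omega>)\<^sup>2) \<le> C"
    using U_square[OF j] by blast
  fix \<theta> :: real and I :: "nat \<Rightarrow> real set" assume I: "\<forall>i. I i \<in> sets borel"
  define A where "A n = {\<omega>\<in>space M. \<forall>i<j. U n i \<omega> \<in> I i}" for n
  define good where "good n \<longleftrightarrow> (\<forall>i j. i \<le> j \<and> j < m \<longrightarrow> K i n \<le> K j n) \<and> (\<forall>i\<in>{..<m}. Kp i n \<le> K i n)" for n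
  \<comment> \<open>\<open>clt\<close> expects an event of the past for every \<open>n\<close>,
    whereas the ordering of the grid times holds only eventually; until then the empty event stands
    in.\<close>
  define A' where "A' n = (if good n then A n else {})" for n
  have good: "\<forall>\<^sub>F n in sequentially. good n"
  proof -
    have "\<forall>\<^sub>F n in sequentially. Kp i n \<le> K i n" if "i \<in> {..<m}" for i
      using Kp_le[of i] that by (auto elim: eventually_mono)
    then show ?thesis unfolding good_def
      by (intro eventually_conj K_mono eventually_ball_finite) auto
  qed
  have A': "A' n \<in> sets (filt (Kp j n))" for n
  proof (cases "good n")
    case True
    have "{\<omega>\<in>space M. \<forall>i\<in>{..<j}. U n i \<omega> \<in> I i} \<in> sets (filt (Kp j n))"
    proof (rule sets.sets_Collect_finite_All[of "{..<j}" "filt (Kp j n)", unfolded space_Sig])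
      fix i assume i: "i \<in> {..<j}"
      obtain j' where j': "j = Suc j'" using i by (cases j) auto
      have le: "K i n \<le> Kp j n" "Kp i n \<le> Kp j n"
      proof -
        have "K i n \<le> K j' n" "Kp i n \<le> K i n" using True i j unfolding good_def j' by (auto simp: less_Suc_eq_le)
        then show "K i n \<le> Kp j n" "Kp i n \<le> Kp j n" unfolding j' Kp_def[of "Suc j'"] by simp_all
      qed
      have "U n i \<in> borel_measurable (filt (Kp j n))"
      proof -
        have "mart (K i n) \<in> borel_measurable (filt (Kp j n))" "mart (Kp i n) \<in> borel_measurable (filt (Kp j n))"
          using l2_mono[OF l2_mart le(1)] l2_mono[OF l2_mart le(2)] by (simp_all add: l2_def)
        then show ?thesis unfolding U_def[abs_def] by (intro borel_measurable_divide borel_measurable_diff borel_measurable_const)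
      qed
      from measurable_sets[OF this, of "I i"] I
      have "U n i -` I i \<inter> space M \<in> sets (filt (Kp j n))" by simp
      moreover have "{\<omega>\<in>space M. U n i \<omega> \<in> I i} = U n i -` I i \<inter> space M" by auto
      ultimately show "{\<omega>\<in>space M. U n i \<omega> \<in> I i} \<in> sets (filt (Kp j n))" by simp
    qed simp
    then show ?thesis using True unfolding A'_def A_def by (simp only: Ball_def lessThan_iff if_True)
  qed (simp add: A'_def)
  define r where "r = T (Suc j) - T j"
  have r: "r > 0" using T(2)[OF j] by (simp add: r_def)
  have L': "filterlim (\<lambda>n. L n * r) at_top sequentially"
    by (rule filterlim_at_top_mult_tendsto_pos[OF tendsto_const r L])
  have W: "(\<lambda>n. clock \<mu> p (K j n) / (L n * r)) \<longlonglongrightarrow> T (Suc j) / r"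
    using tendsto_divide[OF K_clock[OF j] tendsto_const, of r] r by simp
  have "(\<lambda>n. expectation (\<lambda>\<omega>. indicator (A' n) \<omega> * iexp (\<theta> * ((mart (K j n) \<omega> - mart (Kp j n) \<omega>) / sqrt (L n * r))))
     - prob (A' n) * exp (- (\<theta>\<^sup>2 * s2 * 1 / 2))) \<longlonglongrightarrow> 0"
    by (rule clt[OF reg Kp_le[OF j] K[OF j] L' W incr_clock[OF j, folded r_def] A'])
  moreover have "\<forall>\<^sub>F n in sequentially. expectation (\<lambda>\<omega>. indicator (A' n) \<omega> * iexp (\<theta> * ((mart (K j n) \<omega> - mart (Kp j n) \<omega>) / sqrt (L n * r))))
     - prob (A' n) * exp (- (\<theta>\<^sup>2 * s2 * 1 / 2)) =
     expectation (\<lambda>\<omega>. indicator (A n) \<omega> * iexp (\<theta> * U n j \<omega>)) - prob (A n) * exp (- \<theta>\<^sup>2 / 2)"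
    using good by eventually_elim (simp add: A'_def U_def r_def s2)
  ultimately show "(\<lambda>n. expectation (\<lambda>\<omega>. indicator {\<omega>\<in>space M. \<forall>i<j. U n i \<omega> \<in> I i} \<omega> * iexp (\<theta> * U n j \<omega>))
      - prob {\<omega>\<in>space M. \<forall>i<j. U n i \<omega> \<in> I i} * exp (- \<theta>\<^sup>2 / 2)) \<longlonglongrightarrow> 0"
    unfolding A_def[symmetric] by (rule Lim_transform_eventually)
qed

lemma sum_U:
  assumes "j < m" "L n > 0"
  shows "(\<Sum>i<Suc j. sqrt (T (Suc i) - T i) * U n i \<omega>) = (mart (K j n) \<omega> - mart 1 \<omega>) / sqrt (L n)"
proof -
  have e: "sqrt (T (Suc i) - T i) * U n i \<omega> = (mart (K i n) \<omega> - mart (Kp i n) \<omega>) / sqrt (L n)" if "i < m" for i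
    using T(2)[OF that] assms(2) by (simp add: U_def real_sqrt_mult)
  show ?thesis using assms(1)
  proof (induction j)
    case 0
    then show ?case using e[of 0] by (simp add: Kp_def)
  next
    case (Suc j)
    have "(\<Sum>i<Suc (Suc j). sqrt (T (Suc i) - T i) * U n i \<omega>) =
       (mart (K j n) \<omega> - mart 1 \<omega>) / sqrt (L n) + (mart (K (Suc j) n) \<omega> - mart (Kp (Suc j) n) \<omega>) / sqrt (L n)"
      using Suc e[of "Suc j"] by simp
    then show ?case by (simp add: Kp_def add_divide_distrib[symmetric])
  qed
qed

text \<open>The normalised walk \<open>W\<close> is close in mean square to \<open>V\<close>, which
  is \<open>w i\<close> times the scaled martingale increment from \<open>1\<close> to
  \<open>K (J i) n\<close> and thus linear in the asymptotically Gaussian \<open>U\<close>. Then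
  \<open>fun_slutsky\<close> transfers the limit from \<open>V\<close> to \<open>W\<close>. Indices
  \<open>i\<close> with the same \<open>J i\<close> share all their Gaussian coordinates.\<close>

theorem walk_fdd:
  fixes k :: nat and J :: "nat \<Rightarrow> nat" and NN :: "nat \<Rightarrow> nat \<Rightarrow> nat" and q :: "nat \<Rightarrow> nat \<Rightarrow> real" and w r :: "nat \<Rightarrow> real"
    and f :: "(nat \<Rightarrow> real) \<Rightarrow> real"
  assumes J: "\<And>i. i < k \<Longrightarrow> J i < m"
    and NN: "\<And>i. i < k \<Longrightarrow> filterlim (NN i) at_top sequentially"
    and NN_clock: "\<And>i. i < k \<Longrightarrow> (\<lambda>n. clock \<mu> p (NN i n) / L n) \<longlonglongrightarrow> T (Suc (J i))"
    and q_pos: "\<And>i. i < k \<Longrightarrow> \<forall>\<^sub>F n in sequentially. q i n > 0"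
    and q_drift: "\<And>i. i < k \<Longrightarrow> (\<lambda>n. drift_sum \<mu> p (NN i n) * sqrt (L n) / q i n) \<longlonglongrightarrow> w i"
    and q_rem: "\<And>i. i < k \<Longrightarrow> (\<lambda>n. real (NN i n) * ln (real (NN i n)) * ln (ln (real (NN i n))) / (q i n)\<^sup>2) \<longlonglongrightarrow> r i"
    and f: "continuous_on UNIV f" "\<And>u. \<bar>f u\<bar> \<le> B"
  shows "(\<lambda>n. expectation (\<lambda>\<omega>. f (cut_off k (\<lambda>i. (\<Sum>l=1..NN i n. x l \<omega>) / q i n)))) \<longlonglongrightarrow>
     gauss_mean m (\<lambda>u. f (cut_off k (\<lambda>i. w i * (\<Sum>j<Suc (J i). sqrt (T (Suc j) - T j) * u j))))"
proof -
  define V where "V n i \<omega> = w i * (\<Sum>j<Suc (J i). sqrt (T (Suc j) - T j) * U n j \<omega>)" for n i \<omega>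
  define W where "W n i \<omega> = (\<Sum>l=1..NN i n. x l \<omega>) / q i n" for n i \<omega>
  define F where "F u = f (cut_off k (\<lambda>i. w i * (\<Sum>j<Suc (J i). sqrt (T (Suc j) - T j) * u j)))" for u
  have F: "continuous_on UNIV F"
    unfolding F_def[abs_def] by (rule continuous_on_cut_off_linear[OF f(1)])
  have "(\<lambda>n. expectation (\<lambda>\<omega>. F (cut_off m (\<lambda>j. U n j \<omega>)))) \<longlonglongrightarrow> gauss_mean m F"
    by (rule asymp_gauss_tendsto[OF asymp_gauss_U F, of B]) (simp add: F_def f(2))
  moreover have "F (cut_off m (\<lambda>j. U n j \<omega>)) = f (cut_off k (\<lambda>i. V n i \<omega>))" for n \<omega>
  proof -
    have "w i * (\<Sum>j<Suc (J i). sqrt (T (Suc j) - T j) * cut_off m (\<lambda>j. U n j \<omega>) j) = V n i \<omega>" if "i < k" for i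
      unfolding V_def using J[OF that] by (intro arg_cong2[where f="(*)"] refl sum.cong) (auto simp: cut_off_def)
    then have "cut_off k (\<lambda>i. w i * (\<Sum>j<Suc (J i). sqrt (T (Suc j) - T j) * cut_off m (\<lambda>j. U n j \<omega>) j)) = cut_off k (\<lambda>i. V n i \<omega>)"
      by (auto simp: cut_off_def fun_eq_iff)
    then show ?thesis by (simp only: F_def)
  qed
  ultimately have 1: "(\<lambda>n. expectation (\<lambda>\<omega>. f (cut_off k (\<lambda>i. V n i \<omega>)))) \<longlonglongrightarrow> gauss_mean m F" by simp
  have Vm: "V n i \<in> borel_measurable M" for n i
    unfolding V_def[abs_def] by (intro borel_measurable_times borel_measurable_sum borel_measurable_const U_measurable)
  have xm: "x l \<in> borel_measurable M" if "l \<ge> 1" for l by (rule l2_measurable[OF l2_x[OF that order_refl]])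
  have Wm: "W n i \<in> borel_measurable M" for n i
    unfolding W_def[abs_def] using xm by (intro borel_measurable_divide borel_measurable_sum borel_measurable_const) auto
  have Vsq: "\<forall>\<^sub>F n in sequentially. integrable M (\<lambda>\<omega>. (V n i \<omega>)\<^sup>2) \<and> expectation (\<lambda>\<omega>. (V n i \<omega>)\<^sup>2) \<le> (w i)\<^sup>2 * (T (Suc (J i)) + 1)" if i: "i < k" for i
  proof -
    have j: "J i < m" by (rule J[OF i])
    have "\<forall>\<^sub>F n in sequentially. clock \<mu> p (K (J i) n) / L n < T (Suc (J i)) + 1"
      by (rule order_tendstoD(2)[OF K_clock[OF j]]) simp
    with L_pos K_ge_1[OF j] show ?thesis
    proof eventually_elim
      case (elim n)
      have eq: "(V n i \<omega>)\<^sup>2 = (w i)\<^sup>2 * ((mart (K (J i) n) \<omega> - mart 1 \<omega>)\<^sup>2 / L n)" for \<omega>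
        unfolding V_def sum_U[OF j elim(1)] using elim(1) by (simp add: power_mult_distrib power_divide)
      have l: "l2 (K (J i) n) (\<lambda>\<omega>. mart (K (J i) n) \<omega> - mart 1 \<omega>)"
        using elim by (intro l2_diff l2_mart l2_mono[OF l2_mart]) auto
      have "expectation (\<lambda>\<omega>. (V n i \<omega>)\<^sup>2) = (w i)\<^sup>2 * (expectation (\<lambda>\<omega>. (mart (K (J i) n) \<omega> - mart 1 \<omega>)\<^sup>2) / L n)"
        unfolding eq by simp
      also have "\<dots> \<le> (w i)\<^sup>2 * (clock \<mu> p (K (J i) n) / L n)"
        using mart_diff_square[of 1 "K (J i) n"] elim s2
        by (intro mult_left_mono divide_right_mono) (auto simp: clock_def)
      also have "\<dots> \<le> (w i)\<^sup>2 * (T (Suc (J i)) + 1)" using elim by (intro mult_left_mono) auto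
      finally have "expectation (\<lambda>\<omega>. (V n i \<omega>)\<^sup>2) \<le> (w i)\<^sup>2 * (T (Suc (J i)) + 1)" .
      then show ?case unfolding eq using l2_square[OF l] by simp
    qed
  qed
  \<comment> \<open>Three sources of error: the remainder of the walk, the gap between the
    normalised drift coefficient and \<open>w i\<close>, and the martingale between the times
    \<open>NN i n\<close> and \<open>K (J i) n\<close>, whose clocks agree to leading order.\<close>
  have diff: "\<forall>\<^sub>F n in sequentially. integrable M (\<lambda>\<omega>. (W n i \<omega> - V n i \<omega>)\<^sup>2) \<and>
      expectation (\<lambda>\<omega>. (W n i \<omega> - V n i \<omega>)\<^sup>2) \<le>
      4 * (expectation (\<lambda>\<omega>. (remainder (NN i n) \<omega>)\<^sup>2) / (q i n)\<^sup>2)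
      + 4 * ((drift_sum \<mu> p (NN i n) * sqrt (L n) / q i n - w i)\<^sup>2 * (clock \<mu> p (NN i n) / L n))
      + 2 * ((w i)\<^sup>2 * \<bar>clock \<mu> p (NN i n) / L n - clock \<mu> p (K (J i) n) / L n\<bar>)" if i: "i < k" for i
  proof -
    have j: "J i < m" by (rule J[OF i])
    have "\<forall>\<^sub>F n in sequentially. NN i n \<ge> 1" using NN[OF i] by (simp add: filterlim_at_top)
    with L_pos K_ge_1[OF j] q_pos[OF i] show ?thesis
    proof eventually_elim
      case (elim n)
      define N K' where "N = NN i n" and "K' = K (J i) n"
      define R where "R = drift_sum \<mu> p N"
      define a where "a \<omega> = remainder N \<omega> / q i n" for \<omega>
      define b where "b \<omega> = (R * sqrt (L n) / q i n - w i) * ((mart N \<omega> - mart 1 \<omega>) / sqrt (L n))" for \<omega>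
      define d where "d \<omega> = w i * ((mart N \<omega> - mart K' \<omega>) / sqrt (L n))" for \<omega>
      \<comment> \<open>The two times come in no fixed order, so everything is viewed as square
        integrable at the later one.\<close>
      define mx where "mx = max N K'"
      have ge: "1 \<le> N" "1 \<le> K'" "N \<le> mx" "K' \<le> mx" "1 \<le> mx" using elim by (auto simp: N_def K'_def mx_def)
      have sL: "sqrt (L n) > 0" "(sqrt (L n))\<^sup>2 = L n" using elim by simp_all
      have eq: "W n i \<omega> - V n i \<omega> = (a \<omega> + b \<omega>) + d \<omega>" for \<omega>
      proof -
        have "W n i \<omega> = (remainder N \<omega> + R * (mart N \<omega> - mart 1 \<omega>)) / q i n"
          by (simp add: W_def remainder_def R_def N_def)
        moreover have "V n i \<omega> = w i * ((mart K' \<omega> - mart 1 \<omega>) / sqrt (L n))"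
          unfolding V_def sum_U[OF j elim(1)] K'_def ..
        moreover have "(r0 + R * y) / s0 - w i * (z / s) =
            (r0 / s0 + (R * s / s0 - w i) * (y / s)) + w i * ((y - z) / s)" if "s0 > 0" "s > 0" for r0 y z s0 s
          using that by (simp add: field_simps)
        from this[OF elim(3) sL(1)]
        have "(r0 + R * y) / q i n - w i * (z / sqrt (L n)) =
            (r0 / q i n + (R * sqrt (L n) / q i n - w i) * (y / sqrt (L n))) + w i * ((y - z) / sqrt (L n))" for r0 y z .
        ultimately show ?thesis unfolding a_def b_def d_def by simp
      qed
      have la: "l2 mx a" unfolding a_def[abs_def] by (intro l2_divide l2_mono[OF l2_remainder] ge)
      have lb: "l2 mx b" unfolding b_def[abs_def] by (intro l2_scale l2_divide l2_diff l2_mono[OF l2_mart] ge)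
      have ld: "l2 mx d" unfolding d_def[abs_def] by (intro l2_scale l2_divide l2_diff l2_mono[OF l2_mart] ge)
      note lab = l2_add[OF la lb]
      note e1 = expectation_square_add_le(2)[OF l2_measurable[OF lab] l2_measurable[OF ld] l2_square[OF lab] l2_square[OF ld]]
      note e2 = expectation_square_add_le(2)[OF l2_measurable[OF la] l2_measurable[OF lb] l2_square[OF la] l2_square[OF lb]]
      have Ea: "expectation (\<lambda>\<omega>. (a \<omega>)\<^sup>2) = expectation (\<lambda>\<omega>. (remainder N \<omega>)\<^sup>2) / (q i n)\<^sup>2"
        by (simp add: a_def power_divide)
      have Eb: "expectation (\<lambda>\<omega>. (b \<omega>)\<^sup>2) \<le> (R * sqrt (L n) / q i n - w i)\<^sup>2 * (clock \<mu> p N / L n)"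
      proof -
        have "expectation (\<lambda>\<omega>. (b \<omega>)\<^sup>2) = (R * sqrt (L n) / q i n - w i)\<^sup>2 * (expectation (\<lambda>\<omega>. (mart N \<omega> - mart 1 \<omega>)\<^sup>2) / L n)"
          unfolding b_def power_mult_distrib power_divide sL(2) by simp
        also have "\<dots> \<le> (R * sqrt (L n) / q i n - w i)\<^sup>2 * (clock \<mu> p N / L n)"
          using mart_diff_square[of 1 N] ge elim s2 by (intro mult_left_mono divide_right_mono) (auto simp: clock_def)
        finally show ?thesis .
      qed
      have Ed: "expectation (\<lambda>\<omega>. (d \<omega>)\<^sup>2) \<le> (w i)\<^sup>2 * \<bar>clock \<mu> p N / L n - clock \<mu> p K' / L n\<bar>"
      proof -
        have md: "expectation (\<lambda>\<omega>. (mart N \<omega> - mart K' \<omega>)\<^sup>2) \<le> \<bar>clock \<mu> p N - clock \<mu> p K'\<bar>"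
        proof (cases "K' \<le> N")
          case True
          then show ?thesis using mart_diff_square[OF ge(2) True] s2 by simp
        next
          case False
          then have "N \<le> K'" by simp
          from mart_diff_square[OF ge(1) this] s2 show ?thesis by (simp add: power2_commute)
        qed
        have "expectation (\<lambda>\<omega>. (d \<omega>)\<^sup>2) = (w i)\<^sup>2 * (expectation (\<lambda>\<omega>. (mart N \<omega> - mart K' \<omega>)\<^sup>2) / L n)"
          unfolding d_def power_mult_distrib power_divide sL(2) by simp
        also have "\<dots> \<le> (w i)\<^sup>2 * (\<bar>clock \<mu> p N - clock \<mu> p K'\<bar> / L n)"
          using md elim by (intro mult_left_mono divide_right_mono) auto
        also have "\<bar>clock \<mu> p N - clock \<mu> p K'\<bar> / L n = \<bar>clock \<mu> p N / L n - clock \<mu> p K' / L n\<bar>"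
          using elim by (simp add: diff_divide_distrib[symmetric])
        finally show ?thesis .
      qed
      have "integrable M (\<lambda>\<omega>. (W n i \<omega> - V n i \<omega>)\<^sup>2)" unfolding eq by (rule l2_square[OF l2_add[OF lab ld]])
      moreover have "expectation (\<lambda>\<omega>. (W n i \<omega> - V n i \<omega>)\<^sup>2) \<le> 4 * expectation (\<lambda>\<omega>. (a \<omega>)\<^sup>2) + 4 * expectation (\<lambda>\<omega>. (b \<omega>)\<^sup>2) + 2 * expectation (\<lambda>\<omega>. (d \<omega>)\<^sup>2)"
        unfolding eq using e1 e2 by linarith
      ultimately show ?case using Ea Eb Ed unfolding N_def[symmetric] K'_def[symmetric] R_def[symmetric] by linarith
    qed
  qed
  have dlim: "(\<lambda>n. expectation (\<lambda>\<omega>. (W n i \<omega> - V n i \<omega>)\<^sup>2)) \<longlonglongrightarrow> 0" if i: "i < k" for i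
  proof (rule Lim_null_comparison)
    show "\<forall>\<^sub>F n in sequentially. norm (expectation (\<lambda>\<omega>. (W n i \<omega> - V n i \<omega>)\<^sup>2)) \<le>
      4 * (expectation (\<lambda>\<omega>. (remainder (NN i n) \<omega>)\<^sup>2) / (q i n)\<^sup>2)
      + 4 * ((drift_sum \<mu> p (NN i n) * sqrt (L n) / q i n - w i)\<^sup>2 * (clock \<mu> p (NN i n) / L n))
      + 2 * ((w i)\<^sup>2 * \<bar>clock \<mu> p (NN i n) / L n - clock \<mu> p (K (J i) n) / L n\<bar>)"
      using diff[OF i] by eventually_elim simp
    have rem: "(\<lambda>n. expectation (\<lambda>\<omega>. (remainder (NN i n) \<omega>)\<^sup>2) / (q i n)\<^sup>2) \<longlonglongrightarrow> 0"
    proof -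
      define z where "z n = real n * ln (real n) * ln (ln (real n))" for n :: nat
      have "(\<lambda>n. expectation (\<lambda>\<omega>. (remainder (NN i n) \<omega>)\<^sup>2) / z (NN i n) * (z (NN i n) / (q i n)\<^sup>2)) \<longlonglongrightarrow> 0 * r i"
        using filterlim_compose[OF remainder_tendsto[OF reg] NN[OF i]] q_rem[OF i]
        unfolding z_def by (intro tendsto_mult) auto
      moreover have "\<forall>\<^sub>F n in sequentially. z n > 0" unfolding z_def by real_asymp
      then have "\<forall>\<^sub>F n in sequentially. z (NN i n) > 0" by (rule eventually_compose_filterlim[OF _ NN[OF i]])
      then have "\<forall>\<^sub>F n in sequentially. expectation (\<lambda>\<omega>. (remainder (NN i n) \<omega>)\<^sup>2) / z (NN i n) * (z (NN i n) / (q i n)\<^sup>2) =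
         expectation (\<lambda>\<omega>. (remainder (NN i n) \<omega>)\<^sup>2) / (q i n)\<^sup>2"
        by eventually_elim simp
      ultimately have "(\<lambda>n. expectation (\<lambda>\<omega>. (remainder (NN i n) \<omega>)\<^sup>2) / (q i n)\<^sup>2) \<longlonglongrightarrow> 0 * r i"
        by (rule Lim_transform_eventually)
      then show ?thesis by simp
    qed
    have "(\<lambda>n. 4 * (expectation (\<lambda>\<omega>. (remainder (NN i n) \<omega>)\<^sup>2) / (q i n)\<^sup>2)
      + 4 * ((drift_sum \<mu> p (NN i n) * sqrt (L n) / q i n - w i)\<^sup>2 * (clock \<mu> p (NN i n) / L n))
      + 2 * ((w i)\<^sup>2 * \<bar>clock \<mu> p (NN i n) / L n - clock \<mu> p (K (J i) n) / L n\<bar>)) \<longlonglongrightarrow>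
      4 * 0 + 4 * ((w i - w i)\<^sup>2 * T (Suc (J i))) + 2 * ((w i)\<^sup>2 * \<bar>T (Suc (J i)) - T (Suc (J i))\<bar>)"
      by (intro tendsto_add tendsto_mult tendsto_power tendsto_diff tendsto_rabs tendsto_const rem q_drift[OF i] NN_clock[OF i] K_clock[OF J[OF i]])
    then show "(\<lambda>n. 4 * (expectation (\<lambda>\<omega>. (remainder (NN i n) \<omega>)\<^sup>2) / (q i n)\<^sup>2)
      + 4 * ((drift_sum \<mu> p (NN i n) * sqrt (L n) / q i n - w i)\<^sup>2 * (clock \<mu> p (NN i n) / L n))
      + 2 * ((w i)\<^sup>2 * \<bar>clock \<mu> p (NN i n) / L n - clock \<mu> p (K (J i) n) / L n\<bar>)) \<longlonglongrightarrow> 0"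
      by simp
  qed
  have "(\<lambda>n. expectation (\<lambda>\<omega>. f (cut_off k (\<lambda>i. W n i \<omega>))) - expectation (\<lambda>\<omega>. f (cut_off k (\<lambda>i. V n i \<omega>)))) \<longlonglongrightarrow> 0"
  proof (rule fun_slutsky[OF prob_space_axioms f Wm Vm Vsq _ dlim])
    fix i assume "i < k"
    from diff[OF this] show "\<forall>\<^sub>F n in sequentially. integrable M (\<lambda>\<omega>. (W n i \<omega> - V n i \<omega>)\<^sup>2)"
      by eventually_elim simp
  qed
  from tendsto_add[OF this 1] show ?thesis unfolding W_def F_def[abs_def] by simp
qed

end

end

text \<open>Restriction to \<open>{..<k}\<close> maps all sequences continuously onto the
  extensional vectors and forgets the padding. Test functions on the two kinds of vectors therefore
  correspond.\<close>

lemma weakly_converges_fin_dim_lawI: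
  fixes X :: "nat \<Rightarrow> 't \<Rightarrow> 'a \<Rightarrow> real" and Y :: "'t \<Rightarrow> 'b \<Rightarrow> real"
  assumes X: "\<And>n i. i < k \<Longrightarrow> X n (t i) \<in> borel_measurable M"
    and Y: "\<And>i. i < k \<Longrightarrow> Y (t i) \<in> borel_measurable N"
    and lim: "\<And>(g :: (nat \<Rightarrow> real) \<Rightarrow> real) B. continuous_on UNIV g \<Longrightarrow> (\<And>u. \<bar>g u\<bar> \<le> B) \<Longrightarrow>
      (\<lambda>n. \<integral>\<omega>. g (cut_off k (\<lambda>i. X n (t i) \<omega>)) \<partial>M) \<longlonglongrightarrow> (\<integral>\<omega>. g (cut_off k (\<lambda>i. Y (t i) \<omega>)) \<partial>N)"
  shows "weakly_converges (product_topology (\<lambda>_. euclideanreal) {..<k})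
          (\<lambda>n. fin_dim_law M (X n) k t) (fin_dim_law N Y k t)"
  unfolding weakly_converges_def
proof (intro allI impI, elim conjE)
  fix f :: "(nat \<Rightarrow> real) \<Rightarrow> real"
  let ?T = "product_topology (\<lambda>_. euclideanreal) {..<k}"
  assume f: "continuous_map ?T euclideanreal f" and bd: "bounded (f ` topspace ?T)"
  define g where "g u = f (restrict u {..<k})" for u
  have g: "continuous_on UNIV g"
  proof -
    have "continuous_map (product_topology (\<lambda>_. euclideanreal) UNIV) ?T (\<lambda>u. restrict u {..<k})"
      unfolding continuous_map_componentwise by (auto intro: continuous_map_product_projection)
    from continuous_map_compose[OF this f] have "continuous_map euclidean euclideanreal g"
      by (simp add: euclidean_product_topology comp_def g_def[abs_def])
    then show ?thesis by simp
  qed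
  obtain B where "\<And>v. v \<in> topspace ?T \<Longrightarrow> \<bar>f v\<bar> \<le> B"
    using bd unfolding bounded_iff by auto
  then have gB: "\<bar>g u\<bar> \<le> B" for u by (simp add: g_def)
  have gc: "g (cut_off k u) = g u" for u
  proof -
    have "restrict (cut_off k u) {..<k} = restrict u {..<k}" by (auto simp: cut_off_def)
    then show ?thesis by (simp add: g_def)
  qed
  have fm: "f \<in> borel_measurable (Pi\<^sub>M {..<k} (\<lambda>_. borel))"
  proof -
    have "(\<lambda>v. g (cut_off k v)) \<in> borel_measurable (Pi\<^sub>M {..<k} (\<lambda>_. borel))"
    proof (rule measurable_fun_continuous[OF g])
      fix i
      show "(\<lambda>v. cut_off k v i) \<in> borel_measurable (Pi\<^sub>M {..<k} (\<lambda>_. borel))"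
        by (cases "i < k") (auto simp: cut_off_def)
    qed
    then have "g \<in> borel_measurable (Pi\<^sub>M {..<k} (\<lambda>_. borel))" unfolding gc .
    then show ?thesis
      by (rule measurable_cong[THEN iffD1, rotated]) (auto simp: g_def space_PiM PiE_def extensional_restrict)
  qed
  have law: "(\<integral>v. f v \<partial>fin_dim_law P Z k t) = (\<integral>\<omega>. g (cut_off k (\<lambda>i. Z (t i) \<omega>)) \<partial>P)"
    if Z: "\<And>i. i < k \<Longrightarrow> Z (t i) \<in> borel_measurable P" for P :: "'z measure" and Z :: "'t \<Rightarrow> 'z \<Rightarrow> real"
  proof -
    have "(\<lambda>\<omega>. \<lambda>i\<in>{..<k}. Z (t i) \<omega>) \<in> measurable P (Pi\<^sub>M {..<k} (\<lambda>_. borel))"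
      by (rule measurable_restrict) (use Z in simp)
    then have "(\<integral>v. f v \<partial>fin_dim_law P Z k t) = (\<integral>\<omega>. f (\<lambda>i\<in>{..<k}. Z (t i) \<omega>) \<partial>P)"
      unfolding fin_dim_law_def by (rule integral_distr[OF _ fm])
    then show ?thesis unfolding gc by (simp add: g_def)
  qed
  have lX: "(\<integral>v. f v \<partial>fin_dim_law M (X n) k t) = (\<integral>\<omega>. g (cut_off k (\<lambda>i. X n (t i) \<omega>)) \<partial>M)" for n
    by (rule law) (rule X)
  have lY: "(\<integral>v. f v \<partial>fin_dim_law N Y k t) = (\<integral>\<omega>. g (cut_off k (\<lambda>i. Y (t i) \<omega>)) \<partial>N)"
    by (rule law) (rule Y)
  show "(\<lambda>n. \<integral>v. f v \<partial>fin_dim_law M (X n) k t) \<longlonglongrightarrow> (\<integral>v. f v \<partial>fin_dim_law N Y k t)"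
    unfolding lX lY by (rule lim[OF g gB])
qed

lemma distributed_std_normal:
  assumes "prob_space N" and Z: "distributed N lborel Z std_normal_density"
  shows std_normal_measurable: "Z \<in> borel_measurable N"
    and std_normal_square: "integrable N (\<lambda>\<omega>. (Z \<omega>)\<^sup>2)" "(\<integral>\<omega>. (Z \<omega>)\<^sup>2 \<partial>N) = 1"
    and std_normal_char: "(\<integral>\<omega>. iexp (\<theta> * Z \<omega>) \<partial>N) = exp (- (\<theta>\<^sup>2) / 2)"
proof -
  have d: "distr N lborel Z = std_normal_distribution" using Z by (simp add: distributed_def)
  have m: "Z \<in> measurable N lborel" using Z by (simp add: distributed_def)
  then show "Z \<in> borel_measurable N" by simp
  have sq: "integrable std_normal_distribution (\<lambda>y. y\<^sup>2)" "(\<integral>y. y\<^sup>2 \<partial>std_normal_distribution) = 1"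
    using std_normal_distribution_even_moments[of 1] by (auto simp: fact_numeral)
  show "integrable N (\<lambda>\<omega>. (Z \<omega>)\<^sup>2)" using sq(1) integrable_distr_eq[OF m, of "\<lambda>y. y\<^sup>2"] unfolding d by simp
  show "(\<integral>\<omega>. (Z \<omega>)\<^sup>2 \<partial>N) = 1" using sq(2) integral_distr[OF m, of "\<lambda>y. y\<^sup>2"] unfolding d by simp
  have "(\<integral>\<omega>. iexp (\<theta> * Z \<omega>) \<partial>N) = char std_normal_distribution \<theta>"
    unfolding char_def d[symmetric] by (subst integral_distr[OF m]) auto
  then show "(\<integral>\<omega>. iexp (\<theta> * Z \<omega>) \<partial>N) = exp (- (\<theta>\<^sup>2) / 2)"
    by (simp only: char_std_normal_distribution)
qed

text \<open>Independence factors the indicators of the earlier coordinates from the exponential of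
  the last one, so the difference in \<open>asymp_gauss\<close> is zero for every
  \<open>n\<close>.\<close>

lemma asymp_gauss_indep:
  fixes D :: "nat \<Rightarrow> 'a \<Rightarrow> real"
  assumes "prob_space N" and ind: "prob_space.indep_vars N (\<lambda>_. borel) D {..<m}"
    and D: "\<And>j. j < m \<Longrightarrow> distributed N lborel (D j) std_normal_density"
  shows "asymp_gauss N (\<lambda>_. D) m"
  unfolding asymp_gauss_def
proof (intro conjI allI impI)
  interpret prob_space N by fact
  show "prob_space N" by fact
  fix j assume j: "j < m"
  note nj = distributed_std_normal[OF prob_space_axioms D[OF j]]
  show "D j \<in> borel_measurable N" by (rule nj(1))
  show "\<exists>C. \<forall>\<^sub>F n in sequentially. integrable N (\<lambda>\<omega>. (D j \<omega>)\<^sup>2) \<and> (\<integral>\<omega>. (D j \<omega>)\<^sup>2 \<partial>N) \<le> C"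
    using nj(2,3) by (intro exI[of _ 1]) simp
  fix \<theta> :: real and I :: "nat \<Rightarrow> real set" assume I: "\<forall>i. I i \<in> sets borel"
  define A where "A = {\<omega>\<in>space N. \<forall>i<j. D i \<omega> \<in> I i}"
  have ind': "indep_vars (\<lambda>_. borel) D {..<Suc j}" by (rule indep_vars_subset[OF ind]) (use j in auto)
  have Dm: "D i \<in> borel_measurable N" if "i \<le> j" for i
    using distributed_std_normal(1)[OF prob_space_axioms D[of i]] that j by simp
  define P where "P = (\<Prod>i<j. expectation (\<lambda>\<omega>. indicator (I i) (D i \<omega>) :: complex))"
  have fact: "expectation (\<lambda>\<omega>. indicator A \<omega> * g (D j \<omega>)) = P * expectation (\<lambda>\<omega>. g (D j \<omega>))"
    if g: "g \<in> borel_measurable borel" "\<And>y. cmod (g y) \<le> 1" for g :: "real \<Rightarrow> complex"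
  proof -
    define h where "h i = (if i < j then (\<lambda>y. indicator (I i) y) else g)" for i
    have hm: "h i \<in> borel_measurable borel" for i using g I by (auto simp: h_def)
    have h1: "cmod (h i y) \<le> 1" for i y using g(2) by (auto simp: h_def indicator_def)
    have "indep_vars (\<lambda>_. borel) (\<lambda>i \<omega>. h i (D i \<omega>)) {..<Suc j}"
      using indep_vars_compose2[OF ind', of h "\<lambda>_. borel"] hm by simp
    moreover have "integrable N (\<lambda>\<omega>. h i (D i \<omega>))" if "i \<in> {..<Suc j}" for i
      by (rule integrable_const_bound[of _ 1]) (use h1 measurable_compose[OF Dm hm] that in auto)
    ultimately have "expectation (\<lambda>\<omega>. \<Prod>i<Suc j. h i (D i \<omega>)) = (\<Prod>i<Suc j. expectation (\<lambda>\<omega>. h i (D i \<omega>)))"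
      by (intro indep_vars_lebesgue_integral) auto
    also have "\<dots> = P * expectation (\<lambda>\<omega>. g (D j \<omega>))" by (simp add: h_def P_def)
    also have "expectation (\<lambda>\<omega>. \<Prod>i<Suc j. h i (D i \<omega>)) = expectation (\<lambda>\<omega>. indicator A \<omega> * g (D j \<omega>))"
    proof (rule Bochner_Integration.integral_cong[OF refl])
      fix \<omega> assume \<omega>: "\<omega> \<in> space N"
      have "(\<Prod>i<j. indicator (I i) (D i \<omega>) :: complex) = indicator A \<omega>"
      proof (cases "\<forall>i<j. D i \<omega> \<in> I i")
        case True
        then show ?thesis using \<omega> by (simp add: A_def)
      next
        case False
        then have "(\<Prod>i<j. indicator (I i) (D i \<omega>) :: complex) = 0" by (auto simp: indicator_def)
        then show ?thesis using False by (auto simp: A_def indicator_def)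
      qed
      then show "(\<Prod>i<Suc j. h i (D i \<omega>)) = indicator A \<omega> * g (D j \<omega>)" by (simp add: h_def)
    qed
    finally show ?thesis .
  qed
  have Aev: "A \<in> events"
  proof -
    have "{\<omega>\<in>space N. \<forall>i\<in>{..<j}. D i \<omega> \<in> I i} \<in> events"
    proof (rule sets.sets_Collect_finite_All)
      fix i assume "i \<in> {..<j}"
      then have "D i -` I i \<inter> space N \<in> events" using I by (intro measurable_sets[OF Dm]) auto
      moreover have "{\<omega>\<in>space N. D i \<omega> \<in> I i} = D i -` I i \<inter> space N" by auto
      ultimately show "{\<omega>\<in>space N. D i \<omega> \<in> I i} \<in> events" by simp
    qed simp
    then show ?thesis unfolding A_def by (simp only: Ball_def lessThan_iff)
  qed
  have "expectation (\<lambda>\<omega>. indicator A \<omega> :: complex) = of_real (prob A)"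
  proof -
    have "(\<lambda>\<omega>. indicator A \<omega> :: complex) = (\<lambda>\<omega>. of_real (indicator A \<omega>))" by (auto simp: indicator_def)
    then show ?thesis using sets.sets_into_space[OF Aev] by (simp add: Int_absorb2)
  qed
  moreover have "expectation (\<lambda>\<omega>. indicator A \<omega> :: complex) = P" using fact[of "\<lambda>_. 1"] by (simp add: prob_space)
  ultimately have "P = of_real (prob A)" by simp
  then have "expectation (\<lambda>\<omega>. indicator A \<omega> * iexp (\<theta> * D j \<omega>)) = prob A * exp (- (\<theta>\<^sup>2) / 2)"
    using fact[of "\<lambda>y. iexp (\<theta> * y)"] nj(4)[of \<theta>] by simp
  then show "(\<lambda>n. expectation (\<lambda>\<omega>. indicator {\<omega> \<in> space N. \<forall>i<j. D i \<omega> \<in> I i} \<omega> * iexp (\<theta> * D j \<omega>)) -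
      prob {\<omega> \<in> space N. \<forall>i<j. D i \<omega> \<in> I i} * exp (- \<theta>\<^sup>2 / 2)) \<longlonglongrightarrow> 0"
    unfolding A_def[symmetric] by simp
qed

text \<open>A constant sequence converges to its own value. By uniqueness of limits, the recursively
  defined \<open>gauss_mean\<close> is the expectation under any concrete vector of this
  kind.\<close>

lemma expectation_gauss_mean:
  fixes f :: "(nat \<Rightarrow> real) \<Rightarrow> real"
  assumes "asymp_gauss N (\<lambda>_. D) m" "continuous_on UNIV f" "\<And>u. \<bar>f u\<bar> \<le> B"
  shows "(\<integral>\<omega>. f (cut_off m (\<lambda>j. D j \<omega>)) \<partial>N) = gauss_mean m f"
  using LIMSEQ_unique[OF tendsto_const asymp_gauss_tendsto[OF assms]] .

section \<open>Scaling under the two time changes\<close>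

lemma floor_asymp:
  fixes y :: "nat \<Rightarrow> real"
  assumes y: "filterlim y at_top sequentially"
  defines "N \<equiv> \<lambda>n. nat \<lfloor>y n\<rfloor>"
  shows floor_at_top: "filterlim N at_top sequentially"
    and floor_ratio: "(\<lambda>n. real (N n) / y n) \<longlonglongrightarrow> 1"
    and floor_ln: "(\<lambda>n. ln (real (N n)) / ln (y n)) \<longlonglongrightarrow> 1"
    and floor_ln_ln: "(\<lambda>n. ln (ln (real (N n))) / ln (ln (y n))) \<longlonglongrightarrow> 1"
proof -
  have big: "\<forall>\<^sub>F n in sequentially. y n > b" for b using y by (simp add: filterlim_at_top_dense)
  have N: "y n - 1 \<le> real (N n) \<and> real (N n) \<le> y n" if "y n > 1" for n
    using that unfolding N_def by linarith
  show Ntop: "filterlim N at_top sequentially"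
    unfolding filterlim_at_top
  proof
    fix b :: nat
    show "\<forall>\<^sub>F n in sequentially. N n \<ge> b"
      using big[of "real b + 1"] by eventually_elim (simp add: N_def le_nat_floor)
  qed
  have lny: "filterlim (\<lambda>n. ln (y n)) at_top sequentially" by (rule filterlim_compose[OF ln_at_top y])
  have llny: "filterlim (\<lambda>n. ln (ln (y n))) at_top sequentially" by (rule filterlim_compose[OF ln_at_top lny])
  show ratio: "(\<lambda>n. real (N n) / y n) \<longlonglongrightarrow> 1"
  proof (rule tendsto_sandwich)
    show "\<forall>\<^sub>F n in sequentially. 1 - 1 / y n \<le> real (N n) / y n"
      using big[of 1]
    proof eventually_elim
      case (elim n)
      have "1 - 1 / y n = (y n - 1) / y n" using elim by (simp add: diff_divide_distrib)
      also have "\<dots> \<le> real (N n) / y n" using elim N[OF elim] by (intro divide_right_mono) auto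
      finally show ?case .
    qed
    show "\<forall>\<^sub>F n in sequentially. real (N n) / y n \<le> 1"
      using big[of 1]
    proof eventually_elim
      case (elim n)
      then show ?case using N[OF elim] by simp
    qed
    show "(\<lambda>n. 1 - 1 / y n) \<longlonglongrightarrow> 1"
      using tendsto_diff[OF tendsto_const[of 1] real_tendsto_divide_at_top[OF tendsto_const[of 1] y]] by simp
  qed simp
  \<comment> \<open>\<open>ln g / ln z = 1 + ln (g / z) / ln z\<close>, where the numerator tends to
    zero. It is applied to the integer part and then once more to its logarithm.\<close>
  have ln_ratio: "(\<lambda>n. ln (g n) / ln (z n)) \<longlonglongrightarrow> 1"
    if "(\<lambda>n. g n / z n) \<longlonglongrightarrow> 1" "filterlim (\<lambda>n. ln (z n)) at_top sequentially"
      "\<forall>\<^sub>F n in sequentially. g n > 0 \<and> z n > 0" for g z :: "nat \<Rightarrow> real"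
  proof -
    have "(\<lambda>n. 1 + ln (g n / z n) / ln (z n)) \<longlonglongrightarrow> 1 + 0"
      by (intro tendsto_add tendsto_const real_tendsto_divide_at_top[OF tendsto_ln[OF that(1)] that(2)]) simp
    moreover have "\<forall>\<^sub>F n in sequentially. ln (z n) > 0" using that(2) by (simp add: filterlim_at_top_dense)
    then have "\<forall>\<^sub>F n in sequentially. 1 + ln (g n / z n) / ln (z n) = ln (g n) / ln (z n)"
      using that(3) by eventually_elim (simp add: ln_div diff_divide_distrib)
    ultimately have "(\<lambda>n. ln (g n) / ln (z n)) \<longlonglongrightarrow> 1 + 0" by (rule Lim_transform_eventually)
    then show ?thesis by simp
  qed
  show ln: "(\<lambda>n. ln (real (N n)) / ln (y n)) \<longlonglongrightarrow> 1"
  proof (rule ln_ratio[OF ratio lny])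
    show "\<forall>\<^sub>F n in sequentially. real (N n) > 0 \<and> y n > 0"
      using big[of 2]
    proof eventually_elim
      case (elim n)
      then show ?case using N[of n] by linarith
    qed
  qed
  show "(\<lambda>n. ln (ln (real (N n))) / ln (ln (y n))) \<longlonglongrightarrow> 1"
  proof (rule ln_ratio[OF ln llny])
    have "\<forall>\<^sub>F n in sequentially. N n \<ge> 2" using Ntop by (simp add: filterlim_at_top)
    with big[of 1] show "\<forall>\<^sub>F n in sequentially. ln (real (N n)) > 0 \<and> ln (y n) > 0"
      by eventually_elim simp
  qed
qed

text \<open>\<open>y\<close> is the real sampling time and \<open>l\<close> the logarithmic factor
  of its normalisation. For \<open>n powr t\<close> the limits are \<open>h = t\<close> and
  \<open>\<tau> = 1\<close>; for \<open>exp (ln n powr t)\<close> they are \<open>h = 1\<close> and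
  \<open>\<tau> = t\<close>. So \<open>\<tau>\<close> is the clock of the limit and
  \<open>\<rho> * sqrt (c * h) = (2 * \<gamma> + 1) * sqrt h\<close> its amplitude, which explains
  the two shapes of the limit.\<close>

lemma critical_scaling:
  fixes y l :: "nat \<Rightarrow> real" and h \<tau> :: real
  assumes reg: "critical_regime \<mu> p c \<rho>"
    and y: "filterlim y at_top sequentially" and l: "\<forall>\<^sub>F n in sequentially. l n > 0"
    and h: "(\<lambda>n. ln (y n) / l n) \<longlonglongrightarrow> h" and \<tau>: "(\<lambda>n. ln (ln (y n)) / ln (ln (real n))) \<longlonglongrightarrow> \<tau>"
  defines "N \<equiv> \<lambda>n. nat \<lfloor>y n\<rfloor>" and "L \<equiv> \<lambda>n. c * ln (ln (real n))" and "q \<equiv> \<lambda>n. sqrt (y n * l n * ln (ln (real n)))"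
  shows scaling_clock: "(\<lambda>n. clock \<mu> p (N n) / L n) \<longlonglongrightarrow> \<tau>"
    and scaling_pos: "\<forall>\<^sub>F n in sequentially. q n > 0"
    and scaling_drift: "(\<lambda>n. drift_sum \<mu> p (N n) * sqrt (L n) / q n) \<longlonglongrightarrow> \<rho> * sqrt (c * h)"
    and scaling_rem: "(\<lambda>n. real (N n) * ln (real (N n)) * ln (ln (real (N n))) / (q n)\<^sup>2) \<longlonglongrightarrow> h * \<tau>"
proof -
  have c: "c > 0" and cl: "(\<lambda>n. clock \<mu> p n / ln (ln (real n))) \<longlonglongrightarrow> c"
    and dr: "(\<lambda>n. drift_sum \<mu> p n / sqrt (real n * ln (real n))) \<longlonglongrightarrow> \<rho>"
    using reg by (simp_all add: critical_regime_def)
  have N': "nat \<lfloor>y n\<rfloor> = N n" for n by (simp add: N_def)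
  note fl = floor_asymp[OF y, unfolded N']
  have lny: "filterlim (\<lambda>n. ln (y n)) at_top sequentially" by (rule filterlim_compose[OF ln_at_top y])
  have llny: "filterlim (\<lambda>n. ln (ln (y n))) at_top sequentially" by (rule filterlim_compose[OF ln_at_top lny])
  have yp: "\<forall>\<^sub>F n in sequentially. y n > 0 \<and> ln (y n) > 0 \<and> ln (ln (y n)) > 0"
    using y lny llny by (intro eventually_conj) (simp_all add: filterlim_at_top_dense)
  have llp: "\<forall>\<^sub>F n in sequentially. ln (ln (real n)) > 0" by real_asymp
  have "\<forall>\<^sub>F n in sequentially. real n > 0 \<and> ln (real n) > 0 \<and> ln (ln (real n)) > 0"
    by (intro eventually_conj; real_asymp)
  then have Np: "\<forall>\<^sub>F n in sequentially. real (N n) > 0 \<and> ln (real (N n)) > 0 \<and> ln (ln (real (N n))) > 0"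
    by (rule eventually_compose_filterlim[OF _ fl(1)])
  have "(\<lambda>n. clock \<mu> p (N n) / ln (ln (real (N n))) * (ln (ln (real (N n))) / ln (ln (y n))) * (ln (ln (y n)) / ln (ln (real n))) / c) \<longlonglongrightarrow> c * 1 * \<tau> / c"
    using c by (intro tendsto_divide[OF tendsto_mult[OF tendsto_mult[OF filterlim_compose[OF cl fl(1)] fl(4)] \<tau>] tendsto_const]) simp
  moreover have "\<forall>\<^sub>F n in sequentially. clock \<mu> p (N n) / ln (ln (real (N n))) * (ln (ln (real (N n))) / ln (ln (y n))) * (ln (ln (y n)) / ln (ln (real n))) / c = clock \<mu> p (N n) / L n"
    using yp Np
  proof eventually_elim
    case (elim n)
    have "A / a * (a / b) * (b / d) / c = A / (c * d)" if "a > 0" "b > 0" for A a b d :: real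
      using that by simp
    then show ?case unfolding L_def using elim by blast
  qed
  ultimately have "(\<lambda>n. clock \<mu> p (N n) / L n) \<longlonglongrightarrow> c * 1 * \<tau> / c" by (rule Lim_transform_eventually)
  then show "(\<lambda>n. clock \<mu> p (N n) / L n) \<longlonglongrightarrow> \<tau>" using c by simp
  show "\<forall>\<^sub>F n in sequentially. q n > 0"
    using yp llp l by eventually_elim (simp add: q_def)
  have "(\<lambda>n. drift_sum \<mu> p (N n) / sqrt (real (N n) * ln (real (N n))) *
      sqrt (real (N n) / y n * (ln (real (N n)) / ln (y n)) * (c * (ln (y n) / l n)))) \<longlonglongrightarrow> \<rho> * sqrt (1 * 1 * (c * h))"
    by (intro tendsto_mult tendsto_real_sqrt filterlim_compose[OF dr fl(1)] fl h tendsto_const)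
  moreover have "\<forall>\<^sub>F n in sequentially. drift_sum \<mu> p (N n) / sqrt (real (N n) * ln (real (N n))) *
      sqrt (real (N n) / y n * (ln (real (N n)) / ln (y n)) * (c * (ln (y n) / l n))) = drift_sum \<mu> p (N n) * sqrt (L n) / q n"
    using yp llp Np l
  proof eventually_elim
    case (elim n)
    define a where "a = real (N n) * ln (real (N n))"
    define L0 where "L0 = ln (ln (real n))"
    have pos: "a > 0" "L0 > 0" using elim by (simp_all add: a_def L0_def)
    have "real (N n) / y n * (ln (real (N n)) / ln (y n)) * (c * (ln (y n) / l n)) = a * (c * L0 / (y n * l n * L0))"
    proof -
      have "n1 / y1 * (n2 / y2) * (c * (y2 / l1)) = n1 * n2 * (c * L0 / (y1 * l1 * L0))" if "y2 > 0" for n1 n2 y1 y2 l1 :: real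
        using that pos by simp
      then show ?thesis unfolding a_def using elim by blast
    qed
    then have "sqrt (real (N n) / y n * (ln (real (N n)) / ln (y n)) * (c * (ln (y n) / l n))) = sqrt a * (sqrt (c * L0) / sqrt (y n * l n * L0))"
      by (simp only: real_sqrt_mult real_sqrt_divide)
    then show ?case using pos unfolding L_def q_def a_def[symmetric] L0_def[symmetric] by simp
  qed
  ultimately have "(\<lambda>n. drift_sum \<mu> p (N n) * sqrt (L n) / q n) \<longlonglongrightarrow> \<rho> * sqrt (1 * 1 * (c * h))"
    by (rule Lim_transform_eventually)
  then show "(\<lambda>n. drift_sum \<mu> p (N n) * sqrt (L n) / q n) \<longlonglongrightarrow> \<rho> * sqrt (c * h)" by simp
  have "(\<lambda>n. real (N n) / y n * (ln (real (N n)) / ln (y n)) * (ln (y n) / l n) * (ln (ln (real (N n))) / ln (ln (y n)) * (ln (ln (y n)) / ln (ln (real n))))) \<longlonglongrightarrow> 1 * 1 * h * (1 * \<tau>)"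
    by (intro tendsto_mult fl h \<tau>)
  moreover have "\<forall>\<^sub>F n in sequentially. real (N n) / y n * (ln (real (N n)) / ln (y n)) * (ln (y n) / l n) * (ln (ln (real (N n))) / ln (ln (y n)) * (ln (ln (y n)) / ln (ln (real n))))
      = real (N n) * ln (real (N n)) * ln (ln (real (N n))) / (q n)\<^sup>2"
    using yp llp Np l
  proof eventually_elim
    case (elim n)
    have "(q n)\<^sup>2 = y n * l n * ln (ln (real n))" unfolding q_def using elim by (intro real_sqrt_pow2) simp
    moreover have "n1 / y1 * (n2 / y2) * (y2 / l1) * (n3 / y3 * (y3 / l2)) = n1 * n2 * n3 / (y1 * l1 * l2)" if "y2 > 0" "y3 > 0"
      for n1 n2 n3 y1 y2 y3 l1 l2 :: real using that by simp
    ultimately show ?case using elim by metis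
  qed
  ultimately have "(\<lambda>n. real (N n) * ln (real (N n)) * ln (ln (real (N n))) / (q n)\<^sup>2) \<longlonglongrightarrow> 1 * 1 * h * (1 * \<tau>)"
    by (rule Lim_transform_eventually)
  then show "(\<lambda>n. real (N n) * ln (real (N n)) * ln (ln (real (N n))) / (q n)\<^sup>2) \<longlonglongrightarrow> h * \<tau>" by simp
qed

lemma scaling_powr:
  fixes s :: real
  assumes s: "s > 0"
  shows "filterlim (\<lambda>n. real n powr s) at_top sequentially"
    and "\<forall>\<^sub>F n in sequentially. ln (real n) > 0"
    and "(\<lambda>n. ln (real n powr s) / ln (real n)) \<longlonglongrightarrow> s"
    and "(\<lambda>n. ln (ln (real n powr s)) / ln (ln (real n))) \<longlonglongrightarrow> 1"
  using s by real_asymp+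

lemma scaling_exp_powr:
  fixes s :: real
  assumes s: "s > 0"
  shows "filterlim (\<lambda>n. exp (ln (real n) powr s)) at_top sequentially"
    and "\<forall>\<^sub>F n in sequentially. ln (real n) powr s > 0"
    and "(\<lambda>n. ln (exp (ln (real n) powr s)) / ln (real n) powr s) \<longlonglongrightarrow> 1"
    and "(\<lambda>n. ln (ln (exp (ln (real n) powr s))) / ln (ln (real n))) \<longlonglongrightarrow> s"
proof -
  have "filterlim (\<lambda>n. ln (real n) powr s) at_top sequentially" using s by real_asymp
  then show "filterlim (\<lambda>n. exp (ln (real n) powr s)) at_top sequentially"
    by (rule filterlim_compose[OF exp_at_top])
  show pos: "\<forall>\<^sub>F n in sequentially. ln (real n) powr s > 0" using s by real_asymp
  show "(\<lambda>n. ln (exp (ln (real n) powr s)) / ln (real n) powr s) \<longlonglongrightarrow> 1"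
    by (rule tendsto_eventually) (use pos in eventually_elim, simp)
  have "\<forall>\<^sub>F n in sequentially. ln (real n) > 0 \<and> ln (ln (real n)) > 0"
    by (intro eventually_conj; real_asymp)
  then have "\<forall>\<^sub>F n in sequentially. ln (ln (exp (ln (real n) powr s))) / ln (ln (real n)) = s"
  proof eventually_elim
    case (elim n)
    have "ln (ln (exp (ln (real n) powr s))) = s * ln (ln (real n))" using elim by (simp add: ln_powr)
    moreover have "s * z / z = s" if "z > 0" for z :: real using that by simp
    ultimately show ?case using elim by metis
  qed
  then show "(\<lambda>n. ln (ln (exp (ln (real n) powr s))) / ln (ln (real n))) \<longlonglongrightarrow> s"
    by (rule tendsto_eventually)
qed

section \<open>Brownian motion sampled on a finite grid\<close>

context standard_brownian_motion
begin

definition scaled_increment :: "(nat \<Rightarrow> real) \<Rightarrow> nat \<Rightarrow> 'b \<Rightarrow> real" where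
  "scaled_increment T j \<omega> = (B (T (Suc j)) \<omega> - B (T j) \<omega>) / sqrt (T (Suc j) - T j)"

text \<open>Increments divided by their standard deviations are independent standard normal.
  Telescoping returns \<open>B\<close> only almost surely because \<open>B 0 = 0\<close> is only
  almost sure.\<close>

lemma
  assumes T: "T 0 = 0" "\<And>j. j < m \<Longrightarrow> T j < T (Suc j)"
  shows asymp_gauss_increments: "asymp_gauss N (\<lambda>_. scaled_increment T) m"
    and increments_sum: "AE \<omega> in N. \<forall>j<m. (\<Sum>i<Suc j. sqrt (T (Suc i) - T i) * scaled_increment T i \<omega>) = B (T (Suc j)) \<omega>"
proof -
  have T0: "0 \<le> T j" if "j \<le> m" for j using that
  proof (induction j)
    case (Suc j)
    then show ?case using T(2)[of j] by simp
  qed (simp add: T)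
  show "asymp_gauss N (\<lambda>_. scaled_increment T) m"
  proof (rule asymp_gauss_indep[OF prob_space_axioms])
    have "indep_vars (\<lambda>_. borel) (\<lambda>i \<omega>. B (T (Suc i)) \<omega> - B (T i) \<omega>) {..<m}"
      using T by (intro independent_increments) (auto intro: less_imp_le)
    from indep_vars_compose2[OF this, of "\<lambda>i y. y / sqrt (T (Suc i) - T i)" "\<lambda>_. borel"]
    show "indep_vars (\<lambda>_. borel) (scaled_increment T) {..<m}"
      unfolding scaled_increment_def[abs_def] by simp
  next
    fix j assume j: "j < m"
    have "distributed N lborel (\<lambda>\<omega>. B (T (Suc j)) \<omega> - B (T j) \<omega>) (normal_density 0 (sqrt (T (Suc j) - T j)))"
      using T(2)[OF j] T0[of j] j by (intro normal_increments) auto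
    then show "distributed N lborel (scaled_increment T j) std_normal_density"
      using normal_standard_normal_convert[of "sqrt (T (Suc j) - T j)" "\<lambda>\<omega>. B (T (Suc j)) \<omega> - B (T j) \<omega>" 0] T(2)[OF j]
      unfolding scaled_increment_def[abs_def] by simp
  qed
  show "AE \<omega> in N. \<forall>j<m. (\<Sum>i<Suc j. sqrt (T (Suc i) - T i) * scaled_increment T i \<omega>) = B (T (Suc j)) \<omega>"
    using start_zero
  proof eventually_elim
    case (elim \<omega>)
    show ?case
    proof (intro allI impI)
      fix j assume j: "j < m"
      have "(\<Sum>i<Suc j. sqrt (T (Suc i) - T i) * scaled_increment T i \<omega>) = (\<Sum>i<Suc j. B (T (Suc i)) \<omega> - B (T i) \<omega>)"
      proof (rule sum.cong[OF refl])
        fix i assume "i \<in> {..<Suc j}"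
        then have "T i < T (Suc i)" using j by (intro T) simp
        then show "sqrt (T (Suc i) - T i) * scaled_increment T i \<omega> = B (T (Suc i)) \<omega> - B (T i) \<omega>"
          by (simp add: scaled_increment_def)
      qed
      also have "\<dots> = B (T (Suc j)) \<omega> - B (T 0) \<omega>" by (rule sum_lessThan_telescope)
      finally show "(\<Sum>i<Suc j. sqrt (T (Suc i) - T i) * scaled_increment T i \<omega>) = B (T (Suc j)) \<omega>"
        using elim T by simp
    qed
  qed
qed

end

text \<open>The given times may be unordered and repeated, whereas increments can be normalised only
  on a strictly increasing grid. Sorting the distinct values and prepending zero gives
  \<open>T\<close>; \<open>J\<close> finds each time in it.\<close>

lemma time_grid:
  fixes t :: "nat \<Rightarrow> real" and k :: nat
  assumes t: "\<And>i. i < k \<Longrightarrow> t i > 0"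
  obtains T :: "nat \<Rightarrow> real" and m :: nat and J :: "nat \<Rightarrow> nat"
  where "T 0 = 0" "\<And>j. j < m \<Longrightarrow> T j < T (Suc j)" "\<And>i. i < k \<Longrightarrow> J i < m" "\<And>i. i < k \<Longrightarrow> T (Suc (J i)) = t i"
proof -
  define s where "s = sorted_list_of_set (t ` {..<k})"
  define T where "T j = (0 # s) ! j" for j
  have set_s: "set s = t ` {..<k}" unfolding s_def by simp
  have sorted: "sorted_wrt (<) s" unfolding s_def by (rule strict_sorted_list_of_set)
  have "sorted_wrt (<) (0 # s)" using sorted set_s t by auto
  then have T: "T j < T (Suc j)" if "j < length s" for j
    unfolding T_def by (rule sorted_wrt_nth_less) (use that in auto)
  have "\<exists>j<length s. s ! j = t i" if "i < k" for i
    using that set_s by (metis imageI in_set_conv_nth lessThan_iff)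
  then obtain J where "\<And>i. i < k \<Longrightarrow> J i < length s \<and> s ! J i = t i" by metis
  then show ?thesis using that[of T "length s" J] T by (simp add: T_def)
qed

text \<open>Both limits are instances of \<open>walk_fdd\<close> and differ in the grid: a single
  point at clock value \<open>1\<close> for the times \<open>n powr t\<close>, the sorted parameters
  \<open>t\<close> themselves for \<open>exp (ln n powr t)\<close>. On the limit side
  \<open>expectation_gauss_mean\<close> recognises the same \<open>gauss_mean\<close>.\<close>

theorem theorem4p36:
  fixes M :: "'a measure" and N :: "'b measure" and N' :: "'c measure"
    and \<gamma> p :: real and \<mu> :: "nat \<Rightarrow> real"
    and \<xi> X :: "nat \<Rightarrow> 'a \<Rightarrow> real" and \<alpha> :: "nat \<Rightarrow> 'a \<Rightarrow> bool" and \<beta> :: "nat \<Rightarrow> 'a \<Rightarrow> nat"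
    and Z :: "'b \<Rightarrow> real" and B :: "real \<Rightarrow> 'c \<Rightarrow> real"
  assumes "\<gamma> > - 1 / 2"
    and "srrw_rvm M p \<gamma> \<mu> \<xi> \<alpha> \<beta> X"
    and "integrable M (\<lambda>\<omega>. (\<xi> 1 \<omega>)\<^sup>2)" and "prob_space.variance M (\<xi> 1) = 1"
    and "\<And>n. n \<ge> 2 \<Longrightarrow> \<mu> n = real n powr \<gamma> * ln (real n) powr (- (\<gamma> + 1))"
    and "p = critical_prob \<gamma>"
    and "prob_space N" and "distributed N lborel Z std_normal_density"
    and "standard_brownian_motion N' B"
  shows "fdd_converges {0<..}
           M (\<lambda>n t \<omega>. walk X (nat \<lfloor>real n powr t\<rfloor>) \<omega> /
                sqrt (real n powr t * ln (real n) * ln (ln (real n))))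
           N (\<lambda>t \<omega>. (2 * \<gamma> + 1) * sqrt t * Z \<omega>)
       \<and> fdd_converges {0<..}
           M (\<lambda>n t \<omega>. walk X (nat \<lfloor>exp (ln (real n) powr t)\<rfloor>) \<omega> /
                sqrt (exp (ln (real n) powr t) * ln (real n) powr t * ln (ln (real n))))
           N' (\<lambda>t \<omega>. (2 * \<gamma> + 1) * B t \<omega>)"
proof -
  interpret S: srrw_rvm M p \<gamma> \<mu> \<xi> \<alpha> \<beta> X by fact
  \<comment> \<open>The walk is the functional with \<open>\<psi>\<close> the identity; unit
    variance becomes \<open>F.s2 = 1\<close>.\<close>
  interpret F: srrw_functional M p \<gamma> \<mu> \<xi> \<alpha> \<beta> X "\<lambda>y. y"
    by unfold_locales (use assms(3) S.innovation_mean in auto)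
  interpret BM: standard_brownian_motion N' B by fact
  have s2: "F.s2 = 1" using assms(4) S.innovation_mean by (simp add: F.s2_def)
  obtain c \<rho> where reg: "critical_regime \<mu> p c \<rho>" and \<rho>c: "\<rho> * sqrt c = 2 * \<gamma> + 1"
    by (rule critical_asymptotics[OF assms(1) S.memory_pos assms(5,6)])
  have c: "c > 0" using reg by (simp add: critical_regime_def)
  define L where "L n = c * ln (ln (real n))" for n
  have L: "filterlim L at_top sequentially"
    unfolding L_def[abs_def] by (rule filterlim_tendsto_pos_mult_at_top[OF tendsto_const c]) real_asymp
  have walk_measurable: "walk X n \<in> borel_measurable M" for n
    unfolding walk_def[abs_def] using S.step_random_variable by (intro borel_measurable_sum) auto
  have x_measurable: "F.x l \<in> borel_measurable M" if "l \<ge> 1" for l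
    by (rule S.l2_measurable[OF F.l2_x[OF that order_refl]])
  have walk_x: "(\<integral>\<omega>. g (cut_off k (\<lambda>i. walk X (NN i) \<omega> / q i)) \<partial>M) = (\<integral>\<omega>. g (cut_off k (\<lambda>i. (\<Sum>l=1..NN i. F.x l \<omega>) / q i)) \<partial>M)"
    if g: "continuous_on UNIV g" for g :: "(nat \<Rightarrow> real) \<Rightarrow> real" and k NN q
  proof (rule integral_cong_AE)
    show "(\<lambda>\<omega>. g (cut_off k (\<lambda>i. walk X (NN i) \<omega> / q i))) \<in> borel_measurable M"
      using walk_measurable by (intro measurable_fun_continuous[OF g] measurable_cut) simp
    show "(\<lambda>\<omega>. g (cut_off k (\<lambda>i. (\<Sum>l=1..NN i. F.x l \<omega>) / q i))) \<in> borel_measurable M"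
      using x_measurable by (intro measurable_fun_continuous[OF g] measurable_cut borel_measurable_divide borel_measurable_sum) auto
    show "AE \<omega> in M. g (cut_off k (\<lambda>i. walk X (NN i) \<omega> / q i)) = g (cut_off k (\<lambda>i. (\<Sum>l=1..NN i. F.x l \<omega>) / q i))"
      using S.steps_eq
    proof eventually_elim
      case (elim \<omega>)
      have "walk X n \<omega> = (\<Sum>l=1..n. F.x l \<omega>)" for n
        unfolding walk_def F.x_def using elim by (intro sum.cong) auto
      then show ?case by simp
    qed
  qed
  have part1: "fdd_converges {0<..} M (\<lambda>n t \<omega>. walk X (nat \<lfloor>real n powr t\<rfloor>) \<omega> /
      sqrt (real n powr t * ln (real n) * ln (ln (real n)))) N (\<lambda>t \<omega>. (2 * \<gamma> + 1) * sqrt t * Z \<omega>)"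
    unfolding fdd_converges_def
  proof (intro allI impI)
    fix k and t :: "nat \<Rightarrow> real" assume "\<forall>i<k. t i \<in> {0<..}"
    then have t: "t i > 0" if "i < k" for i using that by simp
    note sc = scaling_powr[OF t]
    note cs = critical_scaling[OF reg sc, folded L_def]
    show "weakly_converges (product_topology (\<lambda>_. euclideanreal) {..<k})
       (\<lambda>n. fin_dim_law M (\<lambda>t \<omega>. walk X (nat \<lfloor>real n powr t\<rfloor>) \<omega> / sqrt (real n powr t * ln (real n) * ln (ln (real n)))) k t)
       (fin_dim_law N (\<lambda>t \<omega>. (2 * \<gamma> + 1) * sqrt t * Z \<omega>) k t)"
    proof (rule weakly_converges_fin_dim_lawI)
      note Zm = std_normal_measurable[OF assms(7,8)]
      show "(\<lambda>\<omega>. walk X (nat \<lfloor>real n powr t i\<rfloor>) \<omega> / sqrt (real n powr t i * ln (real n) * ln (ln (real n)))) \<in> borel_measurable M" for n i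
        using walk_measurable by (intro borel_measurable_divide) auto
      show "(\<lambda>\<omega>. (2 * \<gamma> + 1) * sqrt (t i) * Z \<omega>) \<in> borel_measurable N" for i
        using Zm by (intro borel_measurable_times) auto
      fix g :: "(nat \<Rightarrow> real) \<Rightarrow> real" and b assume g: "continuous_on UNIV g" "\<And>u. \<bar>g u\<bar> \<le> b"
      define w where "w i = \<rho> * sqrt (c * t i)" for i
      have w: "w i = (2 * \<gamma> + 1) * sqrt (t i)" for i using \<rho>c by (simp add: w_def real_sqrt_mult mult.assoc[symmetric])
      define G where "G u = g (cut_off k (\<lambda>i. w i * (\<Sum>j<Suc 0. sqrt (real (Suc j) - real j) * u j)))" for u
      have lim: "(\<lambda>n. \<integral>\<omega>. g (cut_off k (\<lambda>i. (\<Sum>l=1..nat \<lfloor>real n powr t i\<rfloor>. F.x l \<omega>) / sqrt (real n powr t i * ln (real n) * ln (ln (real n))))) \<partial>M)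
         \<longlonglongrightarrow> gauss_mean 1 G"
        unfolding G_def[abs_def]
      \<comment> \<open>All times \<open>n powr t i\<close> have the clock of \<open>n\<close> to
        leading order, so the one grid point \<open>K = n\<close>, at clock value
        \<open>real 1\<close>, serves every \<open>i\<close>; the parameter survives in the
        amplitude \<open>w i\<close>.\<close>
      proof (rule F.walk_fdd[OF reg s2 L, where K="\<lambda>_ n. n" and T=real and m=1 and J="\<lambda>_. 0" and k=k and w=w
            and NN="\<lambda>i n. nat \<lfloor>real n powr t i\<rfloor>" and q="\<lambda>i n. sqrt (real n powr t i * ln (real n) * ln (ln (real n)))"
            and r="\<lambda>i. t i * 1" and f=g and B=b])
        show "filterlim (\<lambda>n::nat. n) at_top sequentially" by (rule filterlim_ident)
        show "(\<lambda>n. clock \<mu> p n / L n) \<longlonglongrightarrow> real (Suc j)" if "j < 1" for j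
        proof -
          have "(\<lambda>n. clock \<mu> p n / ln (ln (real n)) / c) \<longlonglongrightarrow> c / c"
            using reg c by (intro tendsto_divide tendsto_const) (auto simp: critical_regime_def)
          then show ?thesis using c that by (simp add: L_def mult.commute)
        qed
        fix i assume i: "i < k"
        show "filterlim (\<lambda>n. nat \<lfloor>real n powr t i\<rfloor>) at_top sequentially" by (rule floor_at_top[OF sc(1)[OF i]])
        show "(\<lambda>n. clock \<mu> p (nat \<lfloor>real n powr t i\<rfloor>) / L n) \<longlonglongrightarrow> real (Suc 0)" using cs(1)[OF i i i i] by simp
        show "\<forall>\<^sub>F n in sequentially. 0 < sqrt (real n powr t i * ln (real n) * ln (ln (real n)))" by (rule cs(2)[OF i i i i])
        show "(\<lambda>n. drift_sum \<mu> p (nat \<lfloor>real n powr t i\<rfloor>) * sqrt (L n) / sqrt (real n powr t i * ln (real n) * ln (ln (real n)))) \<longlonglongrightarrow> w i"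
          unfolding w_def by (rule cs(3)[OF i i i i])
        show "(\<lambda>n. real (nat \<lfloor>real n powr t i\<rfloor>) * ln (real (nat \<lfloor>real n powr t i\<rfloor>)) * ln (ln (real (nat \<lfloor>real n powr t i\<rfloor>))) /
            (sqrt (real n powr t i * ln (real n) * ln (ln (real n))))\<^sup>2) \<longlonglongrightarrow> t i * 1" by (rule cs(4)[OF i i i i])
      qed (use g in auto)
      have ag: "asymp_gauss N (\<lambda>_ _. Z) 1"
      proof (rule asymp_gauss_indep[OF assms(7)])
        interpret N: prob_space N by fact
        \<comment> \<open>A family with a single member is independent: the only nonempty index set
          is \<open>{0}\<close>.\<close>
        have single: "N.prob (\<Inter>j\<in>J. A j) = (\<Prod>j\<in>J. N.prob (A j))" if "J \<subseteq> {..<1}" "J \<noteq> {}"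
          for J :: "nat set" and A
        proof -
          have "J = {0}" using that by auto
          then show ?thesis by simp
        qed
        show "N.indep_vars (\<lambda>_. borel) (\<lambda>_. Z) {..<1::nat}"
          unfolding N.indep_vars_def2 N.indep_sets_def using Zm by (auto intro!: single)
      qed (use assms(8) in simp)
      have "(\<integral>\<omega>. G (cut_off 1 (\<lambda>_. Z \<omega>)) \<partial>N) = gauss_mean 1 G"
      proof (rule expectation_gauss_mean[OF ag, of _ b])
        show "continuous_on UNIV G" unfolding G_def[abs_def] by (rule continuous_on_cut_off_linear[OF g(1)])
        show "\<bar>G u\<bar> \<le> b" for u unfolding G_def by (rule g(2))
      qed
      moreover have "G (cut_off 1 (\<lambda>_. Z \<omega>)) = g (cut_off k (\<lambda>i. (2 * \<gamma> + 1) * sqrt (t i) * Z \<omega>))" for \<omega>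
        unfolding G_def w by (simp add: cut_off_def)
      ultimately show "(\<lambda>n. \<integral>\<omega>. g (cut_off k (\<lambda>i. walk X (nat \<lfloor>real n powr t i\<rfloor>) \<omega> / sqrt (real n powr t i * ln (real n) * ln (ln (real n))))) \<partial>M)
         \<longlonglongrightarrow> (\<integral>\<omega>. g (cut_off k (\<lambda>i. (2 * \<gamma> + 1) * sqrt (t i) * Z \<omega>)) \<partial>N)"
        unfolding walk_x[OF g(1)] using lim by simp
    qed
  qed
  have part2: "fdd_converges {0<..} M (\<lambda>n t \<omega>. walk X (nat \<lfloor>exp (ln (real n) powr t)\<rfloor>) \<omega> /
      sqrt (exp (ln (real n) powr t) * ln (real n) powr t * ln (ln (real n)))) N' (\<lambda>t \<omega>. (2 * \<gamma> + 1) * B t \<omega>)"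
    unfolding fdd_converges_def
  proof (intro allI impI)
    fix k and t :: "nat \<Rightarrow> real" assume "\<forall>i<k. t i \<in> {0<..}"
    then have t: "t i > 0" if "i < k" for i using that by simp
    obtain T m J where T: "T 0 = 0" "\<And>j. j < m \<Longrightarrow> T j < T (Suc j)"
      and J: "\<And>i. i < k \<Longrightarrow> J i < m" "\<And>i. i < k \<Longrightarrow> T (Suc (J i)) = t i"
      using time_grid[of k t] t by metis
    have T_mono: "T i \<le> T j" if "i \<le> j" "j \<le> m" for i j
      using that
    proof (induction j rule: dec_induct)
      case (step j)
      then show ?case using T(2)[of j] by simp
    qed simp
    have T_pos: "T (Suc j) > 0" if "j < m" for j using T_mono[of 0 j] T(2)[OF that] T(1) that by simp
    note sc = scaling_exp_powr[OF t]
    note cs = critical_scaling[OF reg sc, folded L_def]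
    show "weakly_converges (product_topology (\<lambda>_. euclideanreal) {..<k})
       (\<lambda>n. fin_dim_law M (\<lambda>t \<omega>. walk X (nat \<lfloor>exp (ln (real n) powr t)\<rfloor>) \<omega> / sqrt (exp (ln (real n) powr t) * ln (real n) powr t * ln (ln (real n)))) k t)
       (fin_dim_law N' (\<lambda>t \<omega>. (2 * \<gamma> + 1) * B t \<omega>) k t)"
    proof (rule weakly_converges_fin_dim_lawI)
      show "(\<lambda>\<omega>. walk X (nat \<lfloor>exp (ln (real n) powr t i)\<rfloor>) \<omega> / sqrt (exp (ln (real n) powr t i) * ln (real n) powr t i * ln (ln (real n)))) \<in> borel_measurable M" for n i
        using walk_measurable by (intro borel_measurable_divide) auto
      have Bm: "B (t i) \<in> borel_measurable N'" if "i < k" for i using BM.random_variable_B[of "t i"] t[OF that] by simp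
      then show "(\<lambda>\<omega>. (2 * \<gamma> + 1) * B (t i) \<omega>) \<in> borel_measurable N'" if "i < k" for i
        using that by (intro borel_measurable_times) auto
      fix g :: "(nat \<Rightarrow> real) \<Rightarrow> real" and b assume g: "continuous_on UNIV g" "\<And>u. \<bar>g u\<bar> \<le> b"
      define G where "G u = g (cut_off k (\<lambda>i. (2 * \<gamma> + 1) * (\<Sum>j<Suc (J i). sqrt (T (Suc j) - T j) * u j)))" for u
      have lim: "(\<lambda>n. \<integral>\<omega>. g (cut_off k (\<lambda>i. (\<Sum>l=1..nat \<lfloor>exp (ln (real n) powr t i)\<rfloor>. F.x l \<omega>) / sqrt (exp (ln (real n) powr t i) * ln (real n) powr t i * ln (ln (real n))))) \<partial>M)
         \<longlonglongrightarrow> gauss_mean m G"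
        unfolding G_def[abs_def]
      \<comment> \<open>Here the amplitude is the same for all times, and the parameters
        \<open>t i\<close> are themselves the clock values, listed in increasing order by
        \<open>T\<close>.\<close>
      proof (rule F.walk_fdd[OF reg s2 L, where K="\<lambda>j n. nat \<lfloor>exp (ln (real n) powr T (Suc j))\<rfloor>" and T=T and m=m and J=J and k=k and w="\<lambda>_. 2 * \<gamma> + 1"
            and NN="\<lambda>i n. nat \<lfloor>exp (ln (real n) powr t i)\<rfloor>" and q="\<lambda>i n. sqrt (exp (ln (real n) powr t i) * ln (real n) powr t i * ln (ln (real n)))"
            and r="\<lambda>i. 1 * t i" and f=g and B=b])
        show "T 0 = 0" by (rule T)
        show "T j < T (Suc j)" if "j < m" for j by (rule T(2)[OF that])
        show "filterlim (\<lambda>n. nat \<lfloor>exp (ln (real n) powr T (Suc j))\<rfloor>) at_top sequentially" if "j < m" for j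
          by (rule floor_at_top[OF scaling_exp_powr(1)[OF T_pos[OF that]]])
        show "(\<lambda>n. clock \<mu> p (nat \<lfloor>exp (ln (real n) powr T (Suc j))\<rfloor>) / L n) \<longlonglongrightarrow> T (Suc j)" if "j < m" for j
          unfolding L_def by (rule scaling_clock[OF reg scaling_exp_powr[OF T_pos[OF that]]])
        have "\<forall>\<^sub>F n in sequentially. ln (real n) \<ge> 1" by real_asymp
        then show "\<forall>\<^sub>F n in sequentially. \<forall>i j. i \<le> j \<and> j < m \<longrightarrow> nat \<lfloor>exp (ln (real n) powr T (Suc i))\<rfloor> \<le> nat \<lfloor>exp (ln (real n) powr T (Suc j))\<rfloor>"
        proof eventually_elim
          case (elim n)
          show ?case
          proof (intro allI impI)
            fix i j assume "i \<le> j \<and> j < m"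
            then have "T (Suc i) \<le> T (Suc j)" by (intro T_mono) auto
            then have "ln (real n) powr T (Suc i) \<le> ln (real n) powr T (Suc j)" using elim by (intro powr_mono) auto
            then show "nat \<lfloor>exp (ln (real n) powr T (Suc i))\<rfloor> \<le> nat \<lfloor>exp (ln (real n) powr T (Suc j))\<rfloor>"
              by (intro nat_mono floor_mono) simp
          qed
        qed
        fix i assume i: "i < k"
        show "J i < m" by (rule J(1)[OF i])
        show "filterlim (\<lambda>n. nat \<lfloor>exp (ln (real n) powr t i)\<rfloor>) at_top sequentially" by (rule floor_at_top[OF sc(1)[OF i]])
        show "(\<lambda>n. clock \<mu> p (nat \<lfloor>exp (ln (real n) powr t i)\<rfloor>) / L n) \<longlonglongrightarrow> T (Suc (J i))"
          unfolding J(2)[OF i] by (rule cs(1)[OF i i i i])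
        show "\<forall>\<^sub>F n in sequentially. 0 < sqrt (exp (ln (real n) powr t i) * ln (real n) powr t i * ln (ln (real n)))" by (rule cs(2)[OF i i i i])
        show "(\<lambda>n. drift_sum \<mu> p (nat \<lfloor>exp (ln (real n) powr t i)\<rfloor>) * sqrt (L n) / sqrt (exp (ln (real n) powr t i) * ln (real n) powr t i * ln (ln (real n)))) \<longlonglongrightarrow> 2 * \<gamma> + 1"
          using cs(3)[OF i i i i] \<rho>c by simp
        show "(\<lambda>n. real (nat \<lfloor>exp (ln (real n) powr t i)\<rfloor>) * ln (real (nat \<lfloor>exp (ln (real n) powr t i)\<rfloor>)) * ln (ln (real (nat \<lfloor>exp (ln (real n) powr t i)\<rfloor>))) /
            (sqrt (exp (ln (real n) powr t i) * ln (real n) powr t i * ln (ln (real n))))\<^sup>2) \<longlonglongrightarrow> 1 * t i" by (rule cs(4)[OF i i i i])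
      qed (rule g)+
      have Gc: "continuous_on UNIV G" unfolding G_def[abs_def] by (rule continuous_on_cut_off_linear[OF g(1)])
      have ag: "asymp_gauss N' (\<lambda>_. BM.scaled_increment T) m" by (rule BM.asymp_gauss_increments[OF T])
      have sums: "AE \<omega> in N'. \<forall>j<m. (\<Sum>i<Suc j. sqrt (T (Suc i) - T i) * BM.scaled_increment T i \<omega>) = B (T (Suc j)) \<omega>"
        by (rule BM.increments_sum[OF T])
      have "(\<integral>\<omega>. G (cut_off m (\<lambda>j. BM.scaled_increment T j \<omega>)) \<partial>N') = gauss_mean m G"
        by (rule expectation_gauss_mean[OF ag Gc, of b]) (simp add: G_def g(2))
      moreover have "(\<integral>\<omega>. G (cut_off m (\<lambda>j. BM.scaled_increment T j \<omega>)) \<partial>N') = (\<integral>\<omega>. g (cut_off k (\<lambda>i. (2 * \<gamma> + 1) * B (t i) \<omega>)) \<partial>N')"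
      proof (rule integral_cong_AE)
        show "(\<lambda>\<omega>. G (cut_off m (\<lambda>j. BM.scaled_increment T j \<omega>))) \<in> borel_measurable N'"
          using ag by (intro measurable_fun_continuous[OF Gc] measurable_cut) (simp add: asymp_gauss_def)
        show "(\<lambda>\<omega>. g (cut_off k (\<lambda>i. (2 * \<gamma> + 1) * B (t i) \<omega>))) \<in> borel_measurable N'"
          using Bm by (intro measurable_fun_continuous[OF g(1)] measurable_cut borel_measurable_times) auto
        show "AE \<omega> in N'. G (cut_off m (\<lambda>j. BM.scaled_increment T j \<omega>)) = g (cut_off k (\<lambda>i. (2 * \<gamma> + 1) * B (t i) \<omega>))"
          using sums
        proof eventually_elim
          case (elim \<omega>)
          have "(\<Sum>j<Suc (J i). sqrt (T (Suc j) - T j) * cut_off m (\<lambda>j. BM.scaled_increment T j \<omega>) j) = B (t i) \<omega>" if i: "i < k" for i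
          proof -
            have "(\<Sum>j<Suc (J i). sqrt (T (Suc j) - T j) * cut_off m (\<lambda>j. BM.scaled_increment T j \<omega>) j) =
              (\<Sum>j<Suc (J i). sqrt (T (Suc j) - T j) * BM.scaled_increment T j \<omega>)"
              using J(1)[OF i] by (intro sum.cong) (auto simp: cut_off_def)
            also have "\<dots> = B (T (Suc (J i))) \<omega>" using elim J(1)[OF i] by blast
            finally show ?thesis unfolding J(2)[OF i] .
          qed
          then have "cut_off k (\<lambda>i. (2 * \<gamma> + 1) * (\<Sum>j<Suc (J i). sqrt (T (Suc j) - T j) * cut_off m (\<lambda>j. BM.scaled_increment T j \<omega>) j)) =
             cut_off k (\<lambda>i. (2 * \<gamma> + 1) * B (t i) \<omega>)"
            by (intro cut_off_cong) (simp only:)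
          then show ?case by (simp only: G_def)
        qed
      qed
      ultimately show "(\<lambda>n. \<integral>\<omega>. g (cut_off k (\<lambda>i. walk X (nat \<lfloor>exp (ln (real n) powr t i)\<rfloor>) \<omega> / sqrt (exp (ln (real n) powr t i) * ln (real n) powr t i * ln (ln (real n))))) \<partial>M)
         \<longlonglongrightarrow> (\<integral>\<omega>. g (cut_off k (\<lambda>i. (2 * \<gamma> + 1) * B (t i) \<omega>)) \<partial>N')"
        unfolding walk_x[OF g(1)] using lim by simp
    qed
  qed
  from part1 part2 show ?thesis ..
qed

end
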